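(* For each $\mathfrak q$ as in the context there is $\beta_0\in(0,\infty)$ such that the function $r\mapsto\phi_\beta(r)$ on $(1,\infty)$ is not constant for every $\beta>\beta_0$.
   Context: Model: $d\ge1$ is an integer, $s\in(d,2d)$, $|\cdot|$ is a norm on $\mathbb R^d$, and $\mathfrak q\colon\mathbb Z^d\to[0,\infty]$ satisfies $\mathfrak q(x)=\mathfrak q(-x)$ for all $x$, $\mathfrak q(x)=+\infty$ whenever $x$ is a nearest neighbor of the origin in $\mathbb Z^d$, and $\mathfrak q(x)|x|^s\to1$ as $|x|\to\infty$. For $\beta>0$ set $\mathfrak p_\beta(x,y):=1-\exp\{-\beta\,\mathfrak q(x-y)\}$ (with $e^{-\infty}:=0$). The long-range percolation graph has vertex set $\mathbb Z^d$ and, for each pair of distinct $x,y\in\mathbb Z^d$, an undirected edge between $x$ and $y$ is present with probability $\mathfrak p_\beta(x,y)$, independently of other edges; its law is $P_\beta$. $D(x,y)$ is the graph (chemical) distance, i.e. the minimal number of edges of a path in this graph connecting $x$ to $y$. $B(x,r):=\{y\in\mathbb Z^d\colon|x-y|<r\}$, $\#$ is cardinality, $\log$ is the natural logarithm. The functions $\phi_\beta$: with $\gamma:=\frac s{2d}$ and $\Delta:=1/\log_2(2d/s)$, $(\phi_\beta)_{\beta>0}$ is the family (whose existence may be taken as known, and which is uniquely determined by the following properties) of continuous functions $\phi_\beta\colon(1,\infty)\to(0,\infty)$ with $\phi_\beta(r^\gamma)=\phi_\beta(r)$ for all $r>1$, such that $\beta\mapsto\phi_\beta(r)$ is non-increasing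 and left-continuous for each $r>1$ and such that, for some at most countable $\Sigma\subseteq(0,\infty)$ and all $\beta\in(0,\infty)\smallsetminus\Sigma$, the map $\beta\mapsto\phi_\beta(r)$ is continuous at $\beta$ for each $r>1$ and, for all $\epsilon>0$, $r^{-d}\,\#\{x\in B(0,r)\colon |\frac{D(0,x)}{\phi_\beta(r)(\log r)^\Delta}-1|>\epsilon\}\to0$ in $P_\beta$-probability as $r\to\infty$. *)

theory Defs
  imports "HOL-Probability.Probability"
begin

text \<open>
  The lattice \<open>\<int>\<^sup>d\<close> is \<open>int ^ 'n\<close> with \<open>d = CARD('n)\<close>; it sits inside \<open>\<real>\<^sup>d\<close> (\<open>real ^ 'n\<close>)
  through \<open>lattice_vec\<close>.  The norm on \<open>\<real>\<^sup>d\<close> is an arbitrary function \<open>N\<close> satisfying the norm axioms,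
  not the Euclidean norm of the type class.
\<close>

definition lattice_vec :: "int ^ 'n \<Rightarrow> real ^ 'n" where
  "lattice_vec x = (\<chi> i. of_int (x $ i))"

definition is_norm :: "('a :: real_vector \<Rightarrow> real) \<Rightarrow> bool" where
  "is_norm N \<longleftrightarrow>
     (\<forall>v. 0 \<le> N v) \<and>
     (\<forall>v. N v = 0 \<longleftrightarrow> v = 0) \<and>
     (\<forall>c v. N (c *\<^sub>R v) = \<bar>c\<bar> * N v) \<and>
     (\<forall>v w. N (v + w) \<le> N v + N w)"

definition nearest_neighbor_of_origin :: "int ^ 'n \<Rightarrow> bool" where
  "nearest_neighbor_of_origin x \<longleftrightarrow> (\<Sum>i\<in>UNIV. \<bar>x $ i\<bar>) = 1"

definition lattice_ball :: "(real ^ 'n \<Rightarrow> real) \<Rightarrow> int ^ 'n \<Rightarrow> real \<Rightarrow> (int ^ 'n) set" where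
  "lattice_ball N x r = {y. N (lattice_vec (x - y)) < r}"

definition admissible_kernel ::
    "(real ^ 'n \<Rightarrow> real) \<Rightarrow> real \<Rightarrow> (int ^ 'n \<Rightarrow> ennreal) \<Rightarrow> bool" where
  "admissible_kernel N s q \<longleftrightarrow>
     (\<forall>x. q x = q (- x)) \<and>
     (\<forall>x. nearest_neighbor_of_origin x \<longrightarrow> q x = \<infinity>) \<and>
     ((\<lambda>x. q x * ennreal (N (lattice_vec x) powr s)) \<longlongrightarrow> 1)
       (filtercomap (\<lambda>x. N (lattice_vec x)) at_top)"

definition connection_prob ::
    "(int ^ 'n \<Rightarrow> ennreal) \<Rightarrow> real \<Rightarrow> int ^ 'n \<Rightarrow> int ^ 'n \<Rightarrow> real" where
  "connection_prob q \<beta> x y =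
     1 - (if q (x - y) = \<infinity> then 0 else exp (- (\<beta> * enn2real (q (x - y)))))"

text \<open>
  An undirected edge between distinct \<open>x\<close> and \<open>y\<close> is the two-element set \<open>{x, y}\<close>.  For even \<open>q\<close>,
  \<open>edge_prob q \<beta> {x, y}\<close> is \<open>connection_prob q \<beta> x y\<close>, independently of the order of the endpoints.
\<close>

definition lattice_edges :: "(int ^ 'n) set set" where
  "lattice_edges = {{x, y} | x y. x \<noteq> y}"

definition edge_prob :: "(int ^ 'n \<Rightarrow> ennreal) \<Rightarrow> real \<Rightarrow> (int ^ 'n) set \<Rightarrow> real" where
  "edge_prob q \<beta> e = (THE p. \<exists>x y. e = {x, y} \<and> p = connection_prob q \<beta> x y)"

text \<open>
  The law \<open>P\<^sub>\<beta>\<close>: a configuration \<open>\<omega>\<close> tells for each edge whether it is present.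
\<close>

definition percolation_law ::
    "(int ^ 'n \<Rightarrow> ennreal) \<Rightarrow> real \<Rightarrow> ((int ^ 'n) set \<Rightarrow> bool) measure" where
  "percolation_law q \<beta> =
     PiM lattice_edges (\<lambda>e. measure_pmf (bernoulli_pmf (edge_prob q \<beta> e)))"

definition connecting_path :: "('a set \<Rightarrow> bool) \<Rightarrow> 'a \<Rightarrow> 'a \<Rightarrow> 'a list \<Rightarrow> bool" where
  "connecting_path \<omega> x y vs \<longleftrightarrow>
     vs \<noteq> [] \<and> hd vs = x \<and> last vs = y \<and> distinct vs \<and>
     successively (\<lambda>u v. u \<noteq> v \<and> \<omega> {u, v}) vs"

text \<open>The chemical distance; it is \<open>\<infinity>\<close> on configurations where no path connects \<open>x\<close> to \<open>y\<close>.\<close>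

definition chemical_dist :: "('a set \<Rightarrow> bool) \<Rightarrow> 'a \<Rightarrow> 'a \<Rightarrow> enat" where
  "chemical_dist \<omega> x y = (INF vs\<in>{vs. connecting_path \<omega> x y vs}. enat (length vs - 1))"

definition tends_to_zero_in_prob :: "'a measure \<Rightarrow> (real \<Rightarrow> 'a \<Rightarrow> real) \<Rightarrow> bool" where
  "tends_to_zero_in_prob M X \<longleftrightarrow>
     (\<forall>\<delta>>0. ((\<lambda>r. measure M {\<omega>\<in>space M. \<bar>X r \<omega>\<bar> > \<delta>}) \<longlongrightarrow> 0) at_top)"

text \<open>
  The proportion \<open>r\<^sup>-\<^sup>d #{x \<in> B(0,r). \<bar>D(0,x) / (f(r) (log r)\<^sup>\<Delta>) - 1\<bar> > \<epsilon>}\<close>.  The quotient is taken in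
  the extended reals, so a vertex at infinite distance counts as deviating.
\<close>

definition deviating_fraction ::
    "(real ^ 'n \<Rightarrow> real) \<Rightarrow> real \<Rightarrow> (real \<Rightarrow> real) \<Rightarrow> real \<Rightarrow> real
      \<Rightarrow> ((int ^ 'n) set \<Rightarrow> bool) \<Rightarrow> real" where
  "deviating_fraction N \<Delta> f \<epsilon> r \<omega> =
     real (card {x \<in> lattice_ball N 0 r.
        \<bar>ereal_of_enat (chemical_dist \<omega> 0 x) / ereal (f r * ln r powr \<Delta>) - 1\<bar> > ereal \<epsilon>})
     / r ^ CARD('n)"

text \<open>
  The properties characterizing the family \<open>(\<phi>\<^sub>\<beta>)\<^sub>\<beta>\<^sub>>\<^sub>0\<close>; only the values \<open>\<phi> \<beta> r\<close> with \<open>\<beta> > 0\<close> and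
  \<open>r > 1\<close> are relevant.
\<close>

definition is_phi_family ::
    "(real ^ 'n \<Rightarrow> real) \<Rightarrow> real \<Rightarrow> (int ^ 'n \<Rightarrow> ennreal) \<Rightarrow> (real \<Rightarrow> real \<Rightarrow> real) \<Rightarrow> bool" where
  "is_phi_family N s q \<phi> \<longleftrightarrow>
     (let d = real CARD('n); \<gamma> = s / (2 * d); \<Delta> = 1 / log 2 (2 * d / s) in
       (\<forall>\<beta>>0. continuous_on {1<..} (\<phi> \<beta>)) \<and>
       (\<forall>\<beta>>0. \<forall>r>1. 0 < \<phi> \<beta> r) \<and>
       (\<forall>\<beta>>0. \<forall>r>1. \<phi> \<beta> (r powr \<gamma>) = \<phi> \<beta> r) \<and>
       (\<forall>r>1. antimono_on {0<..} (\<lambda>\<beta>. \<phi> \<beta> r)) \<and>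
       (\<forall>r>1. \<forall>\<beta>>0. continuous (at_left \<beta>) (\<lambda>b. \<phi> b r)) \<and>
       (\<exists>\<Sigma> \<subseteq> {0<..}. countable \<Sigma> \<and>
          (\<forall>\<beta> \<in> {0<..} - \<Sigma>.
             (\<forall>r>1. isCont (\<lambda>b. \<phi> b r) \<beta>) \<and>
             (\<forall>\<epsilon>>0. tends_to_zero_in_prob (percolation_law q \<beta>)
                       (deviating_fraction N \<Delta> (\<phi> \<beta>) \<epsilon>)))))"

end

theory Submission
  imports Defs "HOL-Real_Asymp.Real_Asymp"
begin

text \<open>
  Write \<open>\<theta> = d / s \<in> (1/2, 1)\<close>, so that \<open>2 \<theta> = 1 / \<gamma>\<close> and \<open>(2 \<theta>)\<^sup>k\<close> raised to the power \<open>\<Delta>\<close> is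
  \<open>2\<^sup>k\<close>. For large \<open>\<beta>\<close> a vertex at distance \<open>\<beta>\<^sup>t\<close> is reached in \<open>n + m + 1\<close> steps by a single long edge
  between the ball of \<open>n\<close> steps around one endpoint and the ball of \<open>m\<close> steps around the other. If
  these balls have radii \<open>\<beta>\<close> to the powers \<open>\<tau>\<^sub>n\<close> and \<open>\<tau>\<^sub>m\<close>, such an edge is typically present as long as
  \<open>s t < 1 + d (\<tau>\<^sub>n + \<tau>\<^sub>m)\<close>. With \<open>a\<^sub>n = 1 + (2 d - s) \<tau>\<close>, where \<open>\<tau>\<close> belongs to \<open>n - 1\<close> steps, the optimal
  exponents satisfy \<open>a\<^sub>1 = 1\<close> and \<open>a\<^sub>m = \<theta> max (a\<^sub>i + a\<^sub>j)\<close> over \<open>i + j = m\<close>. The solution equals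
  \<open>(2 \<theta>)\<^sup>k\<close> at \<open>m = 2\<^sup>k\<close> and is affine between consecutive powers of two: the best strategy stays
  dyadic down to the unit scale. If \<open>\<phi>\<^sub>\<beta>\<close> were constant, then for large \<open>m\<close> the value \<open>a\<^sub>m\<close> would be a
  constant multiple of \<open>m\<close> to the power \<open>1 / \<Delta>\<close>, up to a relative error that vanishes as \<open>\<beta>\<close> grows. That power is
  strictly concave, hence lies strictly above its chords, and the values at \<open>2\<^sup>k\<close> and \<open>3 \<cdot> 2\<^sup>k\<^sup>-\<^sup>1\<close> are
  incompatible: in terms of \<open>\<theta>\<close> this is \<open>(\<theta> + 1 / 2)\<close> to the power \<open>\<Delta>\<close> being less than \<open>3 / 2\<close>
  (\<open>midpoint_defect\<close>).

  Only these two points are compared, which needs two one-sided estimates at all large scales.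

  The lower bound for distances (\<open>phi_ge\<close>) is a first-moment bound for the size of the balls. A path of
  at most \<open>n\<close> edges between points at distance \<open>r\<close> contains an edge of length at least \<open>r / n\<close>; the three
  pieces of the path occur disjointly, so their probabilities multiply (\<open>disjoint_occurrence\<close>, a van den
  Berg--Kesten inequality). Summing over the endpoint, with probabilities capped by one, the
  expected ball sizes satisfy the recursion above with an additional logarithmic error
  (\<open>expected_ball_le\<close>). Every chord of the dyadic profile is an upper bound for its solution, and a chord
  at level \<open>k\<close> follows from the chord at level \<open>k - 1\<close> because chords are affine.

  The upper bound (\<open>phi_le\<close>) renormalises the expectation of the distance, not a probability, so that
  nothing is lost when the recursion branches: if some edge joins the two smaller boxes, the distance is
  at most the sum of two independent smaller distances plus one, and otherwise a nearest-neighbour path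
  is used, which costs little because the absence of every edge is unlikely (\<open>expected_dist_le\<close>).

  Exceptional \<open>\<beta> \<in> \<Sigma>\<close> are sandwiched between two nearby non-exceptional values by monotonicity.
\<close>

section \<open>Independent edges and disjoint occurrence\<close>

lemma emeasure_UN_le_nn_integral:
  assumes "countable I" "\<And>i. i \<in> I \<Longrightarrow> A i \<in> sets M"
  shows "emeasure M (\<Union>i\<in>I. A i) \<le> (\<integral>\<^sup>+i. emeasure M (A i) \<partial>count_space I)"
proof -
  have "emeasure M (\<Union>i\<in>I. A i) = (\<integral>\<^sup>+x. indicator (\<Union>i\<in>I. A i) x \<partial>M)"
    using assms by (subst nn_integral_indicator) auto
  also have "\<dots> \<le> (\<integral>\<^sup>+x. \<integral>\<^sup>+i. indicator (A i) x \<partial>count_space I \<partial>M)"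
  proof (rule nn_integral_mono)
    fix x
    show "indicator (\<Union>i\<in>I. A i) x \<le> (\<integral>\<^sup>+i. indicator (A i) x \<partial>count_space I)"
    proof (cases "x \<in> (\<Union>i\<in>I. A i)")
      case True
      then obtain i where i: "i \<in> I" "x \<in> A i" by auto
      have "(1::ennreal) = (\<integral>\<^sup>+j. indicator {i} j \<partial>count_space I)"
        using i by (subst nn_integral_indicator) auto
      also have "\<dots> \<le> (\<integral>\<^sup>+i. indicator (A i) x \<partial>count_space I)"
        using i by (intro nn_integral_mono) (auto simp: indicator_def)
      finally show ?thesis using True by simp
    qed auto
  qed
  also have "\<dots> = (\<integral>\<^sup>+i. \<integral>\<^sup>+x. indicator (A i) x \<partial>M \<partial>count_space I)"
    using assms by (intro nn_integral_count_space_nn_integral) auto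
  also have "\<dots> = (\<integral>\<^sup>+i. emeasure M (A i) \<partial>count_space I)"
    using assms by (intro nn_integral_cong) auto
  finally show ?thesis .
qed

locale bernoulli_field =
  fixes I :: "'e set" and B :: "'e \<Rightarrow> bool pmf"
begin

definition law :: "('e \<Rightarrow> bool) measure" where
  "law = PiM I (\<lambda>e. measure_pmf (B e))"

definition all_open :: "'e set \<Rightarrow> ('e \<Rightarrow> bool) \<Rightarrow> bool" where
  "all_open S \<omega> \<longleftrightarrow> (\<forall>e\<in>S. \<omega> e)"

abbreviation some_open :: "'e set set \<Rightarrow> ('e \<Rightarrow> bool) set" where
  "some_open C \<equiv> {\<omega> \<in> space law. \<exists>S\<in>C. all_open S \<omega>}"

abbreviation both_open :: "('e set \<times> 'e set) set \<Rightarrow> ('e \<Rightarrow> bool) set" where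
  "both_open F \<equiv> {\<omega> \<in> space law. \<exists>(S,T)\<in>F. all_open S \<omega> \<and> all_open T \<omega>}"

abbreviation p :: "'e \<Rightarrow> real" where "p e \<equiv> pmf (B e) True"

lemma pmf_False: "pmf (B e) False = 1 - p e"
proof -
  have "(\<Sum>x\<in>UNIV. pmf (B e) x) = 1" by (rule sum_pmf_eq_1) auto
  then show ?thesis by (simp add: UNIV_bool)
qed

lemma p_range: "0 \<le> p e" "p e \<le> 1" by (auto simp: pmf_le_1)

sublocale product_prob_space "\<lambda>e. measure_pmf (B e)" I
  by unfold_locales

sublocale law: prob_space law
  unfolding law_def by (rule P.prob_space_axioms)

lemma coord_measurable [measurable]:
  assumes "e \<in> I" shows "{\<omega> \<in> space law. \<omega> e} \<in> sets law"
proof -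
  have "(\<lambda>\<omega>. \<omega> e) \<in> measurable law (measure_pmf (B e))"
    unfolding law_def using assms by simp
  from measurable_sets[OF this, of "{True}"] show ?thesis
    by (simp add: vimage_def Int_def conj_commute)
qed

lemma all_open_sets:
  assumes "finite S" "S \<subseteq> I" shows "{\<omega> \<in> space law. all_open S \<omega>} \<in> sets law"
  unfolding all_open_def using assms
  by (intro sets.sets_Collect_finite_All) auto

lemma prob_pattern:
  assumes "finite E" "E \<subseteq> I" "U \<subseteq> E"
  shows "law.prob {\<omega> \<in> space law. {e\<in>E. \<omega> e} = U} = (\<Prod>e\<in>U. p e) * (\<Prod>e\<in>E-U. 1 - p e)"
proof -
  have "{\<omega> \<in> space law. {e\<in>E. \<omega> e} = U} = {\<omega> \<in> space law. \<forall>e\<in>E. \<omega> e \<in> {e \<in> U}}"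
    using assms by auto
  also have "emeasure law \<dots> = (\<Prod>e\<in>E. emeasure (measure_pmf (B e)) {e \<in> U})"
    unfolding law_def by (rule emeasure_PiM_Collect) (use assms in auto)
  also have "\<dots> = ennreal (\<Prod>e\<in>E. if e \<in> U then p e else 1 - p e)"
    by (subst prod_ennreal[symmetric])
      (auto simp: emeasure_pmf_single pmf_False p_range intro!: prod.cong)
  also have "(\<Prod>e\<in>E. if e \<in> U then p e else 1 - p e) = (\<Prod>e\<in>U. p e) * (\<Prod>e\<in>E-U. 1 - p e)"
    using assms by (subst prod.If_cases) (auto simp: Int_absorb1 Diff_eq)
  finally show ?thesis
    by (subst measure_def) (auto simp: p_range intro!: enn2real_ennreal mult_nonneg_nonneg prod_nonneg)
qed

lemma pattern_sets:
  assumes "finite E" "E \<subseteq> I"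
  shows "{\<omega> \<in> space law. Q {e\<in>E. \<omega> e}} \<in> sets law"
proof -
  have "{\<omega> \<in> space law. Q {e\<in>E. \<omega> e}} = (\<Union>U\<in>{U\<in>Pow E. Q U}. {\<omega> \<in> space law. {e\<in>E. \<omega> e} = U})"
    by auto
  also have "\<dots> \<in> sets law"
  proof (rule sets.finite_UN)
    show "finite {U \<in> Pow E. Q U}" using assms by auto
    show "{\<omega> \<in> space law. {e\<in>E. \<omega> e} = U} \<in> sets law" if "U \<in> {U \<in> Pow E. Q U}" for U
    proof -
      have "{\<omega> \<in> space law. {e\<in>E. \<omega> e} = U} = {\<omega> \<in> space law. \<forall>e\<in>E. \<omega> e \<longleftrightarrow> e \<in> U}"
        using that by auto
      also have "\<dots> \<in> sets law"
        using assms by (intro sets.sets_Collect_finite_All sets.sets_Collect) auto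
      finally show ?thesis .
    qed
  qed
  finally show ?thesis .
qed

text \<open>
  The mean of \<open>f\<close> over a random subset of \<open>E\<close> that contains each \<open>e\<close> independently with probability
  \<open>p e\<close>. As a finite sum it can be expanded one coordinate at a time, which the induction in
  \<open>disjoint_occurrence_cube\<close> relies on.
\<close>

definition cube_mean :: "'e set \<Rightarrow> ('e set \<Rightarrow> real) \<Rightarrow> real" where
  "cube_mean E f = (\<Sum>U\<in>Pow E. (\<Prod>e\<in>U. p e) * (\<Prod>e\<in>E-U. 1 - p e) * f U)"

lemma prob_eq_cube_mean:
  assumes "finite E" "E \<subseteq> I"
  shows "law.prob {\<omega> \<in> space law. Q {e\<in>E. \<omega> e}} = cube_mean E (\<lambda>U. of_bool (Q U))"
proof -
  have "{\<omega> \<in> space law. Q {e\<in>E. \<omega> e}} = (\<Union>U\<in>{U\<in>Pow E. Q U}. {\<omega> \<in> space law. {e\<in>E. \<omega> e} = U})"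
    by auto
  also have "law.prob \<dots> = (\<Sum>U\<in>{U\<in>Pow E. Q U}. law.prob {\<omega> \<in> space law. {e\<in>E. \<omega> e} = U})"
    using assms by (intro law.finite_measure_finite_Union)
      (auto simp: disjoint_family_on_def intro!: pattern_sets[where Q="\<lambda>V. V = _"])
  also have "\<dots> = (\<Sum>U\<in>{U\<in>Pow E. Q U}. (\<Prod>e\<in>U. p e) * (\<Prod>e\<in>E-U. 1 - p e))"
    using assms by (intro sum.cong prob_pattern) auto
  also have "\<dots> = (\<Sum>U\<in>{U\<in>Pow E. Q U}. (\<Prod>e\<in>U. p e) * (\<Prod>e\<in>E-U. 1 - p e) * of_bool (Q U))"
    by (intro sum.cong) auto
  also have "\<dots> = cube_mean E (\<lambda>U. of_bool (Q U))"
    unfolding cube_mean_def using assms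
    by (intro sum.mono_neutral_left) auto
  finally show ?thesis .
qed

lemma cube_mean_mono:
  assumes "\<And>U. U \<subseteq> E \<Longrightarrow> f U \<le> g U"
  shows "cube_mean E f \<le> cube_mean E g"
  unfolding cube_mean_def using assms
  by (intro sum_mono mult_left_mono mult_nonneg_nonneg prod_nonneg) (auto simp: p_range)

lemma cube_mean_cong:
  "(\<And>U. U \<subseteq> E \<Longrightarrow> f U = g U) \<Longrightarrow> cube_mean E f = cube_mean E g"
  unfolding cube_mean_def by (intro sum.cong) auto

lemma cube_mean_add: "cube_mean E (\<lambda>U. f U + g U) = cube_mean E f + cube_mean E g"
  unfolding cube_mean_def by (simp add: algebra_simps sum.distrib)

lemma cube_mean_cmult: "cube_mean E (\<lambda>U. c * f U) = c * cube_mean E f"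
  unfolding cube_mean_def by (simp add: algebra_simps sum_distrib_left)

lemma cube_mean_multc: "cube_mean E (\<lambda>U. f U * c) = cube_mean E f * c"
  using cube_mean_cmult[of E c f] by (simp add: mult.commute)

lemma cube_mean_insert:
  assumes "finite E" "e \<notin> E"
  shows "cube_mean (insert e E) f
    = p e * cube_mean E (\<lambda>U. f (insert e U)) + (1 - p e) * cube_mean E f"
proof -
  let ?w = "\<lambda>E U. (\<Prod>e\<in>U. p e) * (\<Prod>e\<in>E-U. 1 - p e)"
  have inj: "inj_on (insert e) (Pow E)" using assms by (auto simp: inj_on_def)
  have "cube_mean (insert e E) f
      = (\<Sum>U\<in>Pow E. ?w (insert e E) U * f U) + (\<Sum>U\<in>insert e ` Pow E. ?w (insert e E) U * f U)"
    unfolding cube_mean_def Pow_insert using assms by (intro sum.union_disjoint) auto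
  also have "(\<Sum>U\<in>Pow E. ?w (insert e E) U * f U) = (\<Sum>U\<in>Pow E. (1 - p e) * (?w E U * f U))"
  proof (intro sum.cong refl)
    fix U assume U: "U \<in> Pow E"
    then have "insert e E - U = insert e (E - U)" using assms by auto
    then show "?w (insert e E) U * f U = (1 - p e) * (?w E U * f U)"
      using assms by simp
  qed
  also have "(\<Sum>U\<in>insert e ` Pow E. ?w (insert e E) U * f U)
      = (\<Sum>U\<in>Pow E. p e * (?w E U * f (insert e U)))"
    unfolding sum.reindex[OF inj] o_def
  proof (intro sum.cong refl)
    fix U assume U: "U \<in> Pow E"
    then have "insert e E - insert e U = E - U" "e \<notin> U" "finite U"
      using assms by (auto intro: finite_subset)
    then show "?w (insert e E) (insert e U) * f (insert e U) = p e * (?w E U * f (insert e U))"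
      by simp
  qed
  finally show ?thesis
    unfolding cube_mean_def by (simp add: sum_distrib_left)
qed

text \<open>
  The two sets of a pair never share a coordinate, so they may be read off two independent copies
  of the configuration, and this can only help. The copies are separated one coordinate at a time.
  Write \<open>Q U V\<close> for the event that some pair has its first set in \<open>U\<close> and its second in \<open>V\<close>. Then
  separating \<open>e\<close> does not decrease the mean because
  \<open>Q (U + e) (V + e) + Q U V \<le> Q (U + e) V + Q U (V + e)\<close>.
\<close>

lemma disjoint_occurrence_cube:
  assumes "finite E" "\<And>S T. (S, T) \<in> F \<Longrightarrow> S \<subseteq> E \<and> T \<subseteq> E \<and> S \<inter> T = {}"
  shows "cube_mean E (\<lambda>U. of_bool (\<exists>(S,T)\<in>F. S \<subseteq> U \<and> T \<subseteq> U))
       \<le> cube_mean E (\<lambda>U. cube_mean E (\<lambda>V. of_bool (\<exists>(S,T)\<in>F. S \<subseteq> U \<and> T \<subseteq> V)))"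
  using assms
proof (induction E arbitrary: F rule: finite_induct)
  case empty
  then have "F \<subseteq> {({}, {})}" by auto
  then show ?case by (auto simp: cube_mean_def subset_singleton_iff)
next
  case (insert e E)
  define Q :: "'e set \<Rightarrow> 'e set \<Rightarrow> real" where "Q U V = of_bool (\<exists>(S,T)\<in>F. S \<subseteq> U \<and> T \<subseteq> V)" for U V :: "'e set"
  define A where "A f g = cube_mean E (\<lambda>U. cube_mean E (\<lambda>V. Q (f U) (g V)))"
    for f g :: "'e set \<Rightarrow> 'e set"
  let ?i = "insert e" and ?n = "\<lambda>U::'e set. U"
  define F1 where "F1 = (\<lambda>(S,T). (S - {e}, T - {e})) ` F"
  define F0 where "F0 = {(S,T)\<in>F. e \<notin> S \<and> e \<notin> T}"
  have Q1: "Q (insert e U) (insert e V) = of_bool (\<exists>(S,T)\<in>F1. S \<subseteq> U \<and> T \<subseteq> V)" for U V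
    unfolding Q_def F1_def by (simp add: Diff_subset_conv split_beta)
  have Q0: "Q U V = of_bool (\<exists>(S,T)\<in>F0. S \<subseteq> U \<and> T \<subseteq> V)" if "U \<subseteq> E" "V \<subseteq> E" for U V
  proof -
    have "e \<notin> U" "e \<notin> V" using that \<open>e \<notin> E\<close> by auto
    then have "(P \<in> F \<and> fst P \<subseteq> U \<and> snd P \<subseteq> V) \<longleftrightarrow> (P \<in> F0 \<and> fst P \<subseteq> U \<and> snd P \<subseteq> V)" for P
      unfolding F0_def split_beta mem_Collect_eq prod.collapse by blast
    then show ?thesis unfolding Q_def Bex_def split_beta by presburger
  qed
  have F1E: "S \<subseteq> E \<and> T \<subseteq> E \<and> S \<inter> T = {}" if "(S, T) \<in> F1" for S T
  proof -
    from that obtain S' T' where ST: "(S', T') \<in> F" "S = S' - {e}" "T = T' - {e}"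
      unfolding F1_def by (elim imageE) (simp add: split_beta, metis prod.collapse)
    from insert.prems[OF ST(1)] show ?thesis unfolding ST(2,3) by blast
  qed
  have F0E: "S \<subseteq> E \<and> T \<subseteq> E \<and> S \<inter> T = {}" if "(S, T) \<in> F0" for S T
  proof -
    from that have ST: "(S, T) \<in> F" "e \<notin> S" "e \<notin> T" unfolding F0_def by simp_all
    from insert.prems[OF ST(1)] ST(2,3) show ?thesis by blast
  qed
  have IH1: "cube_mean E (\<lambda>U. Q (?i U) (?i U)) \<le> A ?i ?i"
    unfolding Q1 A_def by (rule insert.IH) (use F1E in metis)
  have IH0: "cube_mean E (\<lambda>U. Q U U) \<le> A ?n ?n"
  proof -
    have "cube_mean E (\<lambda>U. of_bool (\<exists>(S,T)\<in>F0. S \<subseteq> U \<and> T \<subseteq> U))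
       \<le> cube_mean E (\<lambda>U. cube_mean E (\<lambda>V. of_bool (\<exists>(S,T)\<in>F0. S \<subseteq> U \<and> T \<subseteq> V)))"
      by (rule insert.IH) (use F0E in metis)
    then show ?thesis
      unfolding A_def by (simp add: Q0 cong: cube_mean_cong)
  qed
  \<comment> \<open>A disjoint pair uses the coordinate e on at most one side.\<close>
  have key: "A ?i ?i + A ?n ?n \<le> A ?i ?n + A ?n ?i"
  proof -
    have "Q (?i U) (?i V) + Q U V \<le> Q (?i U) V + Q U (?i V)" for U V
    proof -
      have mono: "Q U V \<le> Q U' V'" if "U \<subseteq> U'" "V \<subseteq> V'" for U V U' V'
      proof -
        have *: "of_bool P \<le> (of_bool R :: real)" if "P \<Longrightarrow> R" for P R
          using that by (cases P) auto
        show ?thesis unfolding Q_def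
        proof (rule *)
          assume "\<exists>(S,T)\<in>F. S \<subseteq> U \<and> T \<subseteq> V"
          then obtain S T where "(S,T) \<in> F" "S \<subseteq> U" "T \<subseteq> V" by auto
          moreover from this that have "S \<subseteq> U'" "T \<subseteq> V'" by auto
          ultimately show "\<exists>(S,T)\<in>F. S \<subseteq> U' \<and> T \<subseteq> V'" by auto
        qed
      qed
      have "Q U V \<le> Q (?i U) V" "Q U V \<le> Q U (?i V)" by (auto intro!: mono)
      moreover have "Q (?i U) (?i V) \<le> max (Q (?i U) V) (Q U (?i V))"
      proof (cases "Q (?i U) (?i V) = 0")
        case False
        then obtain S T where ST: "(S, T) \<in> F" "S \<subseteq> ?i U" "T \<subseteq> ?i V"
          by (auto simp: Q_def)
        with insert.prems have "e \<notin> S \<or> e \<notin> T" by blast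
        then have "S \<subseteq> U \<or> T \<subseteq> V" using ST by blast
        then have "Q (?i U) V = 1 \<or> Q U (?i V) = 1" using ST by (auto simp: Q_def)
        moreover have "of_bool P \<in> {0, 1::real}" for P by (cases P) auto
        then have "Q a b \<in> {0,1}" for a b unfolding Q_def .
        ultimately show ?thesis by (auto simp: Q_def max_def)
      qed (auto simp: Q_def max_def)
      moreover have "Q a b \<ge> 0" for a b by (simp add: Q_def)
      ultimately show ?thesis by (smt (verit))
    qed
    then have "cube_mean E (\<lambda>U. cube_mean E (\<lambda>V. Q (?i U) (?i V) + Q U V))
        \<le> cube_mean E (\<lambda>U. cube_mean E (\<lambda>V. Q (?i U) V + Q U (?i V)))"
      by (intro cube_mean_mono)
    then show ?thesis by (simp add: A_def cube_mean_add)
  qed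
  have q: "0 \<le> p e * (1 - p e)" by (simp add: p_range)
  have "cube_mean (?i E) (\<lambda>U. Q U U)
      = p e * cube_mean E (\<lambda>U. Q (?i U) (?i U)) + (1 - p e) * cube_mean E (\<lambda>U. Q U U)"
    by (rule cube_mean_insert) (use insert in auto)
  also have "\<dots> \<le> p e * A ?i ?i + (1 - p e) * A ?n ?n"
    using IH1 IH0 by (intro add_mono mult_left_mono) (auto simp: p_range)
  also have "\<dots> \<le> p e * (p e * A ?i ?i + (1 - p e) * A ?i ?n)
      + (1 - p e) * (p e * A ?n ?i + (1 - p e) * A ?n ?n)"
    using mult_left_mono[OF key q] by (simp add: algebra_simps)
  also have "\<dots> = cube_mean (?i E) (\<lambda>U. cube_mean (?i E) (\<lambda>V. Q U V))"
    using insert.hyps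
    by (simp add: cube_mean_insert cube_mean_add cube_mean_cmult A_def) (simp add: algebra_simps)
  finally show ?case unfolding Q_def .
qed

lemma disjoint_occurrence_finite:
  assumes fin: "finite F" and F: "\<And>S T. (S, T) \<in> F \<Longrightarrow> finite S \<and> finite T \<and> S \<subseteq> I \<and> T \<subseteq> I \<and> S \<inter> T = {}"
  shows "law.prob (both_open F)
    \<le> law.prob (some_open (fst ` F)) * law.prob (some_open (snd ` F))"
proof -
  define E where "E = (\<Union>(S,T)\<in>F. S \<union> T)"
  have F': "finite (fst P)" "finite (snd P)" "fst P \<subseteq> I" "snd P \<subseteq> I" if "P \<in> F" for P
    using F[of "fst P" "snd P"] that by simp_all
  have E: "finite E" "E \<subseteq> I"
    unfolding E_def split_beta using fin F' by (simp_all add: UN_least)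
  have sub: "S \<subseteq> E" "T \<subseteq> E" if "(S,T) \<in> F" for S T
    using UN_upper[OF that, of "\<lambda>(S,T). S \<union> T"] unfolding E_def by simp_all
  have sub': "S \<subseteq> E" if "S \<in> fst ` F \<or> S \<in> snd ` F" for S
    using that sub by (metis imageE prod.collapse)
  have op: "all_open S \<omega> \<longleftrightarrow> S \<subseteq> {e\<in>E. \<omega> e}" if "S \<subseteq> E" for S \<omega>
    using that by (auto simp: all_open_def)
  have "(\<exists>(S,T)\<in>F. all_open S \<omega> \<and> all_open T \<omega>)
      \<longleftrightarrow> (\<exists>(S,T)\<in>F. S \<subseteq> {e\<in>E. \<omega> e} \<and> T \<subseteq> {e\<in>E. \<omega> e})" for \<omega>
  proof (rule bex_cong[OF refl])
    fix x assume "x \<in> F"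
    obtain S T where x: "x = (S, T)" by (cases x)
    with \<open>x \<in> F\<close> have "S \<subseteq> E" "T \<subseteq> E" using sub by auto
    then show "(case x of (S,T) \<Rightarrow> all_open S \<omega> \<and> all_open T \<omega>)
      \<longleftrightarrow> (case x of (S,T) \<Rightarrow> S \<subseteq> {e\<in>E. \<omega> e} \<and> T \<subseteq> {e\<in>E. \<omega> e})"
      unfolding x using op by simp
  qed
  then have "law.prob (both_open F)
      = law.prob {\<omega> \<in> space law. \<exists>(S,T)\<in>F. S \<subseteq> {e\<in>E. \<omega> e} \<and> T \<subseteq> {e\<in>E. \<omega> e}}"
    by presburger
  also have "\<dots> = cube_mean E (\<lambda>U. of_bool (\<exists>(S,T)\<in>F. S \<subseteq> U \<and> T \<subseteq> U))"
    by (rule prob_eq_cube_mean[OF E])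
  also have "\<dots> \<le> cube_mean E (\<lambda>U. cube_mean E (\<lambda>V. of_bool (\<exists>(S,T)\<in>F. S \<subseteq> U \<and> T \<subseteq> V)))"
    by (rule disjoint_occurrence_cube) (use E F sub in auto)
  also have "\<dots> \<le> cube_mean E (\<lambda>U. cube_mean E (\<lambda>V. of_bool (\<exists>S\<in>fst ` F. S \<subseteq> U) * of_bool (\<exists>T\<in>snd ` F. T \<subseteq> V)))"
  proof (intro cube_mean_mono)
    fix U V
    have *: "of_bool P \<le> of_bool Q * (of_bool R :: real)" if "P \<Longrightarrow> Q \<and> R" for P Q R
      using that by (cases P) auto
    show "of_bool (\<exists>(S,T)\<in>F. S \<subseteq> U \<and> T \<subseteq> V)
        \<le> of_bool (\<exists>S\<in>fst ` F. S \<subseteq> U) * (of_bool (\<exists>T\<in>snd ` F. T \<subseteq> V) :: real)"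
    proof (rule *)
      assume "\<exists>(S,T)\<in>F. S \<subseteq> U \<and> T \<subseteq> V"
      then obtain S T where "(S,T) \<in> F" "S \<subseteq> U" "T \<subseteq> V" by auto
      then show "(\<exists>S\<in>fst ` F. S \<subseteq> U) \<and> (\<exists>T\<in>snd ` F. T \<subseteq> V)" by (force simp: image_iff)
    qed
  qed
  also have "\<dots> = cube_mean E (\<lambda>U. of_bool (\<exists>S\<in>fst ` F. S \<subseteq> U)) * cube_mean E (\<lambda>V. of_bool (\<exists>T\<in>snd ` F. T \<subseteq> V))"
    by (simp add: cube_mean_cmult cube_mean_multc)
  also have "cube_mean E (\<lambda>U. of_bool (\<exists>S\<in>fst ` F. S \<subseteq> U))
      = law.prob {\<omega> \<in> space law. \<exists>S\<in>fst ` F. S \<subseteq> {e\<in>E. \<omega> e}}"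
    by (rule prob_eq_cube_mean[OF E, symmetric])
  also have "\<dots> = law.prob (some_open (fst ` F))"
  proof -
    have "(\<exists>S\<in>fst ` F. S \<subseteq> {e\<in>E. \<omega> e}) \<longleftrightarrow> (\<exists>S\<in>fst ` F. all_open S \<omega>)" for \<omega>
      by (rule bex_cong[OF refl]) (use op sub' in metis)
    then show ?thesis by presburger
  qed
  also have "cube_mean E (\<lambda>U. of_bool (\<exists>S\<in>snd ` F. S \<subseteq> U))
      = law.prob {\<omega> \<in> space law. \<exists>S\<in>snd ` F. S \<subseteq> {e\<in>E. \<omega> e}}"
    by (rule prob_eq_cube_mean[OF E, symmetric])
  also have "\<dots> = law.prob (some_open (snd ` F))"
  proof -
    have "(\<exists>S\<in>snd ` F. S \<subseteq> {e\<in>E. \<omega> e}) \<longleftrightarrow> (\<exists>S\<in>snd ` F. all_open S \<omega>)" for \<omega>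
      by (rule bex_cong[OF refl]) (use op sub' in metis)
    then show ?thesis by presburger
  qed
  finally show ?thesis .
qed

lemma some_open_sets:
  assumes "countable C" "\<And>S. S \<in> C \<Longrightarrow> finite S \<and> S \<subseteq> I"
  shows "some_open C \<in> sets law"
proof -
  have "some_open C = (\<Union>S\<in>C. {\<omega> \<in> space law. all_open S \<omega>})"
    by auto
  also have "\<dots> \<in> sets law"
    using assms by (intro sets.countable_UN'') (auto intro!: all_open_sets)
  finally show ?thesis .
qed

text \<open>
  The van den Berg--Kesten inequality for events of the form ``some set of a family is open'', where
  disjointness is built into the pairs of finite sets. The countable case is the limit of the finite one.
\<close>

theorem disjoint_occurrence:
  assumes count: "countable F"
    and F: "\<And>S T. (S, T) \<in> F \<Longrightarrow> finite S \<and> finite T \<and> S \<subseteq> I \<and> T \<subseteq> I \<and> S \<inter> T = {}"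
  shows "law.prob (both_open F)
    \<le> law.prob (some_open (fst ` F)) * law.prob (some_open (snd ` F))"
    (is "?L \<le> ?R")
proof (cases "F = {}")
  case False
  have F': "finite (fst P)" "finite (snd P)" "fst P \<subseteq> I" "snd P \<subseteq> I" if "P \<in> F" for P
    using F[of "fst P" "snd P"] that by simp_all
  define f where "f = from_nat_into F"
  have rf: "range f = F" unfolding f_def by (rule range_from_nat_into[OF False count])
  define A where "A n = {\<omega> \<in> space law. \<exists>k\<in>{..n}. all_open (fst (f k) \<union> snd (f k)) \<omega>}" for n
  have fF: "f k \<in> F" for k using rf by blast
  have As: "A n \<in> sets law" for n
    unfolding A_def
    by (intro sets.sets_Collect_finite_Ex all_open_sets) (use F'[OF fF] in simp_all)
  have inc: "incseq A"
    by (rule incseq_SucI) (auto simp: A_def intro: le_SucI)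
  have open_Un: "all_open (S \<union> T) \<omega> \<longleftrightarrow> all_open S \<omega> \<and> all_open T \<omega>" for S T \<omega>
    unfolding all_open_def by blast
  have "(\<exists>(S,T)\<in>F. all_open S \<omega> \<and> all_open T \<omega>) \<longleftrightarrow> (\<exists>k. all_open (fst (f k) \<union> snd (f k)) \<omega>)" for \<omega>
    unfolding rf[symmetric] open_Un split_beta by simp
  then have U: "(\<Union>n. A n) = (both_open F)"
    unfolding A_def by auto
  have A_eq: "A n = {\<omega> \<in> space law. \<exists>(S,T)\<in>f ` {..n}. all_open S \<omega> \<and> all_open T \<omega>}" for n
    unfolding A_def open_Un split_beta by simp
  have "(\<lambda>n. law.prob (A n)) \<longlonglongrightarrow> law.prob (\<Union>n. A n)"
    using As inc by (intro law.finite_Lim_measure_incseq) auto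
  moreover have "law.prob (A n) \<le> ?R" for n
  proof -
    have sub: "f ` {..n} \<subseteq> F" using rf by auto
    have "law.prob (A n) \<le> law.prob {\<omega> \<in> space law. \<exists>S\<in>fst ` f ` {..n}. all_open S \<omega>}
         * law.prob {\<omega> \<in> space law. \<exists>T\<in>snd ` f ` {..n}. all_open T \<omega>}"
      unfolding A_eq by (rule disjoint_occurrence_finite[OF _ F]) (use sub in \<open>simp, blast\<close>)
    also have "\<dots> \<le> ?R"
    proof (intro mult_mono law.finite_measure_mono)
      have fst_F: "finite S \<and> S \<subseteq> I" if "S \<in> fst ` F" for S
        using that by (elim imageE) (simp add: F')
      have snd_F: "finite S \<and> S \<subseteq> I" if "S \<in> snd ` F" for S
        using that by (elim imageE) (simp add: F')
      show "some_open (fst ` F) \<in> sets law"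
        by (rule some_open_sets[OF countable_image[OF count] fst_F])
      show "some_open (snd ` F) \<in> sets law"
        by (rule some_open_sets[OF countable_image[OF count] snd_F])
    qed (use sub in \<open>auto intro: image_mono\<close>)
    finally show ?thesis .
  qed
  ultimately show ?thesis unfolding U by (intro LIMSEQ_le_const2) auto
qed simp

end

section \<open>The lattice and simple paths\<close>

text \<open>
  All geometric estimates use the maximum norm with natural number values: boxes are then products of
  intervals and have an explicit cardinality. The given norm enters only through its equivalence with
  this one.
\<close>

definition sup_norm :: "int ^ 'n \<Rightarrow> nat" where
  "sup_norm x = Max (range (\<lambda>i. nat \<bar>x $ i\<bar>))"

lemma sup_norm_le_iff: "sup_norm x \<le> n \<longleftrightarrow> (\<forall>i. \<bar>x $ i\<bar> \<le> int n)"
  unfolding sup_norm_def by (subst Max_le_iff) (auto simp: nat_le_iff)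

lemma sup_norm_eq_0: "sup_norm x = 0 \<longleftrightarrow> x = 0"
  using sup_norm_le_iff[of x 0] by (simp add: vec_eq_iff)

lemma sup_norm_0 [simp]: "sup_norm 0 = 0"
  by (simp add: sup_norm_eq_0)

lemma coord_le_sup_norm: "\<bar>x $ i\<bar> \<le> int (sup_norm x)"
  using sup_norm_le_iff[of x "sup_norm x"] by simp

lemma sup_norm_triangle: "sup_norm (x + y) \<le> sup_norm x + sup_norm y"
proof -
  have "\<bar>(x + y) $ i\<bar> \<le> int (sup_norm x + sup_norm y)" for i
    using coord_le_sup_norm[of x i] coord_le_sup_norm[of y i] by simp
  then show ?thesis by (simp only: sup_norm_le_iff) blast
qed

lemma sup_norm_commute: "sup_norm (x - y) = sup_norm (y - x)"
  unfolding sup_norm_def by (simp add: abs_minus_commute)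

lemma sup_norm_triangle_diff: "sup_norm (x - z) \<le> sup_norm (x - y) + sup_norm (y - z)"
  using sup_norm_triangle[of "x - y" "y - z"] by simp

definition sup_box :: "int ^ 'n \<Rightarrow> nat \<Rightarrow> (int ^ 'n) set" where
  "sup_box a n = {x. sup_norm (x - a) \<le> n}"

lemma
  shows finite_sup_box: "finite (sup_box (a :: int ^ 'n) n)"
    and card_sup_box: "card (sup_box (a :: int ^ 'n) n) = (2 * n + 1) ^ CARD('n)"
proof -
  define P where "P = PiE UNIV (\<lambda>i::'n. {a $ i - int n .. a $ i + int n})"
  have eq: "sup_box a n = vec_lambda ` P"
  proof (intro set_eqI iffI)
    fix x assume "x \<in> sup_box a n"
    then have "\<bar>(x - a) $ i\<bar> \<le> int n" for i unfolding sup_box_def sup_norm_le_iff by simp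
    then have "vec_nth x \<in> P" unfolding P_def by (auto simp: PiE_UNIV_domain abs_le_iff) (smt (verit))+
    then show "x \<in> vec_lambda ` P" by (metis image_eqI vec_nth_inverse)
  next
    fix x assume "x \<in> vec_lambda ` P"
    then show "x \<in> sup_box a n" unfolding sup_box_def sup_norm_le_iff P_def
      by (auto simp: PiE_UNIV_domain abs_le_iff Pi_iff) (smt (verit))+
  qed
  have "inj_on vec_lambda P" by (auto simp: inj_on_def vec_lambda_inject)
  moreover have "finite P" unfolding P_def by (intro finite_PiE) auto
  moreover have "card P = (2 * n + 1) ^ CARD('n)"
  proof -
    have "nat (2 * int n + 1) = Suc (2 * n)" by simp
    then show ?thesis unfolding P_def by (simp add: card_PiE)
  qed
  ultimately show "finite (sup_box a n)" "card (sup_box a n) = (2 * n + 1) ^ CARD('n)"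
    unfolding eq by (auto simp: card_image)
qed

lemma centre_in_sup_box [simp]: "a \<in> sup_box a n"
  by (simp add: sup_box_def)

lemma sup_box_mono: "m \<le> n \<Longrightarrow> sup_box a m \<subseteq> sup_box a n"
  by (auto simp: sup_box_def)

fun path_edges :: "'a list \<Rightarrow> 'a set set" where
  "path_edges (x # y # vs) = insert {x, y} (path_edges (y # vs))"
| "path_edges _ = {}"

lemma finite_path_edges: "finite (path_edges vs)"
  by (induction vs rule: path_edges.induct) auto

lemma path_edges_subset: "e \<in> path_edges vs \<Longrightarrow> e \<subseteq> set vs \<and> e \<noteq> {}"
  by (induction vs rule: path_edges.induct) auto

lemma path_edges_lattice: "distinct vs \<Longrightarrow> path_edges vs \<subseteq> lattice_edges"
  by (induction vs rule: path_edges.induct) (auto simp: lattice_edges_def)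

lemma path_edges_append:
  "as \<noteq> [] \<Longrightarrow> bs \<noteq> [] \<Longrightarrow>
    path_edges (as @ bs) = path_edges as \<union> insert {last as, hd bs} (path_edges bs)"
proof (induction as rule: path_edges.induct)
  case ("2_2" v)
  then show ?case by (cases bs) auto
qed auto

lemma successively_open_iff:
  "distinct vs \<Longrightarrow>
    successively (\<lambda>u v. u \<noteq> v \<and> \<omega> {u, v}) vs \<longleftrightarrow> (\<forall>e\<in>path_edges vs. \<omega> e)"
  by (induction vs rule: path_edges.induct) auto

definition simple_paths :: "nat \<Rightarrow> 'a \<Rightarrow> 'a \<Rightarrow> 'a list set" where
  "simple_paths n a x = {vs. vs \<noteq> [] \<and> hd vs = a \<and> last vs = x \<and> distinct vs \<and> length vs \<le> Suc n}"

lemma connecting_path_iff: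
  "connecting_path \<omega> a x vs \<and> length vs \<le> Suc n
     \<longleftrightarrow> vs \<in> simple_paths n a x \<and> (\<forall>e\<in>path_edges vs. \<omega> e)"
  by (auto simp: connecting_path_def simple_paths_def successively_open_iff)

text \<open>
  The vertices of a split are the ends of an edge of the path, so this is the triangle inequality
  along the path; it forces a long edge when the endpoints are far apart.
\<close>

lemma endpoint_distance_le:
  assumes "vs \<noteq> []" "t \<ge> 0"
    and "\<And>as bs. vs = as @ bs \<Longrightarrow> as \<noteq> [] \<Longrightarrow> bs \<noteq> [] \<Longrightarrow> real (sup_norm (last as - hd bs)) \<le> t"
  shows "real (sup_norm (hd vs - last vs)) \<le> real (length vs - 1) * t"
  using assms
proof (induction vs rule: path_edges.induct)
  case (1 x y vs)
  have "real (sup_norm (hd (y # vs) - last (y # vs))) \<le> real (length (y # vs) - 1) * t"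
  proof (rule "1.IH")
    fix as bs assume "y # vs = as @ bs" "as \<noteq> []" "bs \<noteq> []"
    then show "real (sup_norm (last as - hd bs)) \<le> t"
      using "1.prems"(3)[of "x # as" bs] by auto
  qed (use 1 in auto)
  moreover have "real (sup_norm (x - y)) \<le> t"
    using "1.prems"(3)[of "[x]" "y # vs"] by simp
  moreover have "sup_norm (x - last (y # vs)) \<le> sup_norm (x - y) + sup_norm (y - last (y # vs))"
    by (rule sup_norm_triangle_diff)
  ultimately show ?case by (simp add: algebra_simps)
qed auto

lemma long_edge_split:
  assumes vs: "vs \<in> simple_paths n a x" and t: "t \<ge> 0" "real n * t < real (sup_norm (a - x))"
  obtains as bs i where "vs = as @ bs" "i < n" "as \<in> simple_paths i a (last as)"
    "bs \<in> simple_paths (n - 1 - i) (hd bs) x" "t < real (sup_norm (last as - hd bs))"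
    "set as \<inter> set bs = {}" "last as \<in> set as" "hd bs \<in> set bs" "as \<noteq> []" "bs \<noteq> []"
proof -
  have "\<exists>as bs. vs = as @ bs \<and> as \<noteq> [] \<and> bs \<noteq> [] \<and> t < real (sup_norm (last as - hd bs))"
  proof (rule ccontr)
    assume *: "\<not> ?thesis"
    have "real (sup_norm (hd vs - last vs)) \<le> real (length vs - 1) * t"
      by (rule endpoint_distance_le) (use vs t * in \<open>auto simp: simple_paths_def not_less\<close>)
    also have "\<dots> \<le> real n * t"
      using vs t by (intro mult_right_mono) (auto simp: simple_paths_def)
    finally show False using vs t by (simp add: simple_paths_def)
  qed
  then obtain as bs where ab: "vs = as @ bs" "as \<noteq> []" "bs \<noteq> []" "t < real (sup_norm (last as - hd bs))"
    by blast
  have len: "length as + length bs \<le> Suc n" "length as \<ge> 1" "length bs \<ge> 1"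
    using ab vs by (auto simp: simple_paths_def Suc_le_eq)
  show thesis
  proof (rule that[of as bs "length as - 1"])
    show "as \<in> simple_paths (length as - 1) a (last as)"
      "bs \<in> simple_paths (n - 1 - (length as - 1)) (hd bs) x"
      using ab vs len by (auto simp: simple_paths_def)
  qed (use ab vs len in \<open>auto simp: simple_paths_def\<close>)
qed

locale lattice_percolation = bernoulli_field "lattice_edges :: (int ^ 'n) set set" B
  for B :: "(int ^ 'n) set \<Rightarrow> bool pmf"
begin

definition reach :: "nat \<Rightarrow> int ^ 'n \<Rightarrow> int ^ 'n \<Rightarrow> ((int ^ 'n) set \<Rightarrow> bool) set" where
  "reach n a x = {\<omega> \<in> space law. \<exists>vs. connecting_path \<omega> a x vs \<and> length vs \<le> Suc n}"

lemma simple_paths_edges: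
  assumes "vs \<in> simple_paths n a x"
  shows "finite (path_edges vs)" "path_edges vs \<subseteq> lattice_edges"
  using assms path_edges_lattice by (auto simp: simple_paths_def finite_path_edges)

lemma reach_eq: "reach n a x = (some_open (path_edges ` simple_paths n a x))"
  unfolding reach_def connecting_path_iff by (auto simp: all_open_def)

lemma reach_sets [measurable]: "reach n a x \<in> sets law"
  unfolding reach_eq by (rule some_open_sets) (simp, elim imageE, simp only: simple_paths_edges simp_thms)

lemma reach_sym: "reach n a x = reach n x a"
proof -
  have "\<exists>vs. connecting_path \<omega> x a vs \<and> length vs \<le> Suc n"
    if "connecting_path \<omega> a x vs" "length vs \<le> Suc n" for a x :: "int ^ 'n" and \<omega> vs
    using that unfolding connecting_path_def
    by (intro exI[of _ "rev vs"])
      (auto simp: successively_rev hd_rev last_rev insert_commute conj_commute eq_commute)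
  then show ?thesis unfolding reach_def by blast
qed

lemma prob_edge_open:
  assumes "e \<in> lattice_edges" shows "law.prob {\<omega> \<in> space law. all_open {e} \<omega>} = p e"
proof -
  have "{\<omega> \<in> space law. all_open {e} \<omega>} = {\<omega> \<in> space law. {f\<in>{e}. \<omega> f} = {e}}"
    by (auto simp: all_open_def)
  then show ?thesis using prob_pattern[of "{e}" "{e}"] assms by simp
qed

text \<open>
  A path from \<open>a\<close> to \<open>x\<close> cut at its edge \<open>{y, z}\<close>. The edge is put into the second set of the pair, from
  which \<open>prob_split_event\<close> separates it by a second use of disjoint occurrence.
\<close>

definition split_event :: "nat \<Rightarrow> nat \<Rightarrow> int ^ 'n \<Rightarrow> int ^ 'n \<Rightarrow> int ^ 'n \<Rightarrow> int ^ 'n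
    \<Rightarrow> ((int ^ 'n) set \<Rightarrow> bool) set" where
  "split_event i j a y z x = {\<omega> \<in> space law.
     \<exists>(S,T)\<in>{(path_edges as, insert {y, z} (path_edges bs)) | as bs.
        as \<in> simple_paths i a y \<and> bs \<in> simple_paths j z x \<and> set as \<inter> set bs = {}}.
       all_open S \<omega> \<and> all_open T \<omega>}"

lemma split_event_sets: "split_event i j a y z x \<in> sets law"
proof (cases "y = z")
  case True
  have "y \<in> set as" "z \<in> set bs" if "as \<in> simple_paths i a y" "bs \<in> simple_paths j z x" for as bs
    using that by (auto simp: simple_paths_def)
  then have "split_event i j a y z x = {}"
    unfolding split_event_def using True by fastforce
  then show ?thesis by simp
next
  case False
  have yz: "{y, z} \<in> lattice_edges" using False by (auto simp: lattice_edges_def)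
  let ?F = "{(as, bs). as \<in> simple_paths i a y \<and> bs \<in> simple_paths j z x \<and> set as \<inter> set bs = {}}"
  have "split_event i j a y z x = {\<omega> \<in> space law.
      \<exists>S\<in>(\<lambda>(as, bs). path_edges as \<union> insert {y, z} (path_edges bs)) ` ?F. all_open S \<omega>}"
    unfolding split_event_def all_open_def by (simp add: ball_Un split_beta conj_assoc) blast
  also have "\<dots> \<in> sets law"
  proof (rule some_open_sets)
    fix S assume "S \<in> (\<lambda>(as, bs). path_edges as \<union> insert {y, z} (path_edges bs)) ` ?F"
    then obtain as bs where S: "S = path_edges as \<union> insert {y, z} (path_edges bs)"
      "as \<in> simple_paths i a y" "bs \<in> simple_paths j z x" by (elim imageE) auto
    show "finite S \<and> S \<subseteq> lattice_edges"
      unfolding S(1) using simple_paths_edges[OF S(2)] simple_paths_edges[OF S(3)] yz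
      by (simp only: finite_Un finite_insert insert_subset simp_thms Un_subset_iff)
  qed (rule countable_image, rule countableI_type)
  finally show ?thesis .
qed

lemma prob_split_event:
  assumes "y \<noteq> z"
  shows "law.prob (split_event i j a y z x) \<le> law.prob (reach i a y) * (p {y, z} * law.prob (reach j z x))"
proof -
  define F where "F = {(path_edges as, insert {y, z} (path_edges bs)) | as bs.
        as \<in> simple_paths i a y \<and> bs \<in> simple_paths j z x \<and> set as \<inter> set bs = {}}"
  define G where "G = {({{y, z}}, path_edges bs) | bs. bs \<in> simple_paths j z x \<and> y \<notin> set bs}"
  have yz: "{y, z} \<in> lattice_edges" using assms by (auto simp: lattice_edges_def)
  have ends: "y \<in> set as" if "as \<in> simple_paths i a y" for as
    using that by (auto simp: simple_paths_def)
  have ends': "z \<in> set bs" if "bs \<in> simple_paths j z x" for bs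
    using that by (auto simp: simple_paths_def)
  have "law.prob (split_event i j a y z x)
      \<le> law.prob (some_open (fst ` F)) * law.prob (some_open (snd ` F))"
    unfolding split_event_def F_def[symmetric]
  proof (rule disjoint_occurrence)
    have "F \<subseteq> (\<lambda>(as, bs). (path_edges as, insert {y, z} (path_edges bs))) ` UNIV"
      unfolding F_def by auto
    then show "countable F" by (rule countable_subset) simp
  next
    fix S T assume "(S, T) \<in> F"
    then obtain as bs where ab: "S = path_edges as" "T = insert {y, z} (path_edges bs)"
      "as \<in> simple_paths i a y" "bs \<in> simple_paths j z x" "set as \<inter> set bs = {}"
      unfolding F_def by blast
    have "e \<notin> T" if "e \<in> S" for e
    proof -
      from that have "e \<subseteq> set as" "e \<noteq> {}" using path_edges_subset ab by metis+
      then show ?thesis using path_edges_subset[of e bs] ends'[OF ab(4)] ab by auto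
    qed
    then show "finite S \<and> finite T \<and> S \<subseteq> lattice_edges \<and> T \<subseteq> lattice_edges \<and> S \<inter> T = {}"
      using simple_paths_edges[OF ab(3)] simple_paths_edges[OF ab(4)] yz ab by auto
  qed
  also have "\<dots> \<le> law.prob (reach i a y) * (p {y, z} * law.prob (reach j z x))"
  proof (intro mult_mono)
    show "law.prob (some_open (fst ` F)) \<le> law.prob (reach i a y)"
      unfolding reach_eq using reach_sets[of i a y]
      by (intro law.finite_measure_mono) (auto simp: F_def reach_eq)
    have GS: "finite S \<and> finite T \<and> S \<subseteq> lattice_edges \<and> T \<subseteq> lattice_edges \<and> S \<inter> T = {}"
      if "(S, T) \<in> G" for S T
    proof -
      from that obtain bs where bs: "S = {{y, z}}" "T = path_edges bs" "bs \<in> simple_paths j z x" "y \<notin> set bs"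
        unfolding G_def by blast
      have "{y, z} \<notin> path_edges bs" using path_edges_subset[of "{y, z}" bs] bs by auto
      then show ?thesis using simple_paths_edges[OF bs(3)] yz bs by auto
    qed
    have Gc: "countable G"
    proof (rule countable_subset)
      show "G \<subseteq> (\<lambda>bs. ({{y, z}}, path_edges bs)) ` UNIV" unfolding G_def by auto
    qed simp
    have "law.prob (some_open (snd ` F))
        \<le> law.prob (both_open G)"
    proof (rule law.finite_measure_mono)
      show "some_open (snd ` F)
          \<subseteq> (both_open G)"
      proof (intro Collect_mono impI conjI; elim conjE)
        fix \<omega> assume "\<exists>T\<in>snd ` F. all_open T \<omega>"
        then obtain as bs where ab: "all_open (insert {y, z} (path_edges bs)) \<omega>"
          "as \<in> simple_paths i a y" "bs \<in> simple_paths j z x" "set as \<inter> set bs = {}"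
          unfolding F_def by auto
        then have "({{y, z}}, path_edges bs) \<in> G" unfolding G_def using ends by blast
        then show "\<exists>(S,T)\<in>G. all_open S \<omega> \<and> all_open T \<omega>"
          using ab(1) by (intro bexI[of _ "({{y, z}}, path_edges bs)"]) (auto simp: all_open_def)
      qed
      have "both_open G
          = {\<omega> \<in> space law. \<exists>S\<in>(\<lambda>P. fst P \<union> snd P) ` G. all_open S \<omega>}"
        by (auto simp: all_open_def ball_Un split_beta)
      also have "\<dots> \<in> sets law"
        using Gc GS by (intro some_open_sets) (auto, blast+)
      finally show "both_open G \<in> sets law" .
    qed
    also have "\<dots> \<le> law.prob (some_open (fst ` G)) * law.prob (some_open (snd ` G))"
      by (rule disjoint_occurrence[OF Gc GS])
    also have "\<dots> \<le> p {y, z} * law.prob (reach j z x)"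
    proof (intro mult_mono)
      have "law.prob (some_open (fst ` G)) \<le> law.prob {\<omega> \<in> space law. all_open {{y, z}} \<omega>}"
        using yz by (intro law.finite_measure_mono all_open_sets) (auto simp: G_def)
      then show "law.prob (some_open (fst ` G)) \<le> p {y, z}"
        using prob_edge_open[OF yz] by simp
      show "law.prob (some_open (snd ` G)) \<le> law.prob (reach j z x)"
        unfolding reach_eq using reach_sets[of j z x]
        by (intro law.finite_measure_mono) (auto simp: G_def reach_eq)
    qed (auto simp: p_range)
    finally show "law.prob (some_open (snd ` F)) \<le> p {y, z} * law.prob (reach j z x)" .
  qed auto
  finally show ?thesis .
qed

lemma reach_subset_split:
  assumes t: "t \<ge> 0" "real n * t < real (sup_norm (a - x))"
  shows "reach n a x \<subseteq> (\<Union>i\<in>{..<n}. \<Union>(y, z)\<in>{(y, z). t < real (sup_norm (y - z))}. split_event i (n - 1 - i) a y z x)"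
proof
  fix \<omega> assume "\<omega> \<in> reach n a x"
  then obtain vs where vs: "vs \<in> simple_paths n a x" "\<forall>e\<in>path_edges vs. \<omega> e" and \<omega>: "\<omega> \<in> space law"
    unfolding reach_eq by (auto simp: all_open_def)
  obtain as bs i where ab: "vs = as @ bs" "i < n" "as \<in> simple_paths i a (last as)"
    "bs \<in> simple_paths (n - 1 - i) (hd bs) x" "t < real (sup_norm (last as - hd bs))"
    "set as \<inter> set bs = {}" "as \<noteq> []" "bs \<noteq> []"
    using long_edge_split[OF vs(1) t] by metis
  have "\<omega> \<in> split_event i (n - 1 - i) a (last as) (hd bs) x"
    unfolding split_event_def using ab \<omega> vs(2)
    by (auto simp: path_edges_append all_open_def)
  then show "\<omega> \<in> (\<Union>i\<in>{..<n}. \<Union>(y, z)\<in>{(y, z). t < real (sup_norm (y - z))}. split_event i (n - 1 - i) a y z x)"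
    using ab by blast
qed

end

section \<open>First moment of the balls of the graph distance\<close>

text \<open>
  The sum of \<open>min 1 (M r\<^sup>-\<^sup>s)\<close> over the lattice: it is of the order of the volume of the ball whose radius
  \<open>\<rho>\<close> solves \<open>M \<rho>\<^sup>-\<^sup>s = 1\<close>, since the sum over the dyadic shells outside converges geometrically for
  \<open>s > d\<close>. Capping by one is what turns the product of two expected volumes into its \<open>\<theta>\<close>-th power.
\<close>

lemma lattice_sum_le:
  assumes s: "real CARD('n) < s"
  shows "\<exists>C\<ge>1. \<forall>M\<ge>1. \<forall>a :: int ^ 'n. \<forall>f :: int ^ 'n \<Rightarrow> ennreal. (\<forall>x. f x \<le> 1) \<longrightarrow>
     (\<forall>x. x \<noteq> a \<longrightarrow> f x \<le> ennreal (M * real (sup_norm (a - x)) powr - s)) \<longrightarrow>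
     (\<integral>\<^sup>+x. f x \<partial>count_space UNIV) \<le> ennreal (C * M powr (real CARD('n) / s))"
proof -
  define d where "d = CARD('n)"
  define w where "w = 2 powr (real d - s)"
  have d: "d > 0" "real d < s" "s > 0" using s by (auto simp: d_def intro: order.strict_trans1[rotated])
  have w: "0 < w" "w < 1" using d by (auto simp: w_def powr_less_one)
  define C where "C = 2 powr s * 3 ^ d * (1 / (1 - w))"
  have "1 * 1 * 1 \<le> C"
    unfolding C_def using d w by (intro mult_mono) (auto simp: ge_one_powr_ge_zero)
  moreover have "(\<integral>\<^sup>+x. f x \<partial>count_space UNIV) \<le> ennreal (C * M powr (real CARD('n) / s))"
    if M: "M \<ge> 1" and f1: "\<And>x. f x \<le> 1"
      and f2: "\<And>x. x \<noteq> a \<Longrightarrow> f x \<le> ennreal (M * real (sup_norm (a - x)) powr - s)"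
    for M and a :: "int ^ 'n" and f :: "int ^ 'n \<Rightarrow> ennreal"
  proof -
    define \<rho> where "\<rho> = M powr (1 / s)"
    have \<rho>: "\<rho> \<ge> 1" using M d by (simp add: \<rho>_def ge_one_powr_ge_zero)
    define A where "A k = sup_box a (nat \<lfloor>2 ^ k * \<rho>\<rfloor>)" for k
    have inA: "x \<in> A k \<longleftrightarrow> real (sup_norm (a - x)) \<le> 2 ^ k * \<rho>" for x k
    proof -
      have "0 \<le> 2 ^ k * \<rho>" using \<rho> by simp
      then show ?thesis unfolding A_def sup_box_def
        by (simp add: sup_norm_commute[of a x] le_nat_iff le_floor_iff)
    qed
    define c where "c k = 2 powr s * 2 powr (- s * real k)" for k :: nat
    have c: "c k \<ge> 0" for k by (simp add: c_def)
    have "f x \<le> (\<Sum>k. ennreal (c k) * indicator (A k) x)" for x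
    proof -
      have "\<exists>k. x \<in> A k"
      proof -
        have "\<exists>k. real (sup_norm (a - x)) < 2 ^ k" by (rule real_arch_pow) simp
        then obtain k where "real (sup_norm (a - x)) < 2 ^ k" ..
        also have "(2::real) ^ k \<le> 2 ^ k * \<rho>" using \<rho> by simp
        finally show ?thesis using inA by (auto intro: less_imp_le)
      qed
      then obtain k where k: "x \<in> A k" "\<And>j. j < k \<Longrightarrow> x \<notin> A j"
        using that[of "LEAST k. x \<in> A k"] LeastI_ex[of "\<lambda>k. x \<in> A k"] not_less_Least[of _ "\<lambda>k. x \<in> A k"]
        by blast
      have "f x \<le> ennreal (c k)"
      proof (cases k)
        case 0
        then have "1 \<le> c k" using d by (simp add: c_def ge_one_powr_ge_zero)
        then have "(1::ennreal) \<le> ennreal (c k)" by (simp add: ennreal_ge_1)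
        then show ?thesis using f1[of x] by (rule order.trans[rotated])
      next
        case (Suc j)
        then have j: "2 ^ j * \<rho> < real (sup_norm (a - x))" using k(2)[of j] inA by auto
        moreover have "0 < 2 ^ j * \<rho>" using \<rho> by simp
        ultimately have "x \<noteq> a" by auto
        then have "f x \<le> ennreal (M * real (sup_norm (a - x)) powr - s)" by (rule f2)
        also have "\<dots> \<le> ennreal (M * (2 ^ j * \<rho>) powr - s)"
          using M j d \<open>0 < 2 ^ j * \<rho>\<close> by (intro ennreal_leI mult_left_mono powr_mono2') auto
        also have "M * (2 ^ j * \<rho>) powr - s = c k"
        proof -
          have "\<rho> powr - s = inverse M" using M d by (simp add: \<rho>_def powr_powr powr_minus)
          moreover have "(2 ^ j) powr - s = (2::real) powr (- s * real j)"
            by (simp add: powr_realpow[symmetric] powr_powr mult.commute)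
          moreover have "(2 ^ j * \<rho>) powr - s = (2 ^ j) powr - s * \<rho> powr - s"
            using \<rho> by (simp add: powr_mult)
          moreover have "2 powr s * 2 powr (- s * real k) = (2::real) powr (- s * real j)"
            using Suc by (simp add: powr_add[symmetric] algebra_simps)
          ultimately show ?thesis using M by (simp add: c_def field_simps)
        qed
        finally show ?thesis .
      qed
      also have "\<dots> = (\<Sum>i\<in>{k}. ennreal (c i) * indicator (A i) x)" using k by simp
      also have "\<dots> \<le> (\<Sum>k. ennreal (c k) * indicator (A k) x)"
        by (rule sum_le_suminf) auto
      finally show ?thesis .
    qed
    then have "(\<integral>\<^sup>+x. f x \<partial>count_space UNIV)
        \<le> (\<integral>\<^sup>+x. (\<Sum>k. ennreal (c k) * indicator (A k) x) \<partial>count_space UNIV)"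
      by (intro nn_integral_mono)
    also have "\<dots> = (\<Sum>k. \<integral>\<^sup>+x. ennreal (c k) * indicator (A k) x \<partial>count_space UNIV)"
      by (rule nn_integral_suminf) simp
    also have "\<dots> = (\<Sum>k. ennreal (c k) * ennreal (real (card (A k))))"
      by (intro suminf_cong) (simp add: nn_integral_cmult_indicator A_def finite_sup_box ennreal_of_nat_eq_real_of_nat)
    also have "\<dots> \<le> (\<Sum>k. ennreal (2 powr s * 3 ^ d * \<rho> ^ d * w ^ k))"
    proof (intro suminf_le allI)
      fix k
      have "real (card (A k)) = (2 * real (nat \<lfloor>2 ^ k * \<rho>\<rfloor>) + 1) ^ d"
        unfolding A_def card_sup_box d_def by (simp add: add.commute)
      also have "\<dots> \<le> (3 * (2 ^ k * \<rho>)) ^ d"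
      proof (intro power_mono)
        have "1 * 1 \<le> 2 ^ k * \<rho>" using \<rho> by (intro mult_mono) auto
        moreover have "real (nat \<lfloor>2 ^ k * \<rho>\<rfloor>) \<le> 2 ^ k * \<rho>" using \<rho> by simp
        ultimately show "2 * real (nat \<lfloor>2 ^ k * \<rho>\<rfloor>) + 1 \<le> 3 * (2 ^ k * \<rho>)" by linarith
      qed auto
      finally have "c k * real (card (A k)) \<le> c k * (3 * (2 ^ k * \<rho>)) ^ d"
        using c by (intro mult_left_mono)
      also have "\<dots> = 2 powr s * 3 ^ d * \<rho> ^ d * w ^ k"
      proof -
        have "w ^ k = (2 ^ k) ^ d * 2 powr (- s * real k)"
          by (simp add: w_def powr_realpow[symmetric] powr_powr powr_add[symmetric] algebra_simps)
        then show ?thesis by (simp add: c_def power_mult_distrib algebra_simps)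
      qed
      finally show "ennreal (c k) * ennreal (real (card (A k))) \<le> ennreal (2 powr s * 3 ^ d * \<rho> ^ d * w ^ k)"
        using c by (simp add: ennreal_mult[symmetric] ennreal_leI)
    qed auto
    also have "\<dots> = ennreal (\<Sum>k. 2 powr s * 3 ^ d * \<rho> ^ d * w ^ k)"
      using w \<rho> by (intro suminf_ennreal2 summable_mult summable_geometric) auto
    also have "(\<Sum>k. 2 powr s * 3 ^ d * \<rho> ^ d * w ^ k) = 2 powr s * 3 ^ d * \<rho> ^ d * (1 / (1 - w))"
      using w by (subst suminf_mult) (auto simp: suminf_geometric intro!: summable_geometric)
    also have "\<dots> = C * M powr (real CARD('n) / s)"
    proof -
      have "\<rho> ^ d = M powr (real d / s)"
        using \<rho> M by (subst powr_realpow[symmetric]) (auto simp: \<rho>_def powr_powr)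
      then show ?thesis by (simp add: C_def d_def)
    qed
    finally show ?thesis .
  qed
  ultimately show ?thesis by (intro exI[of _ C]) auto
qed

text \<open>
  The recursion \<open>l m \<le> \<theta> (l i + l j + L) + c + c' ln m\<close>, for \<open>i + j = m\<close> and \<open>l 1 = 0\<close>, governs the
  logarithms of the expected ball sizes. It is bounded by a family of functions that are affine in
  \<open>m\<close>, one for each level \<open>k\<close>: for affine functions the sum at \<open>i\<close> and \<open>j\<close> depends only on \<open>i + j\<close>, so
  level \<open>k - 1\<close> yields level \<open>k\<close> with no optimisation over \<open>i\<close>. The main term is the chord of the profile
  \<open>(2 \<theta>)\<^sup>k\<close> at \<open>m = 2\<^sup>k\<close>. The error term absorbs the logarithm through its tangent,
  \<open>ln m \<le> k + m / 2\<^sup>k\<close>, and stays of the order \<open>(2 \<theta>)\<^sup>k\<close> for \<open>m\<close> of the order \<open>2\<^sup>k\<close>.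
\<close>

context
  fixes \<theta> c c' :: real
begin

fun err_const :: "nat \<Rightarrow> real" where
  "err_const 0 = 0"
| "err_const (Suc k) = 2 * \<theta> * err_const k + c + c' * (real k + 1)"

fun err_slope :: "nat \<Rightarrow> real" where
  "err_slope 0 = (c + c') / (1 - \<theta>)"
| "err_slope (Suc k) = \<theta> * err_slope k + c' / 2 ^ Suc k"

text \<open>
  The affine function of \<open>m\<close> that takes the value \<open>(2 \<theta>)\<^sup>k\<close> at \<open>m = 2\<^sup>k\<close> and \<open>(2 \<theta>)\<^sup>k\<^sup>+\<^sup>1\<close> at \<open>m = 2\<^sup>k\<^sup>+\<^sup>1\<close>.
\<close>

definition dyadic_chord :: "nat \<Rightarrow> real \<Rightarrow> real" where
  "dyadic_chord k m = (2 - 2 * \<theta>) * (2 * \<theta>) ^ k + (2 * \<theta> - 1) * \<theta> ^ k * m"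

definition log_bound :: "real \<Rightarrow> nat \<Rightarrow> real \<Rightarrow> real" where
  "log_bound L k m = \<theta> * L / (2 * \<theta> - 1) * (dyadic_chord k m - 1) + err_const k + err_slope k * m"

context
  assumes \<theta>: "1 / 2 < \<theta>" "\<theta> < 1" and c: "0 \<le> c" "0 \<le> c'"
begin

lemma err_nonneg: "0 \<le> err_const k" "0 \<le> err_slope k"
proof -
  show "0 \<le> err_const k" using \<theta> c by (induction k) auto
  show "0 \<le> err_slope k" using \<theta> c by (induction k) auto
qed

lemma dyadic_chord_ge_1:
  assumes "m \<ge> 1" shows "dyadic_chord k m \<ge> 1"
proof -
  have "dyadic_chord k 1 \<ge> 1"
  proof (induction k)
    case (Suc k)
    have p: "2 * \<theta> ^ k * 2 ^ k \<ge> \<theta> ^ k"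
    proof -
      have "(1::real) \<le> 2 * 2 ^ k" using one_le_power[of "2::real" k] by linarith
      then have "\<theta> ^ k * 1 \<le> \<theta> ^ k * (2 * 2 ^ k)" using \<theta> by (intro mult_left_mono) auto
      then show ?thesis by simp
    qed
    have "dyadic_chord (Suc k) 1 - dyadic_chord k 1
        = (2 * \<theta> - 1) * (1 - \<theta>) * (2 * \<theta> ^ k * 2 ^ k - \<theta> ^ k)"
      by (simp add: dyadic_chord_def power_mult_distrib algebra_simps)
    also have "\<dots> \<ge> 0" using \<theta> p by (intro mult_nonneg_nonneg) auto
    finally show ?case using Suc by simp
  qed (simp add: dyadic_chord_def)
  also have "dyadic_chord k 1 \<le> dyadic_chord k m"
    unfolding dyadic_chord_def using \<theta> assms by (intro add_left_mono mult_left_mono) auto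
  finally show ?thesis .
qed

lemma log_bound_nonneg:
  assumes "m \<ge> 1" "L \<ge> 0" shows "log_bound L k m \<ge> 0"
  unfolding log_bound_def using \<theta> assms dyadic_chord_ge_1[OF assms(1), of k] err_nonneg[of k]
  by (intro add_nonneg_nonneg mult_nonneg_nonneg) auto

lemma log_bound_add:
  "log_bound L k i + log_bound L k j = 2 * log_bound L k ((i + j) / 2)"
proof -
  define K where "K = \<theta> * L / (2 * \<theta> - 1)"
  show ?thesis
    unfolding log_bound_def dyadic_chord_def K_def[symmetric] by (simp add: algebra_simps add_divide_distrib)
qed

lemma log_bound_step_Suc:
  assumes m: "m > 0"
  shows "\<theta> * (2 * log_bound L k (m / 2) + L) + c + c' * ln m \<le> log_bound L (Suc k) m"
proof -
  have "ln m = real (Suc k) * ln 2 + ln (m / 2 ^ Suc k)"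
    using m by (simp add: ln_div ln_realpow ln_mult algebra_simps)
  also have "real (Suc k) * ln 2 \<le> real (Suc k) * 1" using ln_2_less_1 by (intro mult_left_mono) auto
  also have "ln (m / 2 ^ Suc k) \<le> m / 2 ^ Suc k" using m ln_le_minus_one[of "m / 2 ^ Suc k"] by simp
  finally have "ln m \<le> real (Suc k) + m / 2 ^ Suc k" by simp
  then have ln: "c' * ln m \<le> c' * (real (Suc k) + m / 2 ^ Suc k)" using c by (intro mult_left_mono)
  define K where "K = \<theta> * L / (2 * \<theta> - 1)"
  have K: "\<theta> * L = (2 * \<theta> - 1) * K" using \<theta> by (simp add: K_def)
  have "log_bound L (Suc k) m - (\<theta> * (2 * log_bound L k (m / 2) + L) + c)
      = c' * (real (Suc k) + m / 2 ^ Suc k)"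
    unfolding log_bound_def dyadic_chord_def K_def[symmetric]
    unfolding distrib_left[of \<theta> _ L] K
    by (simp add: algebra_simps)
  then show ?thesis using ln by linarith
qed

text \<open>
  Level zero reproduces itself: its error slope is large enough to carry \<open>c + c' ln m \<le> (c + c') m\<close>,
  and for \<open>m \<ge> 2\<close> the chord itself satisfies the recursion.
\<close>

lemma log_bound_step_0:
  assumes m: "m \<ge> 2" and L: "L \<ge> 0"
  shows "\<theta> * (2 * log_bound L 0 (m / 2) + L) + c + c' * ln m \<le> log_bound L 0 m"
proof -
  have "ln m \<le> m" using m ln_le_minus_one[of m] by simp
  then have ln: "c' * ln m \<le> c' * m" using c by (intro mult_left_mono)
  define K where "K = \<theta> * L / (2 * \<theta> - 1)"
  have K: "\<theta> * L = (2 * \<theta> - 1) * K" using \<theta> by (simp add: K_def)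
  have K0: "K \<ge> 0" unfolding K_def using \<theta> L by auto
  define b where "b = err_slope 0"
  have b: "c + c' = (1 - \<theta>) * b" using \<theta> by (simp add: b_def)
  have "log_bound L 0 m - \<theta> * (2 * log_bound L 0 (m / 2) + L)
      = (2 * \<theta> - 1) * K * ((1 - \<theta>) * (m - 2)) + (1 - \<theta>) * b * m"
    unfolding log_bound_def dyadic_chord_def K_def[symmetric] b_def[symmetric]
    unfolding distrib_left[of \<theta> _ L] K
    by (simp add: algebra_simps)
  moreover have "0 \<le> (2 * \<theta> - 1) * K * ((1 - \<theta>) * (m - 2))"
    using \<theta> K0 m by (intro mult_nonneg_nonneg) auto
  moreover have "c + c' * m \<le> (1 - \<theta>) * b * m"
    unfolding b[symmetric] using m c mult_left_mono[of 1 m c] by (simp add: algebra_simps)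
  ultimately show ?thesis using ln by linarith
qed

lemma log_bound_step:
  assumes m: "m \<ge> 2" and L: "L \<ge> 0"
  shows "\<theta> * (2 * log_bound L (k - 1) (m / 2) + L) + c + c' * ln m \<le> log_bound L k m"
proof (cases k)
  case 0
  then show ?thesis using log_bound_step_0[OF assms] by simp
next
  case (Suc j)
  then show ?thesis using log_bound_step_Suc[of m L j] m by simp
qed

text \<open>
  At \<open>m = 3 \<cdot> 2\<^sup>k\<close>, the midpoint of \<open>2\<^sup>k\<^sup>+\<^sup>1\<close> and \<open>2\<^sup>k\<^sup>+\<^sup>2\<close>, the chord is \<open>(1 + 2 \<theta>) / 2\<close> times
  \<open>(2 \<theta>)\<^sup>k\<^sup>+\<^sup>1\<close>. The error is a multiple of the same power by a constant \<open>G\<close> that is independent of \<open>L\<close>;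
  this makes it negligible when \<open>L\<close>, which is \<open>ln \<beta>\<close> up to a constant, is large.
\<close>

lemma log_bound_at_midpoint:
  "\<exists>G. \<forall>L k. log_bound L (Suc k) (3 * 2 ^ k)
      \<le> \<theta> * L / (2 * \<theta> - 1) * ((\<theta> + 1 / 2) * (2 * \<theta>) ^ Suc k - 1) + G * (2 * \<theta>) ^ Suc k"
proof -
  \<comment> \<open>Adding these particular solutions makes both error recursions homogeneous.\<close>
  define b where "b = c' / (2 * \<theta> - 1)"
  define a where "a = (c + 2 * \<theta> * b) / (2 * \<theta> - 1)"
  have b: "c' = (2 * \<theta> - 1) * b" using \<theta> by (simp add: b_def)
  have "(2 * \<theta> - 1) * a = c + 2 * \<theta> * b" unfolding a_def using \<theta> by simp
  then have a: "c = (2 * \<theta> - 1) * a - 2 * \<theta> * b" by linarith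
  have nn: "b \<ge> 0" "a \<ge> 0" using \<theta> c by (auto simp: a_def b_def)
  have const: "err_const k + b * real k + a = a * (2 * \<theta>) ^ k" for k
  proof (induction k)
    case (Suc k)
    have "c + c' * (real k + 1) + b * real (Suc k) + a = 2 * \<theta> * (b * real k + a)"
      by (subst a, subst b) (simp add: algebra_simps)
    then have "err_const (Suc k) + b * real (Suc k) + a = 2 * \<theta> * (err_const k + b * real k + a)"
      by (simp add: algebra_simps)
    then show ?case unfolding Suc by simp
  qed simp
  have slope: "err_slope k + b / 2 ^ k = (err_slope 0 + b) * \<theta> ^ k" for k
  proof (induction k)
    case (Suc k)
    have "c' / 2 ^ Suc k + b / 2 ^ Suc k = \<theta> * (b / 2 ^ k)"
      by (subst b) (simp add: field_simps)
    then have "err_slope (Suc k) + b / 2 ^ Suc k = \<theta> * (err_slope k + b / 2 ^ k)"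
      by (simp add: algebra_simps)
    then show ?case unfolding Suc by simp
  qed simp
  define G where "G = a + 3 / 2 * (err_slope 0 + b)"
  have "log_bound L (Suc k) (3 * 2 ^ k)
      \<le> \<theta> * L / (2 * \<theta> - 1) * ((\<theta> + 1 / 2) * (2 * \<theta>) ^ Suc k - 1) + G * (2 * \<theta>) ^ Suc k" for L k
  proof -
    have "err_const (Suc k) \<le> a * (2 * \<theta>) ^ Suc k"
      using const[of "Suc k"] nn by (smt (verit) mult_nonneg_nonneg of_nat_0_le_iff)
    moreover have "err_slope (Suc k) * (3 * 2 ^ k) \<le> (err_slope 0 + b) * \<theta> ^ Suc k * (3 * 2 ^ k)"
    proof (rule mult_right_mono)
      have "0 \<le> b / 2 ^ Suc k" using nn by simp
      then show "err_slope (Suc k) \<le> (err_slope 0 + b) * \<theta> ^ Suc k"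
        using slope[of "Suc k"] by linarith
    qed simp
    moreover have "(err_slope 0 + b) * \<theta> ^ Suc k * (3 * 2 ^ k) = 3 / 2 * (err_slope 0 + b) * (2 * \<theta>) ^ Suc k"
      by (simp only: power_Suc power_mult_distrib) (simp add: field_simps del: err_slope.simps)
    moreover have chord: "dyadic_chord (Suc k) (3 * 2 ^ k) = (\<theta> + 1 / 2) * (2 * \<theta>) ^ Suc k"
      unfolding dyadic_chord_def by (simp add: power_mult_distrib field_simps)
    ultimately show ?thesis
      unfolding log_bound_def G_def chord distrib_right[of a _ "(2 * \<theta>) ^ Suc k"] by linarith
  qed
  then show ?thesis by blast
qed

end
end

context lattice_percolation
begin

abbreviation expected_ball :: "nat \<Rightarrow> int ^ 'n \<Rightarrow> ennreal" where
  "expected_ball n a \<equiv> (\<integral>\<^sup>+x. emeasure law (reach n a x) \<partial>count_space UNIV)"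

text \<open>
  One step of the first-moment recursion: sum over the number \<open>i\<close> of steps before the long edge and
  over the ends of that edge. Its length bounds its probability uniformly, so the double sum
  factorises.
\<close>

lemma emeasure_reach_le:
  assumes t: "t > 0" "real n * t < real (sup_norm (a - x))" and "J \<ge> 0" "s > 0"
    and p_le: "\<And>y z. y \<noteq> z \<Longrightarrow> p {y, z} \<le> J * real (sup_norm (y - z)) powr - s"
  shows "emeasure law (reach n a x)
    \<le> (\<Sum>i<n. ennreal (J * t powr - s) * (expected_ball i a
          * expected_ball (n - 1 - i) x))"
proof -
  let ?D = "{(y, z). t < real (sup_norm (y - z))} :: ((int ^ 'n) \<times> (int ^ 'n)) set"
  let ?S = "\<lambda>i. \<Union>(y, z)\<in>?D. split_event i (n - 1 - i) a y z x"
  have S_sets: "?S i \<in> sets law" for i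
    by (rule sets.countable_UN''[OF countableI_type]) (simp add: split_beta split_event_sets)
  have "emeasure law (reach n a x) \<le> emeasure law (\<Union>i\<in>{..<n}. ?S i)"
    
    by (rule emeasure_mono[OF reach_subset_split[OF less_imp_le[OF t(1)] t(2)] sets.finite_UN[OF finite_lessThan S_sets]])
  also have "\<dots> \<le> (\<Sum>i<n. emeasure law (?S i))"
    using S_sets by (intro emeasure_subadditive_finite) auto
  also have "\<dots> \<le> (\<Sum>i<n. ennreal (J * t powr - s) * (expected_ball i a
          * expected_ball (n - 1 - i) x))"
  proof (rule sum_mono)
    fix i
    let ?j = "n - 1 - i"
    let ?J = "ennreal (J * t powr - s)"
    have "?S i = (\<Union>P\<in>?D. split_event i ?j a (fst P) (snd P) x)" by (auto simp: split_beta)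
    then have "emeasure law (?S i) \<le> (\<integral>\<^sup>+P. emeasure law (split_event i ?j a (fst P) (snd P) x) \<partial>count_space ?D)"
      by (simp only:) (rule emeasure_UN_le_nn_integral; simp add: split_event_sets)
    also have "\<dots> \<le> (\<integral>\<^sup>+P. emeasure law (reach i a (fst P)) * (?J * emeasure law (reach ?j x (snd P))) \<partial>count_space ?D)"
    proof (rule nn_integral_mono)
      fix P assume "P \<in> space (count_space ?D)"
      then obtain y z where P: "P = (y, z)" "t < real (sup_norm (y - z))" by auto
      then have "y \<noteq> z" using t by auto
      have "p {y, z} \<le> J * real (sup_norm (y - z)) powr - s" by (rule p_le) fact
      also have "\<dots> \<le> J * t powr - s"
        using t assms(3,4) P by (intro mult_left_mono powr_mono2') auto
      finally have pJ: "p {y, z} \<le> J * t powr - s" .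
      have "law.prob (split_event i ?j a y z x)
          \<le> law.prob (reach i a y) * (p {y, z} * law.prob (reach ?j z x))"
        by (rule prob_split_event) fact
      also have "\<dots> \<le> law.prob (reach i a y) * (J * t powr - s * law.prob (reach ?j x z))"
        using pJ by (subst reach_sym[of ?j z x]) (intro mult_left_mono mult_right_mono; simp)
      finally have "ennreal (law.prob (split_event i ?j a y z x))
          \<le> ennreal (law.prob (reach i a y) * (J * t powr - s * law.prob (reach ?j x z)))"
        by (rule ennreal_leI)
      then show "emeasure law (split_event i ?j a (fst P) (snd P) x)
          \<le> emeasure law (reach i a (fst P)) * (?J * emeasure law (reach ?j x (snd P)))"
        unfolding law.emeasure_eq_measure P fst_conv snd_conv using assms(3)
        by (simp add: ennreal_mult)
    qed
    also have "\<dots> \<le> (\<integral>\<^sup>+P. emeasure law (reach i a (fst P)) * (?J * emeasure law (reach ?j x (snd P))) \<partial>count_space UNIV)"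
      by (simp add: nn_integral_count_space_indicator) (intro nn_integral_mono, auto simp: indicator_def)
    also have "\<dots> = (\<integral>\<^sup>+y. \<integral>\<^sup>+z. emeasure law (reach i a y) * (?J * emeasure law (reach ?j x z)) \<partial>count_space UNIV \<partial>count_space UNIV)"
      by (subst nn_integral_fst_count_space[symmetric]) simp
    also have "\<dots> = ?J * (expected_ball i a
          * expected_ball ?j x)"
      by (simp add: nn_integral_cmult nn_integral_multc mult_ac)
    finally show "emeasure law (?S i) \<le> \<dots>" .
  qed
  finally show ?thesis .
qed

lemma reach_0: "reach 0 a x = (if a = x then space law else {})"
proof -
  have "(\<exists>vs. connecting_path \<omega> a x vs \<and> length vs \<le> Suc 0) \<longleftrightarrow> a = x" for \<omega>
  proof
    assume "\<exists>vs. connecting_path \<omega> a x vs \<and> length vs \<le> Suc 0"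
    then obtain vs where vs: "connecting_path \<omega> a x vs" "length vs \<le> Suc 0" by blast
    then show "a = x" by (cases vs) (auto simp: connecting_path_def)
  next
    assume "a = x"
    then show "\<exists>vs. connecting_path \<omega> a x vs \<and> length vs \<le> Suc 0"
      by (intro exI[of _ "[a]"]) (auto simp: connecting_path_def)
  qed
  then show ?thesis unfolding reach_def by auto
qed

text \<open>
  Induction on the number of steps, for all levels \<open>k\<close> and all centres at once; level \<open>k\<close> uses level
  \<open>k - 1\<close> for both pieces, and level \<open>0\<close> uses itself (truncated subtraction). The argument of
  \<open>log_bound\<close> is \<open>n + 1\<close>, because \<open>i\<close> steps, the long edge and \<open>n - 1 - i\<close> steps make \<open>(i + 1) + (n - i) = n + 1\<close>.
\<close>

lemma expected_ball_le:
  assumes s: "real CARD('n) < s" "s < 2 * real CARD('n)" and J: "J \<ge> 1"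
    and p_le: "\<And>y z. y \<noteq> z \<Longrightarrow> p {y, z} \<le> J * real (sup_norm (y - z)) powr - s"
    and C: "C \<ge> 1"
    and lattice_sum: "\<And>M (a :: int ^ 'n) f. M \<ge> 1 \<Longrightarrow> (\<And>x. f x \<le> 1) \<Longrightarrow>
       (\<And>x. x \<noteq> a \<Longrightarrow> f x \<le> ennreal (M * real (sup_norm (a - x)) powr - s)) \<Longrightarrow>
       (\<integral>\<^sup>+x. f x \<partial>count_space UNIV) \<le> ennreal (C * M powr (real CARD('n) / s))"
    and \<theta>_def: "\<theta> = real CARD('n) / s"
    and c_def: "c = ln C + \<theta> * s * ln 2" and c'_def: "c' = \<theta> * (s + 1)"
  shows "expected_ball n a
    \<le> ennreal (exp (log_bound \<theta> c c' (ln J) k (real n + 1)))"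
proof -
  have s0: "s > 0" using s(1) by (rule order.strict_trans1[rotated]) simp
  have \<theta>: "1 / 2 < \<theta>" "\<theta> < 1" using s s0 by (auto simp: \<theta>_def field_simps)
  have cc: "0 \<le> c" "0 \<le> c'" using C \<theta> s0 by (auto simp: c_def c'_def intro!: add_nonneg_nonneg mult_nonneg_nonneg)
  note lb = log_bound_nonneg[OF \<theta> cc] log_bound_step[OF \<theta> cc] log_bound_add[OF \<theta> cc]
  define h where "h k m = log_bound \<theta> c c' (ln J) k m" for k m
  have L: "ln J \<ge> 0" using J by simp
  show ?thesis unfolding h_def[symmetric]
  proof (induction n arbitrary: a k rule: less_induct)
    case (less n)
    show ?case
    proof (cases "n = 0")
      case True
      have "expected_ball 0 a = (\<integral>\<^sup>+x. indicator {a} x \<partial>count_space UNIV)"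
        by (intro nn_integral_cong) (auto simp: reach_0 law.emeasure_space_1 indicator_def)
      also have "\<dots> = 1" by (subst nn_integral_indicator) auto
      also have "\<dots> \<le> ennreal (exp (h k 1))"
        using lb(1)[of 1 "ln J" k] L by (simp add: h_def)
      finally show ?thesis using True by simp
    next
      case False
      define m where "m = real n + 1"
      have m: "m \<ge> 2" using False by (simp add: m_def)
      define W where "W = exp (2 * h (k - 1) (m / 2))"
      define M where "M = real n * J * (2 * real n) powr s * W"
      have W1: "W \<ge> 1" using lb(1)[of "m / 2" "ln J" "k - 1"] L m by (simp add: W_def h_def)
      have n1: "real n \<ge> 1" using False by simp
      have "1 * 1 * 1 * 1 \<le> M" unfolding M_def
        using n1 J W1 s0 by (intro mult_mono) (auto intro!: ge_one_powr_ge_zero mult_nonneg_nonneg)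
      then have M1: "M \<ge> 1" by simp
      have "expected_ball n a \<le> ennreal (C * M powr (real CARD('n) / s))"
      proof (rule lattice_sum[OF M1])
        show "emeasure law (reach n a x) \<le> 1" for x by (rule law.emeasure_le_1)
        fix x assume "x \<noteq> a"
        define r where "r = real (sup_norm (a - x))"
        have r: "r > 0" using \<open>x \<noteq> a\<close> sup_norm_eq_0[of "a - x"] by (auto simp: r_def)
        \<comment> \<open>Half of the length \<open>r / n\<close>, to make the inequality of \<open>long_edge_split\<close> strict.\<close>
        define t where "t = r / (2 * real n)"
        have t: "t > 0" "real n * t < r" using r n1 by (auto simp: t_def)
        have "emeasure law (reach n a x)
            \<le> (\<Sum>i<n. ennreal (J * t powr - s) * (expected_ball i a
              * expected_ball (n - 1 - i) x))"
          using t s0 J p_le unfolding r_def by (intro emeasure_reach_le) auto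
        also have "\<dots> \<le> (\<Sum>i<n. ennreal (J * t powr - s) * ennreal W)"
        proof (intro sum_mono mult_left_mono)
          fix i assume i: "i \<in> {..<n}"
          then have eq: "real i + 1 + (real (n - 1 - i) + 1) = m" by (auto simp: m_def of_nat_diff)
          have "expected_ball i a
              * expected_ball (n - 1 - i) x
              \<le> ennreal (exp (h (k - 1) (real i + 1))) * ennreal (exp (h (k - 1) (real (n - 1 - i) + 1)))"
            using i by (intro mult_mono less.IH) auto
          also have "\<dots> = ennreal (exp (h (k - 1) (real i + 1) + h (k - 1) (real (n - 1 - i) + 1)))"
            by (simp add: ennreal_mult[symmetric] exp_add)
          also have "\<dots> = ennreal W"
            unfolding W_def h_def lb(3) eq ..
          finally show "expected_ball i a
              * expected_ball (n - 1 - i) x \<le> ennreal W" .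
        qed auto
        also have "\<dots> = ennreal (real n * (J * t powr - s * W))"
          using J W1 by (simp add: ennreal_mult[symmetric] ennreal_of_nat_eq_real_of_nat)
        also have "real n * (J * t powr - s * W) = M * r powr - s"
        proof -
          have "t powr - s = (2 * real n) powr s * r powr - s"
            unfolding t_def using r n1 by (simp add: powr_divide powr_minus field_simps)
          then show ?thesis by (simp add: M_def mult_ac)
        qed
        finally show "emeasure law (reach n a x) \<le> ennreal (M * real (sup_norm (a - x)) powr - s)"
          unfolding r_def .
      qed
      also have "C * M powr (real CARD('n) / s) \<le> exp (h k (real n + 1))"
      proof -
        have "ln (C * M powr \<theta>) = ln C + \<theta> * ln M" using C M1 by (simp add: ln_mult ln_powr)
        also have "ln M = ln (real n) + ln J + s * (ln 2 + ln (real n)) + 2 * h (k - 1) (m / 2)"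
          unfolding M_def W_def using n1 J by (simp add: ln_mult ln_powr)
        also have "\<dots> \<le> 2 * h (k - 1) (m / 2) + ln J + s * ln 2 + (s + 1) * ln m"
        proof -
          have "(s + 1) * ln (real n) \<le> (s + 1) * ln m" using n1 s0 by (intro mult_left_mono) (auto simp: m_def)
          then show ?thesis by (simp add: algebra_simps)
        qed
        finally have "ln (C * M powr \<theta>) \<le> ln C + \<theta> * (2 * h (k - 1) (m / 2) + ln J + s * ln 2 + (s + 1) * ln m)"
          using \<theta> by simp
        also have "\<dots> = \<theta> * (2 * h (k - 1) (m / 2) + ln J) + c + c' * ln m"
          by (simp add: c_def c'_def algebra_simps)
        also have "\<dots> \<le> h k m" unfolding h_def using m L by (intro lb(2))
        finally have "exp (ln (C * M powr \<theta>)) \<le> exp (h k m)" by simp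
        then show ?thesis using C M1 by (simp add: \<theta>_def m_def)
      qed
      finally show ?thesis by (simp add: ennreal_leI)
    qed
  qed
qed

end

lemma expected_ball_at_midpoint:
  assumes s: "real CARD('n) < s" "s < 2 * real CARD('n)" and \<theta>_def: "\<theta> = real CARD('n) / s"
  shows "\<exists>G. \<forall>(B :: (int ^ 'n) set \<Rightarrow> bool pmf) J k a. J \<ge> 1 \<longrightarrow>
    (\<forall>y z. y \<noteq> z \<longrightarrow> pmf (B {y, z}) True \<le> J * real (sup_norm (y - z)) powr - s) \<longrightarrow>
    (\<integral>\<^sup>+x. emeasure (bernoulli_field.law lattice_edges B) (lattice_percolation.reach B (3 * 2 ^ k - 1) a x) \<partial>count_space UNIV)
     \<le> ennreal (exp ((2 * \<theta>) ^ Suc k * (\<theta> * ln J / (2 * \<theta> - 1) * (\<theta> + 1 / 2) + G)))"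
proof -
  obtain C where C: "C \<ge> 1" and lattice_sum: "\<And>M (a :: int ^ 'n) f. M \<ge> 1 \<Longrightarrow> (\<And>x. f x \<le> 1) \<Longrightarrow>
       (\<And>x. x \<noteq> a \<Longrightarrow> f x \<le> ennreal (M * real (sup_norm (a - x)) powr - s)) \<Longrightarrow>
       (\<integral>\<^sup>+x. f x \<partial>count_space UNIV) \<le> ennreal (C * M powr (real CARD('n) / s))"
    using lattice_sum_le[OF s(1)] by blast
  define c where "c = ln C + \<theta> * s * ln 2"
  define c' where "c' = \<theta> * (s + 1)"
  have s0: "s > 0" using s(1) by (rule order.strict_trans1[rotated]) simp
  have \<theta>: "1 / 2 < \<theta>" "\<theta> < 1" using s s0 by (auto simp: \<theta>_def field_simps)
  have cc: "0 \<le> c" "0 \<le> c'" using C \<theta> s0 by (auto simp: c_def c'_def intro!: add_nonneg_nonneg mult_nonneg_nonneg)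
  obtain G where G: "\<And>L k. log_bound \<theta> c c' L (Suc k) (3 * 2 ^ k)
      \<le> \<theta> * L / (2 * \<theta> - 1) * ((\<theta> + 1 / 2) * (2 * \<theta>) ^ Suc k - 1) + G * (2 * \<theta>) ^ Suc k"
    using log_bound_at_midpoint[OF \<theta> cc] by blast
  show ?thesis
  proof (intro exI[of _ G] allI impI)
    fix B :: "(int ^ 'n) set \<Rightarrow> bool pmf" and J :: real and k a
    assume J: "J \<ge> 1" and p_le: "\<forall>y z. y \<noteq> z \<longrightarrow> pmf (B {y, z}) True \<le> J * real (sup_norm (y - z)) powr - s"
    interpret lattice_percolation B .
    have "expected_ball (3 * 2 ^ k - 1) a
        \<le> ennreal (exp (log_bound \<theta> c c' (ln J) (Suc k) (real (3 * 2 ^ k - 1) + 1)))"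
      by (rule expected_ball_le[OF s J _ C lattice_sum \<theta>_def c_def c'_def]) (use p_le in auto)
    also have "real (3 * 2 ^ k - 1) + 1 = 3 * 2 ^ k" by (simp add: of_nat_diff)
    also have "log_bound \<theta> c c' (ln J) (Suc k) (3 * 2 ^ k)
        \<le> (2 * \<theta>) ^ Suc k * (\<theta> * ln J / (2 * \<theta> - 1) * (\<theta> + 1 / 2) + G)"
    proof -
      have "0 \<le> \<theta> * ln J / (2 * \<theta> - 1)" using \<theta> J by simp
      then have "\<theta> * ln J / (2 * \<theta> - 1) * ((\<theta> + 1 / 2) * (2 * \<theta>) ^ Suc k - 1)
          \<le> \<theta> * ln J / (2 * \<theta> - 1) * ((\<theta> + 1 / 2) * (2 * \<theta>) ^ Suc k)"
        by (intro mult_left_mono) auto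
      moreover have "(2 * \<theta>) ^ Suc k * (\<theta> * ln J / (2 * \<theta> - 1) * (\<theta> + 1 / 2) + G)
          = \<theta> * ln J / (2 * \<theta> - 1) * ((\<theta> + 1 / 2) * (2 * \<theta>) ^ Suc k) + G * (2 * \<theta>) ^ Suc k"
        by (simp only: distrib_left mult_ac)
      ultimately show ?thesis using G[of "ln J" k] by linarith
    qed
    finally show "expected_ball (3 * 2 ^ k - 1) a
     \<le> ennreal (exp ((2 * \<theta>) ^ Suc k * (\<theta> * ln J / (2 * \<theta> - 1) * (\<theta> + 1 / 2) + G)))"
      by (simp add: ennreal_leI)
  qed
qed

section \<open>Distances inside a region and their renormalisation\<close>

text \<open>
  The distance using only vertices of \<open>W\<close>. It depends only on the edges inside \<open>W\<close>, so distances in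
  disjoint regions are independent of each other and of the edges between the regions.
\<close>

definition dist_in :: "'a set \<Rightarrow> ('a set \<Rightarrow> bool) \<Rightarrow> 'a \<Rightarrow> 'a \<Rightarrow> ennreal" where
  "dist_in W \<omega> a x = (INF vs\<in>{vs. connecting_path \<omega> a x vs \<and> set vs \<subseteq> W}. of_nat (length vs - 1))"

lemma dist_in_le:
  "connecting_path \<omega> a x vs \<Longrightarrow> set vs \<subseteq> W \<Longrightarrow> dist_in W \<omega> a x \<le> of_nat (length vs - 1)"
  unfolding dist_in_def by (rule INF_lower) simp

lemma dist_in_mono: "W \<subseteq> W' \<Longrightarrow> dist_in W' \<omega> a x \<le> dist_in W \<omega> a x"
  unfolding dist_in_def by (rule INF_superset_mono) auto

lemma dist_in_self: "a \<in> W \<Longrightarrow> dist_in W \<omega> a a = 0"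
  using dist_in_le[of \<omega> a a "[a]" W] by (simp add: connecting_path_def)

lemma dist_in_attained:
  assumes "dist_in W \<omega> a x \<noteq> \<top>"
  obtains vs where "connecting_path \<omega> a x vs" "set vs \<subseteq> W" "dist_in W \<omega> a x = of_nat (length vs - 1)"
proof -
  let ?P = "\<lambda>vs. connecting_path \<omega> a x vs \<and> set vs \<subseteq> W"
  have "\<exists>vs. ?P vs"
  proof (rule ccontr)
    assume "\<not> (\<exists>vs. ?P vs)"
    then have "{vs. ?P vs} = {}" by blast
    then have "dist_in W \<omega> a x = \<top>" unfolding dist_in_def by simp
    with assms show False by simp
  qed
  then obtain vs where vs: "?P vs" "\<And>us. ?P us \<Longrightarrow> length vs \<le> length us"
    using ex_has_least_nat[of ?P _ length] by blast
  have "of_nat (length vs - 1) \<le> dist_in W \<omega> a x"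
    unfolding dist_in_def using vs(2) by (intro INF_greatest) (simp add: diff_le_mono)
  then have "dist_in W \<omega> a x = of_nat (length vs - 1)"
    using vs(1) dist_in_le[of \<omega> a x vs W] by (intro antisym) auto
  with vs(1) show thesis using that[of vs] by blast
qed

lemma dist_in_glue:
  assumes "W1 \<inter> W2 = {}" "\<omega> {y, z}"
  shows "dist_in (W1 \<union> W2) \<omega> a x \<le> dist_in W1 \<omega> a y + 1 + dist_in W2 \<omega> x z"
proof (cases "dist_in W1 \<omega> a y = \<top> \<or> dist_in W2 \<omega> x z = \<top>")
  case False
  then have fin: "dist_in W1 \<omega> a y \<noteq> \<top>" "dist_in W2 \<omega> x z \<noteq> \<top>" by simp_all
  obtain as where as: "connecting_path \<omega> a y as" "set as \<subseteq> W1" "dist_in W1 \<omega> a y = of_nat (length as - 1)"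
    using dist_in_attained[OF fin(1)] .
  obtain bs where bs: "connecting_path \<omega> x z bs" "set bs \<subseteq> W2" "dist_in W2 \<omega> x z = of_nat (length bs - 1)"
    using dist_in_attained[OF fin(2)] .
  have A: "as \<noteq> []" "hd as = a" "last as = y" "distinct as" "successively (\<lambda>u v. u \<noteq> v \<and> \<omega> {u, v}) as"
    using as(1) by (simp_all add: connecting_path_def)
  have B: "bs \<noteq> []" "hd bs = x" "last bs = z" "distinct bs" "successively (\<lambda>u v. u \<noteq> v \<and> \<omega> {u, v}) bs"
    using bs(1) by (simp_all add: connecting_path_def)
  note ne = A(1) B(1)
  have "y \<in> W1" "z \<in> W2"
    using A(3) B(3) last_in_set[OF A(1)] last_in_set[OF B(1)] as(2) bs(2) by blast+
  then have "y \<noteq> z" using assms by blast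
  have "successively (\<lambda>u v. u \<noteq> v \<and> \<omega> {u, v}) (rev bs)"
    unfolding successively_rev using B(5) by (rule successively_mono) (auto simp: insert_commute)
  moreover have "set as \<inter> set bs = {}" using as(2) bs(2) assms(1) by blast
  ultimately have "connecting_path \<omega> a x (as @ rev bs)"
    using A B assms(2) \<open>y \<noteq> z\<close> unfolding connecting_path_def
    by (simp add: successively_append_iff hd_rev last_rev)
  then have "dist_in (W1 \<union> W2) \<omega> a x \<le> of_nat (length (as @ rev bs) - 1)"
    by (rule dist_in_le) (use as(2) bs(2) in auto)
  also have "length (as @ rev bs) - 1 = (length as - 1) + 1 + (length bs - 1)"
    using ne by (cases as; cases bs) auto
  finally show ?thesis unfolding as(3) bs(3) by (simp add: add_ac)
qed auto

lemma connecting_path_cong: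
  assumes "\<And>e. e \<in> path_edges vs \<Longrightarrow> \<omega> e = \<omega>' e"
  shows "connecting_path \<omega> a x vs \<longleftrightarrow> connecting_path \<omega>' a x vs"
proof (cases "distinct vs")
  case True
  show ?thesis
    unfolding connecting_path_def successively_open_iff[OF True] using assms by simp
qed (simp add: connecting_path_def)

definition inner_edges :: "(int ^ 'n) set \<Rightarrow> (int ^ 'n) set set" where
  "inner_edges W = {e \<in> lattice_edges. e \<subseteq> W}"

lemma path_edges_inner:
  assumes "distinct vs" "set vs \<subseteq> W" shows "path_edges vs \<subseteq> inner_edges W"
  unfolding inner_edges_def using assms path_edges_subset path_edges_lattice by blast

lemma dist_in_restrict:
  assumes "inner_edges W \<subseteq> K"
  shows "dist_in W (restrict \<omega> K) a x = dist_in W \<omega> a x"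
proof -
  have "connecting_path (restrict \<omega> K) a x vs \<longleftrightarrow> connecting_path \<omega> a x vs" if "set vs \<subseteq> W" for vs
  proof (cases "distinct vs")
    case True
    show ?thesis
      by (rule connecting_path_cong) (use path_edges_inner[OF True that] assms in auto)
  qed (simp add: connecting_path_def)
  then have "{vs. connecting_path (restrict \<omega> K) a x vs \<and> set vs \<subseteq> W}
      = {vs. connecting_path \<omega> a x vs \<and> set vs \<subseteq> W}" by blast
  then show ?thesis unfolding dist_in_def by simp
qed

lemma dist_in_measurable:
  assumes "inner_edges W \<subseteq> K"
  shows "(\<lambda>\<omega>. dist_in W \<omega> a x) \<in> borel_measurable (bernoulli_field.law K B)"
proof -
  interpret bernoulli_field K B .
  let ?V = "{vs. vs \<noteq> [] \<and> hd vs = a \<and> last vs = x \<and> distinct vs \<and> set vs \<subseteq> W}"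
  have eq: "dist_in W \<omega> a x = (INF vs\<in>?V. if all_open (path_edges vs) \<omega> then of_nat (length vs - 1) else \<top>)"
    (is "_ = ?R") for \<omega>
  proof (rule antisym)
    show "dist_in W \<omega> a x \<le> ?R"
    proof (rule INF_greatest)
      fix vs assume "vs \<in> ?V"
      then show "dist_in W \<omega> a x \<le> (if all_open (path_edges vs) \<omega> then of_nat (length vs - 1) else \<top>)"
        using dist_in_le[of \<omega> a x vs W]
        by (auto simp: connecting_path_def successively_open_iff all_open_def)
    qed
    show "?R \<le> dist_in W \<omega> a x"
      unfolding dist_in_def
    proof (rule INF_greatest)
      fix vs assume vs: "vs \<in> {vs. connecting_path \<omega> a x vs \<and> set vs \<subseteq> W}"
      then have "vs \<in> ?V" "all_open (path_edges vs) \<omega>"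
        by (auto simp: connecting_path_def successively_open_iff all_open_def)
      then show "?R \<le> of_nat (length vs - 1)" by (intro INF_lower2[of vs]) auto
    qed
  qed
  have "(\<lambda>\<omega>. INF vs\<in>?V. if all_open (path_edges vs) \<omega> then of_nat (length vs - 1) else (\<top>::ennreal))
      \<in> borel_measurable law"
  proof (rule borel_measurable_INF)
    fix vs assume vs: "vs \<in> ?V"
    have "{\<omega> \<in> space law. all_open (path_edges vs) \<omega>} \<in> sets law"
      by (rule all_open_sets) (use path_edges_inner[of vs W] vs assms in \<open>auto simp: finite_path_edges\<close>)
    then show "(\<lambda>\<omega>. if all_open (path_edges vs) \<omega> then of_nat (length vs - 1) else (\<top>::ennreal)) \<in> borel_measurable law"
      by (intro measurable_If) auto
  qed (rule countableI_type)
  then show ?thesis unfolding eq[abs_def] .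
qed

context bernoulli_field
begin

lemma indep_coordinates:
  assumes "I \<noteq> {}"
  shows "law.indep_vars (\<lambda>e. measure_pmf (B e)) (\<lambda>e \<omega>. \<omega> e) I"
proof (subst law.indep_vars_iff_distr_eq_PiM'[OF assms])
  show "(\<lambda>\<omega>. \<omega> e) \<in> measurable law (measure_pmf (B e))" if "e \<in> I" for e
    unfolding law_def by (rule measurable_component_singleton[OF that])
  have "distr law (PiM I (\<lambda>e. measure_pmf (B e))) (\<lambda>\<omega>. \<lambda>e\<in>I. \<omega> e) = distr law law (\<lambda>\<omega>. \<omega>)"
    by (intro distr_cong) (auto simp: law_def space_PiM)
  also have "\<dots> = law" by (rule distr_id)
  also have "law = PiM I (\<lambda>e. distr law (measure_pmf (B e)) (\<lambda>\<omega>. \<omega> e))"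
    unfolding law_def by (intro PiM_cong) (simp_all add: PiM_component)
  finally show "distr law (PiM I (\<lambda>e. measure_pmf (B e))) (\<lambda>\<omega>. \<lambda>e\<in>I. \<omega> e)
      = PiM I (\<lambda>e. distr law (measure_pmf (B e)) (\<lambda>\<omega>. \<omega> e))" .
qed

lemma nn_integral_disjoint_blocks:
  assumes K: "K1 \<subseteq> I" "K2 \<subseteq> I" "K1 \<inter> K2 = {}" "I \<noteq> {}"
    and f: "f \<in> borel_measurable (PiM K1 (\<lambda>e. measure_pmf (B e)))"
    and g: "g \<in> borel_measurable (PiM K2 (\<lambda>e. measure_pmf (B e)))"
  shows "(\<integral>\<^sup>+\<omega>. f (restrict \<omega> K1) * g (restrict \<omega> K2) \<partial>law)
    = (\<integral>\<^sup>+\<omega>. f (restrict \<omega> K1) \<partial>law) * (\<integral>\<^sup>+\<omega>. g (restrict \<omega> K2) \<partial>law)"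
proof -
  let ?K = "case_bool K1 K2"
  have "law.indep_vars (\<lambda>j. PiM (?K j) (\<lambda>e. measure_pmf (B e))) (\<lambda>j \<omega>. \<lambda>e\<in>?K j. \<omega> e) UNIV"
    using K by (intro law.indep_vars_restrict[OF indep_coordinates])
      (auto simp: disjoint_family_on_def split: bool.splits)
  then have "law.indep_vars (\<lambda>_. borel) (\<lambda>j \<omega>. case_bool f g j (\<lambda>e\<in>?K j. \<omega> e)) UNIV"
    by (rule law.indep_vars_compose2) (use f g in \<open>auto split: bool.splits\<close>)
  then have "(\<integral>\<^sup>+\<omega>. (\<Prod>j\<in>UNIV. case_bool f g j (\<lambda>e\<in>?K j. \<omega> e)) \<partial>law)
      = (\<Prod>j\<in>UNIV. \<integral>\<^sup>+\<omega>. case_bool f g j (\<lambda>e\<in>?K j. \<omega> e) \<partial>law)"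
    by (intro law.indep_vars_nn_integral) auto
  then show ?thesis by (simp add: UNIV_bool mult.commute)
qed

end

text \<open>
  Coordinates are moved one unit at a time towards the target. The intervals in the third part
  keep the path inside a box around its starting point; they also show that the first vertex is never
  visited again.
\<close>

lemma between_path:
  fixes a x :: "int ^ 'n"
  shows "\<exists>vs. vs \<noteq> [] \<and> hd vs = a \<and> last vs = x \<and> distinct vs
    \<and> successively (\<lambda>u v. nearest_neighbor_of_origin (u - v)) vs
    \<and> (\<forall>u\<in>set vs. \<forall>i. min (a $ i) (x $ i) \<le> u $ i \<and> u $ i \<le> max (a $ i) (x $ i))
    \<and> int (length vs) = 1 + (\<Sum>i\<in>UNIV. \<bar>x $ i - a $ i\<bar>)"
proof (induction "nat (\<Sum>i\<in>UNIV. \<bar>x $ i - a $ i\<bar>)" arbitrary: a rule: less_induct)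
  case less
  show ?case
  proof (cases "a = x")
    case True
    then show ?thesis by (intro exI[of _ "[a]"]) auto
  next
    case False
    then obtain i where i: "a $ i \<noteq> x $ i" by (auto simp: vec_eq_iff)
    define a' where "a' = (\<chi> j. if j = i then a $ i + sgn (x $ i - a $ i) else a $ j)"
    have a': "a' $ i = a $ i + sgn (x $ i - a $ i)" "\<And>j. j \<noteq> i \<Longrightarrow> a' $ j = a $ j"
      by (simp_all add: a'_def)
    have split: "(\<Sum>j\<in>UNIV. f j) = f i + (\<Sum>j\<in>UNIV - {i}. f j)" for f :: "'n \<Rightarrow> int"
      by (rule sum.remove) auto
    have rest: "(\<Sum>j\<in>UNIV - {i}. \<bar>x $ j - a' $ j\<bar>) = (\<Sum>j\<in>UNIV - {i}. \<bar>x $ j - a $ j\<bar>)"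
      by (intro sum.cong) (auto simp: a')
    have l1: "(\<Sum>j\<in>UNIV. \<bar>x $ j - a' $ j\<bar>) = (\<Sum>j\<in>UNIV. \<bar>x $ j - a $ j\<bar>) - 1"
      unfolding split[of "\<lambda>j. \<bar>x $ j - a $ j\<bar>"] split[of "\<lambda>j. \<bar>x $ j - a' $ j\<bar>"] rest a'
      using i by (auto simp: sgn_if abs_if)
    have "0 \<le> (\<Sum>j\<in>UNIV. \<bar>x $ j - a' $ j\<bar>)" by (intro sum_nonneg) auto
    then have "nat (\<Sum>j\<in>UNIV. \<bar>x $ j - a' $ j\<bar>) < nat (\<Sum>j\<in>UNIV. \<bar>x $ j - a $ j\<bar>)"
      unfolding l1 by linarith
    from less[OF this] obtain vs where vs: "vs \<noteq> []" "hd vs = a'" "last vs = x" "distinct vs"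
      "successively (\<lambda>u v. nearest_neighbor_of_origin (u - v)) vs"
      "\<And>u j. u \<in> set vs \<Longrightarrow> min (a' $ j) (x $ j) \<le> u $ j \<and> u $ j \<le> max (a' $ j) (x $ j)"
      "int (length vs) = 1 + (\<Sum>j\<in>UNIV. \<bar>x $ j - a' $ j\<bar>)" by blast
    have btw: "min (a $ j) (x $ j) \<le> u $ j \<and> u $ j \<le> max (a $ j) (x $ j)" if "u \<in> set vs" for u j
      using vs(6)[OF that, of j] i a' by (cases "j = i") (auto simp: sgn_if split: if_splits)
    have "a \<notin> set vs"
    proof
      assume "a \<in> set vs"
      from vs(6)[OF this, of i] show False using i a' by (auto simp: sgn_if split: if_splits)
    qed
    moreover have "nearest_neighbor_of_origin (a - a')"
      unfolding nearest_neighbor_of_origin_def split[of "\<lambda>j. \<bar>(a - a') $ j\<bar>"]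
      using i a' by (simp add: sgn_if)
    ultimately show ?thesis
      using vs btw l1 by (intro exI[of _ "a # vs"]) (auto simp: successively_Cons)
  qed
qed

context lattice_percolation
begin

abbreviation expected_dist :: "(int ^ 'n) set \<Rightarrow> int ^ 'n \<Rightarrow> int ^ 'n \<Rightarrow> ennreal" where
  "expected_dist W a x \<equiv> (\<integral>\<^sup>+\<omega>. dist_in W \<omega> a x \<partial>law)"

lemma AE_nearest_neighbor_dist:
  assumes nn: "\<And>u v. nearest_neighbor_of_origin (u - v) \<Longrightarrow> p {u, v} = 1"
  shows "AE \<omega> in law. dist_in (sup_box a (sup_norm (x - a))) \<omega> a x \<le> of_nat (CARD('n) * sup_norm (x - a))"
proof -
  have "AE \<omega> in law. \<forall>u v. nearest_neighbor_of_origin (u - v) \<longrightarrow> \<omega> {u, v}"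
    unfolding AE_all_countable
  proof (intro allI)
    fix u v :: "int ^ 'n"
    show "AE \<omega> in law. nearest_neighbor_of_origin (u - v) \<longrightarrow> \<omega> {u, v}"
    proof (cases "nearest_neighbor_of_origin (u - v)")
      case True
      then have "u \<noteq> v" by (auto simp: nearest_neighbor_of_origin_def)
      then have "law.prob {\<omega> \<in> space law. all_open {{u, v}} \<omega>} = 1"
        using prob_edge_open[of "{u, v}"] nn[OF True] by (auto simp: lattice_edges_def)
      from law.AE_prob_1[OF this] show ?thesis by (auto simp: all_open_def)
    qed simp
  qed
  then show ?thesis
  proof eventually_elim
    case (elim \<omega>)
    obtain vs where vs: "vs \<noteq> []" "hd vs = a" "last vs = x" "distinct vs"
      "successively (\<lambda>u v. nearest_neighbor_of_origin (u - v)) vs"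
      "\<forall>u\<in>set vs. \<forall>i. min (a $ i) (x $ i) \<le> u $ i \<and> u $ i \<le> max (a $ i) (x $ i)"
      "int (length vs) = 1 + (\<Sum>i\<in>UNIV. \<bar>x $ i - a $ i\<bar>)"
      using between_path[of a x] by blast
    have "successively (\<lambda>u v. u \<noteq> v \<and> \<omega> {u, v}) vs"
      using vs(5) by (rule successively_mono) (use elim in \<open>auto simp: nearest_neighbor_of_origin_def\<close>)
    then have path: "connecting_path \<omega> a x vs" using vs by (simp add: connecting_path_def)
    have "set vs \<subseteq> sup_box a (sup_norm (x - a))"
    proof
      fix u assume u: "u \<in> set vs"
      have "\<bar>(u - a) $ i\<bar> \<le> int (sup_norm (x - a))" for i
      proof -
        have "\<bar>(u - a) $ i\<bar> \<le> \<bar>(x - a) $ i\<bar>"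
          using vs(6)[rule_format, OF u, of i] by (auto simp: min_def max_def split: if_splits)
        also have "\<dots> \<le> int (sup_norm (x - a))" by (rule coord_le_sup_norm)
        finally show ?thesis .
      qed
      then show "u \<in> sup_box a (sup_norm (x - a))" by (simp add: sup_box_def sup_norm_le_iff)
    qed
    then have "dist_in (sup_box a (sup_norm (x - a))) \<omega> a x \<le> of_nat (length vs - 1)"
      by (rule dist_in_le[OF path])
    also have "length vs - 1 \<le> CARD('n) * sup_norm (x - a)"
    proof -
      have "(\<Sum>i\<in>UNIV. \<bar>x $ i - a $ i\<bar>) \<le> (\<Sum>i\<in>(UNIV::'n set). int (sup_norm (x - a)))"
        using coord_le_sup_norm[of "x - a"] by (intro sum_mono) simp
      then have "int (length vs) \<le> 1 + int (CARD('n) * sup_norm (x - a))" using vs(7) by simp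
      then show ?thesis by linarith
    qed
    finally show ?case by simp
  qed
qed

text \<open>
  Decompose according to the set of open edges between \<open>Y\<close> and \<open>Z\<close>. If it is nonempty, one of
  its edges joins a path inside \<open>W1\<close> to a path inside \<open>W2\<close>; which edge is used depends only on the
  edges between the regions and hence not on the two inner distances. Thus the inner expectations enter
  unconditioned, and the two bounds \<open>F\<close> add up with total weight at most one.
\<close>

lemma expected_dist_renormalise:
  assumes Y: "finite Y" "Y \<subseteq> W1" and Z: "finite Z" "Z \<subseteq> W2"
    and W: "W1 \<inter> W2 = {}" "W1 \<union> W2 \<subseteq> W"
    and FY: "\<And>y. y \<in> Y \<Longrightarrow> (expected_dist W1 a y) \<le> F"
    and FZ: "\<And>z. z \<in> Z \<Longrightarrow> (expected_dist W2 x z) \<le> F"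
    and D: "AE \<omega> in law. dist_in W \<omega> a x \<le> D"
    and p: "\<And>y z. y \<in> Y \<Longrightarrow> z \<in> Z \<Longrightarrow> 1 - p {y, z} \<le> q" and q: "0 \<le> q"
  shows "expected_dist W a x \<le> 2 * F + 1 + D * ennreal (q ^ (card Y * card Z))"
proof -
  define J where "J = (\<lambda>(y, z). {y, z}) ` (Y \<times> Z)"
  have ne: "y \<noteq> z" if "y \<in> Y" "z \<in> Z" for y z using that Y Z W by auto
  have J: "finite J" "J \<subseteq> lattice_edges"
    unfolding J_def using Y Z ne by (simp, fastforce simp: lattice_edges_def)
  have inj: "inj_on (\<lambda>(y, z). {y, z}) (Y \<times> Z)"
  proof (rule inj_onI, clarify)
    fix y z y' z' assume "y \<in> Y" "z \<in> Z" "y' \<in> Y" "z' \<in> Z" "{y, z} = {y', z'}"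
    then show "y = y' \<and> z = z'" using W Y Z by (auto simp: doubleton_eq_iff)
  qed
  define cross_open where "cross_open \<omega> = {e\<in>J. \<omega> e}" for \<omega>
  define T where "T \<omega> = dist_in W \<omega> a x" for \<omega>
  have Tm: "T \<in> borel_measurable law"
    unfolding T_def[abs_def] law_def
    by (rule dist_in_measurable[unfolded bernoulli_field.law_def]) (auto simp: inner_edges_def)
  define E where "E \<eta> = {\<omega> \<in> space law. cross_open \<omega> = \<eta>}" for \<eta>
  have Es [measurable]: "E \<eta> \<in> sets law" for \<eta>
    unfolding E_def cross_open_def by (rule pattern_sets[OF J])
  have block: "(\<integral>\<^sup>+\<omega>. dist_in V \<omega> u v * indicator (E \<eta>) \<omega> \<partial>law) \<le> F * emeasure law (E \<eta>)"
    if V: "V = W1 \<or> V = W2" and le: "expected_dist V u v \<le> F" for V u v \<eta>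
  proof -
    have disj: "inner_edges V \<inter> J = {}"
      using V W Y Z unfolding inner_edges_def J_def by auto
    let ?f = "\<lambda>\<omega>. dist_in V \<omega> u v" and ?g = "\<lambda>\<omega>. of_bool (cross_open \<omega> = \<eta>) :: ennreal"
    have g: "?g \<in> borel_measurable (PiM J (\<lambda>e. measure_pmf (B e)))"
    proof -
      interpret J: bernoulli_field J B .
      have "{\<omega> \<in> space J.law. cross_open \<omega> = \<eta>} \<in> sets J.law"
        unfolding cross_open_def by (rule J.pattern_sets[OF J(1)]) simp
      then have "(\<lambda>\<omega>. if cross_open \<omega> = \<eta> then 1 else (0::ennreal)) \<in> borel_measurable J.law"
        by (intro measurable_If) auto
      then show ?thesis unfolding J.law_def of_bool_def .
    qed
    have "(\<integral>\<^sup>+\<omega>. dist_in V \<omega> u v * indicator (E \<eta>) \<omega> \<partial>law)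
        = (\<integral>\<^sup>+\<omega>. ?f (restrict \<omega> (inner_edges V)) * ?g (restrict \<omega> J) \<partial>law)"
    proof (rule nn_integral_cong)
      fix \<omega> assume "\<omega> \<in> space law"
      then have "indicator (E \<eta>) \<omega> = ?g (restrict \<omega> J)"
        unfolding E_def cross_open_def by (auto simp: indicator_def intro!: arg_cong[where f="\<lambda>b. of_bool b"])
      then show "dist_in V \<omega> u v * indicator (E \<eta>) \<omega> = ?f (restrict \<omega> (inner_edges V)) * ?g (restrict \<omega> J)"
        by (simp add: dist_in_restrict)
    qed
    also have "\<dots> = (\<integral>\<^sup>+\<omega>. ?f (restrict \<omega> (inner_edges V)) \<partial>law) * (\<integral>\<^sup>+\<omega>. ?g (restrict \<omega> J) \<partial>law)"
    proof (rule nn_integral_disjoint_blocks)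
      have "{0, 1} \<in> (lattice_edges :: (int ^ 'n) set set)"
        unfolding lattice_edges_def
        by (intro CollectI exI[of _ 0] exI[of _ 1]) (simp add: vec_eq_iff)
      then show "(lattice_edges :: (int ^ 'n) set set) \<noteq> {}" by blast
      show "?f \<in> borel_measurable (PiM (inner_edges V) (\<lambda>e. measure_pmf (B e)))"
        by (rule dist_in_measurable[unfolded bernoulli_field.law_def]) simp
    qed (use J disj g in \<open>auto simp: inner_edges_def\<close>)
    also have "(\<integral>\<^sup>+\<omega>. ?f (restrict \<omega> (inner_edges V)) \<partial>law) = (\<integral>\<^sup>+\<omega>. ?f \<omega> \<partial>law)"
      by (simp add: dist_in_restrict)
    also have "(\<integral>\<^sup>+\<omega>. ?g (restrict \<omega> J) \<partial>law) = (\<integral>\<^sup>+\<omega>. indicator (E \<eta>) \<omega> \<partial>law)"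
      unfolding E_def cross_open_def
      by (intro nn_integral_cong) (auto simp: indicator_def intro!: arg_cong[where f="\<lambda>b. of_bool b"])
    also have "\<dots> = emeasure law (E \<eta>)" by simp
    finally show ?thesis using le by (simp add: mult_right_mono)
  qed
  have some: "(\<integral>\<^sup>+\<omega>. T \<omega> * indicator (E \<eta>) \<omega> \<partial>law) \<le> (2 * F + 1) * emeasure law (E \<eta>)"
    if "\<eta> \<in> Pow J - {{}}" for \<eta>
  proof -
    from that obtain e where "e \<in> \<eta>" "e \<in> J" by blast
    then obtain y z where yz: "y \<in> Y" "z \<in> Z" "{y, z} \<in> \<eta>" unfolding J_def by auto
    have "(\<integral>\<^sup>+\<omega>. T \<omega> * indicator (E \<eta>) \<omega> \<partial>law)
        \<le> (\<integral>\<^sup>+\<omega>. dist_in W1 \<omega> a y * indicator (E \<eta>) \<omega> + indicator (E \<eta>) \<omega> + dist_in W2 \<omega> x z * indicator (E \<eta>) \<omega> \<partial>law)"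
    proof (rule nn_integral_mono)
      fix \<omega> assume "\<omega> \<in> space law"
      show "T \<omega> * indicator (E \<eta>) \<omega>
          \<le> dist_in W1 \<omega> a y * indicator (E \<eta>) \<omega> + indicator (E \<eta>) \<omega> + dist_in W2 \<omega> x z * indicator (E \<eta>) \<omega>"
      proof (cases "\<omega> \<in> E \<eta>")
        case True
        then have "\<omega> {y, z}" using yz by (auto simp: E_def cross_open_def)
        from dist_in_glue[of W1 W2 \<omega> y z a x, OF W(1) this] dist_in_mono[OF W(2), of \<omega> a x]
        show ?thesis using True by (simp add: T_def)
      qed simp
    qed
    also have "\<dots> = (\<integral>\<^sup>+\<omega>. dist_in W1 \<omega> a y * indicator (E \<eta>) \<omega> \<partial>law) + emeasure law (E \<eta>)
        + (\<integral>\<^sup>+\<omega>. dist_in W2 \<omega> x z * indicator (E \<eta>) \<omega> \<partial>law)"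
    proof -
      have [measurable]: "(\<lambda>\<omega>. dist_in V \<omega> u v) \<in> borel_measurable law" for V u v
        unfolding law_def
        by (rule dist_in_measurable[unfolded bernoulli_field.law_def]) (auto simp: inner_edges_def)
      show ?thesis by (subst nn_integral_add; simp)+
    qed
    also have "\<dots> \<le> F * emeasure law (E \<eta>) + emeasure law (E \<eta>) + F * emeasure law (E \<eta>)"
      using yz FY FZ by (intro add_mono block) auto
    also have "\<dots> = (2 * F + 1) * emeasure law (E \<eta>)"
      by (simp add: distrib_right mult_2 add_ac)
    finally show ?thesis .
  qed
  have none: "(\<integral>\<^sup>+\<omega>. T \<omega> * indicator (E {}) \<omega> \<partial>law) \<le> D * ennreal (q ^ (card Y * card Z))"
  proof -
    have "(\<integral>\<^sup>+\<omega>. T \<omega> * indicator (E {}) \<omega> \<partial>law) \<le> (\<integral>\<^sup>+\<omega>. D * indicator (E {}) \<omega> \<partial>law)"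
    proof (rule nn_integral_mono_AE)
      show "AE \<omega> in law. T \<omega> * indicator (E {}) \<omega> \<le> D * indicator (E {}) \<omega>"
        using D unfolding T_def by eventually_elim (rule mult_right_mono, simp_all)
    qed
    also have "\<dots> = D * emeasure law (E {})" by (simp add: nn_integral_cmult_indicator)
    also have "law.prob (E {}) = (\<Prod>e\<in>J. 1 - p e)"
      unfolding E_def cross_open_def using prob_pattern[OF J, of "{}"] by simp
    then have "emeasure law (E {}) = ennreal (\<Prod>e\<in>J. 1 - p e)" by (simp add: law.emeasure_eq_measure)
    also have "(\<Prod>e\<in>J. 1 - p e) \<le> (\<Prod>e\<in>J. q)"
      using p by (intro prod_mono) (auto simp: J_def p_range)
    also have "\<dots> = q ^ (card Y * card Z)"
      by (simp add: J_def card_image[OF inj] card_cartesian_product)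
    finally show ?thesis by (simp add: mult_left_mono ennreal_leI)
  qed
  have cover: "(\<Sum>\<eta>\<in>Pow J. indicator (E \<eta>) \<omega>) = (1::ennreal)" if "\<omega> \<in> space law" for \<omega>
  proof -
    have "(\<Sum>\<eta>\<in>Pow J. indicator (E \<eta>) \<omega>) = (\<Sum>\<eta>\<in>Pow J. if \<eta> = cross_open \<omega> then 1 else (0::ennreal))"
      using that by (intro sum.cong) (auto simp: E_def indicator_def)
    also have "\<dots> = 1" using J by (subst sum.delta) (auto simp: cross_open_def)
    finally show ?thesis .
  qed
  have "(\<integral>\<^sup>+\<omega>. T \<omega> \<partial>law) = (\<integral>\<^sup>+\<omega>. (\<Sum>\<eta>\<in>Pow J. T \<omega> * indicator (E \<eta>) \<omega>) \<partial>law)"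
    by (intro nn_integral_cong) (simp add: sum_distrib_left[symmetric] cover)
  also have "\<dots> = (\<Sum>\<eta>\<in>Pow J. \<integral>\<^sup>+\<omega>. T \<omega> * indicator (E \<eta>) \<omega> \<partial>law)"
    using Tm by (intro nn_integral_sum) simp
  also have "\<dots> = (\<integral>\<^sup>+\<omega>. T \<omega> * indicator (E {}) \<omega> \<partial>law)
      + (\<Sum>\<eta>\<in>Pow J - {{}}. \<integral>\<^sup>+\<omega>. T \<omega> * indicator (E \<eta>) \<omega> \<partial>law)"
    using J by (intro sum.remove) auto
  also have "\<dots> \<le> D * ennreal (q ^ (card Y * card Z)) + (\<Sum>\<eta>\<in>Pow J - {{}}. (2 * F + 1) * emeasure law (E \<eta>))"
    by (intro add_mono sum_mono none some)
  also have "(\<Sum>\<eta>\<in>Pow J - {{}}. (2 * F + 1) * emeasure law (E \<eta>)) \<le> 2 * F + 1"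
  proof -
    have "(\<Sum>\<eta>\<in>Pow J - {{}}. emeasure law (E \<eta>)) = emeasure law (\<Union>\<eta>\<in>Pow J - {{}}. E \<eta>)"
    proof (rule sum_emeasure)
      show "E ` (Pow J - {{}}) \<subseteq> sets law" using Es by blast
      show "disjoint_family_on E (Pow J - {{}})" unfolding disjoint_family_on_def E_def by blast
      show "finite (Pow J - {{}})" using J by simp
    qed
    also have "\<dots> \<le> 1" by (rule law.emeasure_le_1)
    finally show ?thesis
      unfolding sum_distrib_left[symmetric] using mult_left_mono[of _ 1 "2 * F + 1"] by simp
  qed
  finally show ?thesis unfolding T_def by (simp add: add_ac)
qed

end

lemma power_superadditive:
  fixes u v :: real
  assumes "0 \<le> u" "0 \<le> v" "d > 0"
  shows "u ^ d + v ^ d \<le> (u + v) ^ d"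
proof -
  have "u ^ Suc n + v ^ Suc n \<le> (u + v) ^ Suc n" for n
  proof -
    have "u * u ^ n + v * v ^ n \<le> u * (u + v) ^ n + v * (u + v) ^ n"
      using assms by (intro add_mono mult_left_mono power_mono) auto
    then show ?thesis by (simp add: distrib_right)
  qed
  then show ?thesis using assms(3) by (cases d) auto
qed

text \<open>
  Targets at distances below \<open>R\<close> other than the centre are left out: connection probabilities can vanish
  at such distances, and the bound for the expected distance may fail there.
\<close>

definition annulus :: "int ^ 'n \<Rightarrow> nat \<Rightarrow> nat \<Rightarrow> (int ^ 'n) set" where
  "annulus a R \<rho> = {y. y = a \<or> R \<le> sup_norm (y - a) \<and> sup_norm (y - a) \<le> \<rho>}"

lemma annulus_subset_sup_box: "annulus a R \<rho> \<subseteq> sup_box a \<rho>"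
  unfolding annulus_def sup_box_def by auto

lemma card_annulus:
  fixes a :: "int ^ 'n"
  assumes "R \<ge> 1"
  shows "((real \<rho> + 1) / (2 * real R + 1)) ^ CARD('n) \<le> real (card (annulus a R \<rho>))"
proof (cases "\<rho> \<le> 2 * R")
  case True
  have "((real \<rho> + 1) / (2 * real R + 1)) ^ CARD('n) \<le> 1"
    using True by (intro power_le_one) auto
  moreover have "card {a} \<le> card (annulus a R \<rho>)"
    by (rule card_mono[OF finite_subset[OF annulus_subset_sup_box finite_sup_box]]) (simp add: annulus_def)
  ultimately show ?thesis by simp
next
  case False
  have "((real \<rho> + 1) / (2 * real R + 1)) ^ CARD('n) \<le> (real \<rho> + 1) ^ CARD('n)"
    by (intro power_mono) (auto simp: field_simps)
  also have "\<dots> \<le> (real \<rho> + 1 + real \<rho>) ^ CARD('n) - real \<rho> ^ CARD('n)"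
    using power_superadditive[of "real \<rho> + 1" "real \<rho>" "CARD('n)"] by simp
  also have "\<dots> \<le> real ((2 * \<rho> + 1) ^ CARD('n)) - real ((2 * (R - 1) + 1) ^ CARD('n))"
  proof -
    have "real ((2 * (R - 1) + 1) ^ CARD('n)) \<le> real (\<rho> ^ CARD('n))"
      using False assms by (intro of_nat_mono power_mono) auto
    moreover have "real ((2 * \<rho> + 1) ^ CARD('n)) = (real \<rho> + 1 + real \<rho>) ^ CARD('n)"
      by (simp add: add_ac)
    ultimately show ?thesis by simp
  qed
  also have "\<dots> = real (card (sup_box a \<rho>)) - real (card (sup_box a (R - 1)))"
    by (simp only: card_sup_box)
  also have "\<dots> \<le> real (card (sup_box a \<rho> - sup_box a (R - 1)))"
  proof -
    have "card (sup_box a \<rho>) - card (sup_box a (R - 1)) \<le> card (sup_box a \<rho> - sup_box a (R - 1))"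
      by (rule diff_card_le_card_Diff[OF finite_sup_box])
    then show ?thesis by linarith
  qed
  also have "\<dots> \<le> real (card (annulus a R \<rho>))"
    using assms by (intro of_nat_mono card_mono finite_subset[OF annulus_subset_sup_box finite_sup_box])
      (auto simp: annulus_def sup_box_def)
  finally show ?thesis .
qed

context lattice_percolation
begin

text \<open>
  Induction on the scale \<open>k\<close>. Smaller boxes of radius \<open>\<rho>\<close> around both points are joined by an edge, except
  with probability at most \<open>\<delta> / (d n)\<close>, in which case a nearest-neighbour path of length at most
  \<open>d n\<close> is available; so the failure contributes at most \<open>\<delta>\<close> to the expectation, and \<open>(1 + \<delta>) (2\<^sup>k - 1)\<close> solves
  \<open>F' = 2 F + 1 + \<delta>\<close>. The radius is essentially the previous scale, but at most a quarter of the distance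
  so that the boxes stay disjoint; \<open>near\<close> and \<open>scale\<close> guarantee enough candidate edges in either case.
\<close>

lemma expected_dist_le:
  fixes r :: "nat \<Rightarrow> real"
  assumes nn: "\<And>u v. nearest_neighbor_of_origin (u - v) \<Longrightarrow> p {u, v} = 1"
    and far: "\<And>y z. real R1 \<le> real (sup_norm (y - z)) \<Longrightarrow> 1 - p {y, z} \<le> exp (- (b * real (sup_norm (y - z)) powr - s))"
    and R1: "R1 \<ge> 1" and b: "b > 0" and s: "s > 0" and \<delta>: "\<delta> > 0"
    and \<kappa>_def: "\<kappa> = 2 powr - s / (2 * real (2 * R1) + 1) ^ (2 * CARD('n))"
    and r: "r 0 = 1" "\<And>k. r k \<ge> 1"
    and near: "\<And>x. x \<ge> 1 \<Longrightarrow> ln (real CARD('n) * x / \<delta>) \<le> b * \<kappa> * x powr - s * (x / 4) ^ (2 * CARD('n))"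
    and scale: "\<And>k x. x \<ge> 1 \<Longrightarrow> x < r (Suc k) \<Longrightarrow>
        ln (real CARD('n) * x / \<delta>) \<le> b * \<kappa> * x powr - s * r k ^ (2 * CARD('n))"
    and x: "x = a \<or> 2 * R1 \<le> sup_norm (x - a)" "real (sup_norm (x - a)) < r k"
  shows "expected_dist (sup_box a (2 * sup_norm (x - a))) a x \<le> ennreal ((1 + \<delta>) * (2 ^ k - 1))"
  using x
proof (induction k arbitrary: a x)
  case 0
  then have "sup_norm (x - a) = 0" using r by simp
  then have "x = a" by (simp add: sup_norm_eq_0)
  then show ?case by (simp add: dist_in_self)
next
  case (Suc k)
  show ?case
  proof (cases "x = a")
    case True
    then show ?thesis by (simp add: dist_in_self)
  next
    case False
    define R where "R = 2 * R1"
    define n where "n = sup_norm (x - a)"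
    define d where "d = CARD('n)"
    have n: "R \<le> n" "real n < r (Suc k)" using Suc.prems False by (auto simp: R_def n_def)
    have R: "R \<ge> 2" using R1 by (simp add: R_def)
    then have n2: "n \<ge> 2" using n by simp
    define \<rho> where "\<rho> = min (nat \<lceil>r k\<rceil> - 1) ((n - 1) div 4)"
    have \<rho>n: "4 * \<rho> < n" using n2 by (auto simp: \<rho>_def min_def)
    have ceil: "nat \<lceil>r k\<rceil> \<ge> 1" "real (nat \<lceil>r k\<rceil>) < r k + 1"
      using r(2)[of k] by linarith+
    have \<rho>r: "real \<rho> < r k"
    proof -
      have "\<rho> \<le> nat \<lceil>r k\<rceil> - 1" by (simp add: \<rho>_def)
      then have "real \<rho> \<le> real (nat \<lceil>r k\<rceil>) - 1" using ceil by (simp add: of_nat_diff[symmetric])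
      then show ?thesis using ceil by linarith
    qed
    define W1 where "W1 = sup_box a (2 * \<rho>)"
    define W2 where "W2 = sup_box x (2 * \<rho>)"
    define F where "F = ennreal ((1 + \<delta>) * (2 ^ k - 1))"
    have F: "(\<integral>\<^sup>+\<omega>. dist_in (sup_box u (2 * \<rho>)) \<omega> u y \<partial>law) \<le> F" if "y \<in> annulus u R \<rho>" for u y
    proof -
      have y: "sup_norm (y - u) \<le> \<rho>" using that annulus_subset_sup_box unfolding sup_box_def by fast
      have "(\<integral>\<^sup>+\<omega>. dist_in (sup_box u (2 * \<rho>)) \<omega> u y \<partial>law)
          \<le> (expected_dist (sup_box u (2 * sup_norm (y - u))) u y)"
        using y by (intro nn_integral_mono dist_in_mono sup_box_mono) simp
      also have "\<dots> \<le> F"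
        unfolding F_def using y \<rho>r that by (intro Suc.IH) (auto simp: annulus_def R_def)
      finally show ?thesis .
    qed
    have W: "W1 \<inter> W2 = {}" "W1 \<union> W2 \<subseteq> sup_box a (2 * n)"
    proof -
      have "\<not> (u \<in> W1 \<and> u \<in> W2)" for u
        using sup_norm_triangle_diff[of x a u] sup_norm_commute[of u x] \<rho>n
        by (auto simp: W1_def W2_def sup_box_def n_def)
      then show "W1 \<inter> W2 = {}" by blast
      have "u \<in> sup_box a (2 * n)" if "u \<in> W2" for u
        using that sup_norm_triangle_diff[of u a x] \<rho>n by (auto simp: W2_def sup_box_def n_def)
      moreover have "W1 \<subseteq> sup_box a (2 * n)" unfolding W1_def using \<rho>n by (intro sup_box_mono) simp
      ultimately show "W1 \<union> W2 \<subseteq> sup_box a (2 * n)" by blast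
    qed
    define q where "q = exp (- (b * (2 * real n) powr - s))"
    define Y where "Y = annulus a R \<rho>"
    define Z where "Z = annulus x R \<rho>"
    have YZ: "Y \<subseteq> sup_box a \<rho>" "Z \<subseteq> sup_box x \<rho>" unfolding Y_def Z_def by (rule annulus_subset_sup_box)+
    have pq: "1 - p {y, z} \<le> q" if "y \<in> Y" "z \<in> Z" for y z
    proof -
      have y: "sup_norm (y - a) \<le> \<rho>" "sup_norm (z - x) \<le> \<rho>" using that YZ by (auto simp: sup_box_def)
      have "n \<le> sup_norm (x - z) + sup_norm (z - y) + sup_norm (y - a)"
        unfolding n_def using sup_norm_triangle_diff[of x a z] sup_norm_triangle_diff[of z a y] by linarith
      then have lo: "n \<le> 2 * sup_norm (y - z)"
        using y \<rho>n sup_norm_commute[of x z] sup_norm_commute[of y z] by linarith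
      have "sup_norm (y - z) \<le> sup_norm (y - a) + sup_norm (a - x) + sup_norm (x - z)"
        using sup_norm_triangle_diff[of y z a] sup_norm_triangle_diff[of a z x] by linarith
      then have hi: "sup_norm (y - z) \<le> 2 * n"
        using y \<rho>n sup_norm_commute[of x z] sup_norm_commute[of a x] unfolding n_def by linarith
      have "real R1 \<le> real (sup_norm (y - z))" using lo n by (simp add: R_def)
      then have "1 - p {y, z} \<le> exp (- (b * real (sup_norm (y - z)) powr - s))" by (rule far)
      also have "\<dots> \<le> q"
      proof -
        have "(2 * real n) powr - s \<le> real (sup_norm (y - z)) powr - s"
          using lo hi n2 s by (intro powr_mono2') auto
        then show ?thesis unfolding q_def using b by (simp add: mult_left_mono)
      qed
      finally show ?thesis .
    qed
    have "expected_dist (sup_box a (2 * n)) a x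
        \<le> 2 * F + 1 + of_nat (d * n) * ennreal (q ^ (card Y * card Z))"
    proof (rule expected_dist_renormalise[of Y W1 Z W2])
      show "finite Y" "finite Z" using YZ finite_sup_box finite_subset by metis+
      show "Y \<subseteq> W1" "Z \<subseteq> W2"
        using YZ sup_box_mono[of \<rho> "2 * \<rho>" a] sup_box_mono[of \<rho> "2 * \<rho>" x] unfolding W1_def W2_def by auto
      show "expected_dist W1 a y \<le> F" if "y \<in> Y" for y
        using F that unfolding W1_def Y_def by blast
      show "expected_dist W2 x z \<le> F" if "z \<in> Z" for z
        using F that unfolding W2_def Z_def by blast
      show "AE \<omega> in law. dist_in (sup_box a (2 * n)) \<omega> a x \<le> of_nat (d * n)"
      proof -
        have "AE \<omega> in law. dist_in (sup_box a (sup_norm (x - a))) \<omega> a x \<le> of_nat (CARD('n) * sup_norm (x - a))"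
          by (rule AE_nearest_neighbor_dist) (rule nn)
        then show ?thesis
        proof eventually_elim
          case (elim \<omega>)
          have "dist_in (sup_box a (2 * n)) \<omega> a x \<le> dist_in (sup_box a n) \<omega> a x"
            by (intro dist_in_mono sup_box_mono) simp
          with elim show ?case unfolding n_def d_def by (rule order.trans[rotated])
        qed
      qed
      show "0 \<le> q" by (simp add: q_def)
    qed (use W pq in auto)
    also have "q ^ (card Y * card Z) \<le> \<delta> / (real d * real n)"
    proof -
      have "\<rho> + 1 = nat \<lceil>r k\<rceil> \<or> real \<rho> + 1 \<ge> real n / 4"
      proof -
        have "n \<le> 4 * ((n - 1) div 4) + 4" using n2 by presburger
        then have "real n \<le> 4 * real ((n - 1) div 4) + 4" by linarith
        then show ?thesis using ceil by (auto simp: \<rho>_def min_def)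
      qed
      then have \<rho>_ge: "real \<rho> + 1 \<ge> r k \<or> real \<rho> + 1 \<ge> real n / 4"
        by (metis of_nat_1 of_nat_add real_nat_ceiling_ge)
      define N where "N = (real \<rho> + 1) / (2 * real R + 1)"
      have N: "N ^ d \<le> real (card Y)" "N ^ d \<le> real (card Z)"
        unfolding N_def d_def Y_def Z_def using R by (auto intro!: card_annulus)
      have "N ^ d * N ^ d \<le> real (card Y) * real (card Z)"
        using N by (intro mult_mono) (auto simp: N_def)
      then have card: "N ^ (2 * d) \<le> real (card Y * card Z)" by (simp add: power_add mult_2)
      have "ln (real d * real n / \<delta>) \<le> b * \<kappa> * real n powr - s * (real \<rho> + 1) ^ (2 * d)"
        using \<rho>_ge
      proof
        assume *: "real \<rho> + 1 \<ge> r k"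
        have "ln (real d * real n / \<delta>) \<le> b * \<kappa> * real n powr - s * r k ^ (2 * d)"
          unfolding d_def using n n2 by (intro scale) auto
        also have "\<dots> \<le> b * \<kappa> * real n powr - s * (real \<rho> + 1) ^ (2 * d)"
          using * r(2)[of k] b by (intro mult_left_mono power_mono) (auto simp: \<kappa>_def)
        finally show ?thesis .
      next
        assume *: "real \<rho> + 1 \<ge> real n / 4"
        have "ln (real d * real n / \<delta>) \<le> b * \<kappa> * real n powr - s * (real n / 4) ^ (2 * d)"
          unfolding d_def using n2 by (intro near) auto
        also have "\<dots> \<le> b * \<kappa> * real n powr - s * (real \<rho> + 1) ^ (2 * d)"
          using * b by (intro mult_left_mono power_mono) (auto simp: \<kappa>_def)
        finally show ?thesis .
      qed
      also have "\<dots> = b * (2 * real n) powr - s * N ^ (2 * d)"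
        unfolding N_def \<kappa>_def d_def[symmetric] R_def using n2
        by (simp add: powr_mult power_divide)
      also have "\<dots> \<le> b * (2 * real n) powr - s * real (card Y * card Z)"
        using b by (intro mult_left_mono card) auto
      finally have "exp (- (real (card Y * card Z) * (b * (2 * real n) powr - s))) \<le> exp (- ln (real d * real n / \<delta>))"
        by (simp add: mult_ac)
      also have "exp (- ln (real d * real n / \<delta>)) = \<delta> / (real d * real n)"
        using n2 \<delta> by (simp add: exp_minus d_def)
      also have "exp (- (real (card Y * card Z) * (b * (2 * real n) powr - s))) = q ^ (card Y * card Z)"
        unfolding q_def by (simp only: exp_of_nat_mult[symmetric] mult_minus_right)
      finally show ?thesis .
    qed
    then have "of_nat (d * n) * ennreal (q ^ (card Y * card Z)) \<le> of_nat (d * n) * ennreal (\<delta> / (real d * real n))"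
      by (intro mult_left_mono ennreal_leI) auto
    also have "of_nat (d * n) * ennreal (\<delta> / (real d * real n)) = ennreal \<delta>"
      using n2 \<delta> by (simp add: ennreal_of_nat_eq_real_of_nat ennreal_mult[symmetric] d_def)
    finally have "expected_dist (sup_box a (2 * n)) a x \<le> 2 * F + 1 + ennreal \<delta>"
      by (simp add: add_left_mono)
    also have "2 * F + 1 + ennreal \<delta> = ennreal (2 * ((1 + \<delta>) * (2 ^ k - 1)) + 1 + \<delta>)"
    proof -
      have "2 * ennreal f + 1 + ennreal \<delta> = ennreal (2 * f + 1 + \<delta>)" if "0 \<le> f" for f
        using that \<delta> by (simp add: ennreal_mult)
      then show ?thesis unfolding F_def using \<delta> by simp
    qed
    also have "2 * ((1 + \<delta>) * (2 ^ k - 1)) + 1 + \<delta> = (1 + \<delta>) * (2 ^ Suc k - 1)"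
      by (simp add: algebra_simps)
    finally show ?thesis unfolding n_def .
  qed
qed

end

section \<open>Norms, connection probabilities and chemical distance\<close>

lemma is_norm_comparison:
  fixes N :: "real ^ 'n \<Rightarrow> real"
  assumes "is_norm N"
  shows "\<exists>c C. 0 < c \<and> 0 < C \<and> (\<forall>x. c * real (sup_norm x) \<le> N (lattice_vec x) \<and> N (lattice_vec x) \<le> C * real (sup_norm x))"
proof -
  have N: "0 \<le> N v" "N v = 0 \<longleftrightarrow> v = 0" "N (a *\<^sub>R v) = \<bar>a\<bar> * N v" "N (v + w) \<le> N v + N w" for a v w
    using assms by (auto simp: is_norm_def)
  have sum_le: "N (\<Sum>i\<in>A. f i) \<le> (\<Sum>i\<in>A. N (f i))" if "finite A" for A and f :: "'n \<Rightarrow> real ^ 'n"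
    using that
  proof (induction A rule: finite_induct)
    case (insert i A)
    then show ?case using N(4)[of "f i" "\<Sum>i\<in>A. f i"] by simp
  next
    case empty
    have "N 0 = 0" using N(2) by blast
    then show ?case by simp
  qed
  define K where "K = (\<Sum>i\<in>UNIV. N (axis i 1)) + 1"
  have K: "K > 0" unfolding K_def using N(1) by (intro add_nonneg_pos sum_nonneg) auto
  have upper: "N v \<le> K * M" if "\<And>i. \<bar>v $ i\<bar> \<le> M" for v M
  proof -
    have M: "0 \<le> M" using that[of undefined] by linarith
    have "v = (\<Sum>i\<in>UNIV. v $ i *\<^sub>R axis i 1)"
      using basis_expansion[of v] by (simp add: scalar_mult_eq_scaleR)
    then have "N v \<le> (\<Sum>i\<in>UNIV. N (v $ i *\<^sub>R axis i 1))" using sum_le[of UNIV] by (metis finite)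
    also have "\<dots> \<le> (\<Sum>i\<in>UNIV. M * N (axis i 1))"
      unfolding N(3) using that N(1) by (intro sum_mono mult_right_mono)
    also have "\<dots> \<le> K * M"
      unfolding sum_distrib_left[symmetric] K_def using M by (simp add: algebra_simps)
    finally show ?thesis .
  qed
  have "continuous_on UNIV N"
  proof (rule continuous_onI)
    fix x :: "real ^ 'n" and e :: real assume e: "e > 0"
    have minus: "N (w - v) = N (v - w)" for v w using N(3)[of "-1" "v - w"] by simp
    have "dist (N y) (N x) \<le> e" if "dist y x < e / K" for y
    proof -
      have "N y \<le> N x + N (y - x)" "N x \<le> N y + N (x - y)"
        using N(4)[of x "y - x"] N(4)[of y "x - y"] by simp_all
      then have "\<bar>N y - N x\<bar> \<le> N (y - x)" using minus[of x y] by linarith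
      also have "\<dots> \<le> K * norm (y - x)" by (intro upper component_le_norm_cart)
      also have "\<dots> \<le> e" using that K by (simp add: dist_norm field_simps)
      finally show ?thesis by (simp add: dist_real_def)
    qed
    then show "\<exists>d>0. \<forall>y\<in>UNIV. dist y x < d \<longrightarrow> dist (N y) (N x) \<le> e"
      using e K by (intro exI[of _ "e / K"]) auto
  qed
  then have "continuous_on (sphere 0 1) N" by (rule continuous_on_subset) simp
  moreover have "sphere (0 :: real ^ 'n) 1 \<noteq> {}" by simp
  ultimately obtain v0 where v0: "v0 \<in> sphere 0 1" "\<And>v. v \<in> sphere 0 1 \<Longrightarrow> N v0 \<le> N v"
    using continuous_attains_inf[of "sphere 0 1" N] by auto
  define c where "c = N v0"
  have c: "c > 0" using v0(1) N(1)[of v0] N(2)[of v0] unfolding c_def by (auto simp: less_le)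
  have lower: "c * norm v \<le> N v" for v
  proof (cases "v = 0")
    case False
    have "c \<le> N ((1 / norm v) *\<^sub>R v)" unfolding c_def using False by (intro v0(2)) simp
    also have "\<dots> = N v / norm v" using False by (simp add: N(3))
    finally show ?thesis using False by (simp add: field_simps)
  qed (simp add: N(1))
  have "c * real (sup_norm x) \<le> N (lattice_vec x) \<and> N (lattice_vec x) \<le> K * real (sup_norm x)" for x :: "int ^ 'n"
  proof
    have "\<bar>lattice_vec x $ i\<bar> = of_int \<bar>x $ i\<bar>" for i by (simp add: lattice_vec_def)
    moreover have "of_int \<bar>x $ i\<bar> \<le> real (sup_norm x)" for i
      using coord_le_sup_norm[of x i] by (metis of_int_le_iff of_int_of_nat_eq)
    ultimately show "N (lattice_vec x) \<le> K * real (sup_norm x)" by (intro upper) auto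
    have "sup_norm x \<in> range (\<lambda>i. nat \<bar>x $ i\<bar>)" unfolding sup_norm_def by (rule Max_in) auto
    then obtain i where "sup_norm x = nat \<bar>x $ i\<bar>" by blast
    then have "real (sup_norm x) = \<bar>lattice_vec x $ i\<bar>" by (simp add: lattice_vec_def)
    also have "\<dots> \<le> norm (lattice_vec x)" by (rule component_le_norm_cart)
    finally have "c * real (sup_norm x) \<le> c * norm (lattice_vec x)" using c by (intro mult_left_mono) auto
    also have "\<dots> \<le> N (lattice_vec x)" by (rule lower)
    finally show "c * real (sup_norm x) \<le> N (lattice_vec x)" .
  qed
  then show ?thesis using c K by blast
qed

lemma lattice_ball_growth:
  fixes N :: "real ^ 'n \<Rightarrow> real"
  assumes "is_norm N"
  obtains b B where "0 < b" "0 < B" "\<And>r. r \<ge> 1 \<Longrightarrow> finite (lattice_ball N 0 r)"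
    "\<And>r. r \<ge> 1 \<Longrightarrow> b * r ^ CARD('n) \<le> real (card (lattice_ball N 0 r))"
    "\<And>r. r \<ge> 1 \<Longrightarrow> real (card (lattice_ball N 0 r)) \<le> B * r ^ CARD('n)"
    "\<And>r x. r \<ge> 1 \<Longrightarrow> x \<in> lattice_ball N 0 r \<Longrightarrow> real (sup_norm x) \<le> B * r"
proof -
  obtain c C where c: "0 < c" "0 < C"
    and N: "\<And>x. c * real (sup_norm x) \<le> N (lattice_vec x)" "\<And>x. N (lattice_vec x) \<le> C * real (sup_norm x)"
    using is_norm_comparison[OF assms] by blast
  define b where "b = (1 / C) ^ CARD('n)"
  define B where "B = max (1 / c) ((2 / c + 1) ^ CARD('n))"
  have growth: "finite (lattice_ball N 0 r)
     \<and> b * r ^ CARD('n) \<le> real (card (lattice_ball N 0 r)) \<and> real (card (lattice_ball N 0 r)) \<le> B * r ^ CARD('n)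
     \<and> (\<forall>x\<in>lattice_ball N 0 r. real (sup_norm x) \<le> B * r)" if r: "r \<ge> 1" for r
  proof -
    have minus: "sup_norm (- x) = sup_norm x" for x :: "int ^ 'n"
      using sup_norm_commute[of 0 x] by simp
    have le: "real (sup_norm x) \<le> r / c" if "x \<in> lattice_ball N 0 r" for x
      using that N(1)[of "- x"] c by (simp add: lattice_ball_def minus field_simps)
    have sub: "lattice_ball N 0 r \<subseteq> sup_box 0 (nat \<lfloor>r / c\<rfloor>)"
      using le by (auto simp: sup_box_def intro!: le_nat_floor)
    then have fin: "finite (lattice_ball N 0 r)" by (rule finite_subset[OF _ finite_sup_box])
    have "real (card (lattice_ball N 0 r)) \<le> real (card (sup_box (0 :: int ^ 'n) (nat \<lfloor>r / c\<rfloor>)))"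
      by (intro of_nat_mono card_mono sub finite_sup_box)
    also have "\<dots> = (2 * real (nat \<lfloor>r / c\<rfloor>) + 1) ^ CARD('n)" by (simp add: card_sup_box add.commute)
    also have "\<dots> \<le> ((2 / c + 1) * r) ^ CARD('n)"
    proof (intro power_mono)
      have "0 \<le> r / c" using r c by simp
      then have "real (nat \<lfloor>r / c\<rfloor>) \<le> r / c" by linarith
      then show "2 * real (nat \<lfloor>r / c\<rfloor>) + 1 \<le> (2 / c + 1) * r" using r by (simp add: distrib_right)
    qed auto
    also have "\<dots> = (2 / c + 1) ^ CARD('n) * r ^ CARD('n)" by (rule power_mult_distrib)
    also have "\<dots> \<le> B * r ^ CARD('n)" unfolding B_def using r by (intro mult_right_mono) auto
    finally have up: "real (card (lattice_ball N 0 r)) \<le> B * r ^ CARD('n)" .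
    define n where "n = nat \<lceil>r / C\<rceil> - 1"
    have "0 < r / C" using r c by simp
    then have n: "real n < r / C" "r / C \<le> real n + 1" unfolding n_def by linarith+
    have sup: "sup_box 0 n \<subseteq> lattice_ball N 0 r"
    proof
      fix x :: "int ^ 'n" assume "x \<in> sup_box 0 n"
      then have "real (sup_norm (- x)) \<le> real n" by (simp add: sup_box_def minus)
      then have "C * real (sup_norm (- x)) \<le> C * real n" using c by (intro mult_left_mono) auto
      also have "\<dots> < r" using n c by (simp add: field_simps)
      finally show "x \<in> lattice_ball N 0 r" using N(2)[of "- x"] by (simp add: lattice_ball_def)
    qed
    have "b * r ^ CARD('n) = (r / C) ^ CARD('n)" by (simp add: b_def power_divide)
    also have "\<dots> \<le> (2 * real n + 1) ^ CARD('n)" using n \<open>0 < r / C\<close> by (intro power_mono) auto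
    also have "\<dots> = real (card (sup_box (0 :: int ^ 'n) n))" by (simp add: card_sup_box add.commute)
    also have "\<dots> \<le> real (card (lattice_ball N 0 r))" by (intro of_nat_mono card_mono sup fin)
    finally have low: "b * r ^ CARD('n) \<le> real (card (lattice_ball N 0 r))" .
    have "real (sup_norm x) \<le> B * r" if "x \<in> lattice_ball N 0 r" for x
    proof -
      have "r / c = 1 / c * r" by simp
      also have "\<dots> \<le> B * r" unfolding B_def using r by (intro mult_right_mono) auto
      finally show ?thesis using le[OF that] by linarith
    qed
    then show ?thesis using fin low up by blast
  qed
  have "0 < b" "0 < B" using c by (auto simp: b_def B_def less_max_iff_disj)
  then show thesis by (rule that) (use growth in simp_all)
qed

lemma connection_prob_sym:
  assumes "\<And>x. q x = q (- x)" shows "connection_prob q \<beta> x y = connection_prob q \<beta> y x"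
  using assms[of "x - y"] by (simp add: connection_prob_def)

lemma edge_prob_eq:
  assumes "\<And>x. q x = q (- x)" shows "edge_prob q \<beta> {x, y} = connection_prob q \<beta> x y"
  unfolding edge_prob_def
proof (rule the_equality)
  fix t assume "\<exists>u v. {x, y} = {u, v} \<and> t = connection_prob q \<beta> u v"
  then obtain u v where uv: "{x, y} = {u, v}" "t = connection_prob q \<beta> u v" by blast
  then have "x = u \<and> y = v \<or> x = v \<and> y = u" by (auto simp: doubleton_eq_iff)
  then show "t = connection_prob q \<beta> x y" using uv(2) connection_prob_sym[of q, OF assms, of \<beta> u v] by auto
qed blast

lemma connection_prob_range:
  assumes "\<beta> \<ge> 0" shows "0 \<le> connection_prob q \<beta> x y" "connection_prob q \<beta> x y \<le> 1"
  using assms by (auto simp: connection_prob_def)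

definition edge_law :: "(int ^ 'n \<Rightarrow> ennreal) \<Rightarrow> real \<Rightarrow> (int ^ 'n) set \<Rightarrow> bool pmf" where
  "edge_law q \<beta> e = bernoulli_pmf (edge_prob q \<beta> e)"

lemma percolation_law_eq: "percolation_law q \<beta> = bernoulli_field.law lattice_edges (edge_law q \<beta>)"
  unfolding percolation_law_def bernoulli_field.law_def edge_law_def ..

lemma edge_law_True:
  assumes "\<And>x. q x = q (- x)" "\<beta> \<ge> 0"
  shows "pmf (edge_law q \<beta> {x, y}) True = connection_prob q \<beta> x y"
  using connection_prob_range[OF assms(2), of q x y] by (simp add: edge_law_def edge_prob_eq[of q, OF assms(1)])

text \<open>
  The constant \<open>c\<close> shifts the logarithmic scales by a bounded amount, which \<open>ln \<beta>\<close> dominates.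
\<close>

lemma kernel_bounds:
  fixes N :: "real ^ 'n \<Rightarrow> real"
  assumes N: "is_norm N" and s: "s > 0" and q: "admissible_kernel N s q"
  shows "\<exists>c R. 0 < c \<and> R \<ge> (1::nat) \<and> (\<forall>x. real R \<le> real (sup_norm x) \<longrightarrow>
     q x \<noteq> \<infinity> \<and> c * real (sup_norm x) powr - s \<le> enn2real (q x) \<and> enn2real (q x) \<le> real (sup_norm x) powr - s / c)"
proof -
  obtain c C where c: "0 < c" "0 < C"
    and Nc: "\<And>x. c * real (sup_norm x) \<le> N (lattice_vec x)" "\<And>x. N (lattice_vec x) \<le> C * real (sup_norm x)"
    using is_norm_comparison[OF N] by blast
  have lim: "((\<lambda>x. q x * ennreal (N (lattice_vec x) powr s)) \<longlongrightarrow> 1) (filtercomap (\<lambda>x. N (lattice_vec x)) at_top)"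
    using q by (simp add: admissible_kernel_def)
  have "eventually (\<lambda>x. q x * ennreal (N (lattice_vec x) powr s) \<in> {ennreal (1/2)<..<2})
      (filtercomap (\<lambda>x. N (lattice_vec x)) at_top)"
  proof (rule topological_tendstoD[OF lim])
    have "ennreal (1/2) < ennreal 1" by (subst ennreal_less_iff) auto
    then show "1 \<in> {ennreal (1/2)<..<2}" by simp
  qed simp
  then obtain R0 where R0: "\<And>x. N (lattice_vec x) \<ge> R0 \<Longrightarrow> q x * ennreal (N (lattice_vec x) powr s) \<in> {ennreal (1/2)<..<2}"
    unfolding eventually_filtercomap_at_top_linorder by blast
  define R where "R = nat \<lceil>\<bar>R0\<bar> / c\<rceil> + 1"
  define c1 where "c1 = min (C powr - s / 2) (c powr s / 2)"
  have c1: "c1 > 0" using c by (simp add: c1_def)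
  have "q x \<noteq> \<infinity> \<and> c1 * real (sup_norm x) powr - s \<le> enn2real (q x) \<and> enn2real (q x) \<le> real (sup_norm x) powr - s / c1"
    if x: "real R \<le> real (sup_norm x)" for x
  proof -
    define n where "n = real (sup_norm x)"
    define v where "v = N (lattice_vec x)"
    have n: "n \<ge> 1" "n \<ge> \<bar>R0\<bar> / c" using x unfolding n_def R_def by linarith+
    have "\<bar>R0\<bar> \<le> c * n" using n c by (simp add: field_simps)
    then have vR: "v \<ge> R0" using Nc(1)[of x] unfolding v_def n_def by linarith
    have "0 < c * n" using c n by simp
    then have v0: "v > 0" "c * n \<le> v" "v \<le> C * n" using Nc[of x] unfolding v_def n_def by linarith+
    have bd: "ennreal (1/2) < q x * ennreal (v powr s)" "q x * ennreal (v powr s) < 2"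
      using R0[OF vR[unfolded v_def]] by (simp_all add: v_def)
    have fin: "q x \<noteq> \<infinity>"
    proof
      assume "q x = \<infinity>"
      then have "q x * ennreal (v powr s) = \<top>" using v0 by (simp add: ennreal_top_mult)
      then show False using bd(2) by simp
    qed
    define w where "w = enn2real (q x)"
    have qw: "q x = ennreal w" "w \<ge> 0" unfolding w_def using fin by (auto simp: ennreal_enn2real less_top)
    have ev: "q x * ennreal (v powr s) = ennreal (w * v powr s)"
      using qw by (simp add: ennreal_mult)
    have "1/2 < w * v powr s"
      using bd(1) unfolding ev by (subst (asm) ennreal_less_iff) auto
    moreover have "ennreal (w * v powr s) < ennreal 2" using bd(2) unfolding ev by simp
    then have "w * v powr s < 2" using qw by (subst (asm) ennreal_less_iff) auto
    ultimately have w: "1/2 < w * v powr s" "w * v powr s < 2" by blast+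
    have vs: "v powr s > 0" using v0 by simp
    have "c1 * n powr - s \<le> C powr - s / 2 * n powr - s" unfolding c1_def by (intro mult_right_mono) auto
    also have "\<dots> = (C * n) powr - s / 2" using c n by (simp add: powr_mult)
    also have "\<dots> \<le> v powr - s / 2" using v0 s by (intro divide_right_mono powr_mono2') auto
    also have "\<dots> \<le> w" using w(1) vs by (simp add: powr_minus field_simps)
    finally have lo: "c1 * n powr - s \<le> w" .
    have "w \<le> 2 * v powr - s" using w(2) vs by (simp add: powr_minus field_simps)
    also have "\<dots> \<le> 2 * (c * n) powr - s" using v0 c n s by (intro mult_left_mono powr_mono2') auto
    also have "\<dots> = n powr - s / (c powr s / 2)" using c n by (simp add: powr_mult powr_minus field_simps)
    also have "\<dots> \<le> n powr - s / c1" using c c1 unfolding c1_def by (intro divide_left_mono) auto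
    finally show ?thesis using fin lo unfolding n_def w_def by blast
  qed
  moreover have "R \<ge> 1" by (simp add: R_def)
  ultimately show ?thesis using c1 by blast
qed

lemma edge_law_bounds:
  fixes N :: "real ^ 'n \<Rightarrow> real"
  assumes N: "is_norm N" and s: "s > 0" and q: "admissible_kernel N s q"
  shows "\<exists>c R \<kappa>. 0 < c \<and> R \<ge> (1::nat) \<and> \<kappa> \<ge> 1 \<and>
    (\<forall>\<beta>\<ge>1. (\<forall>u v. nearest_neighbor_of_origin (u - v) \<longrightarrow> pmf (edge_law q \<beta> {u, v}) True = 1)
      \<and> (\<forall>y z. real R \<le> real (sup_norm (y - z)) \<longrightarrow>
            1 - pmf (edge_law q \<beta> {y, z}) True \<le> exp (- (\<beta> * c * real (sup_norm (y - z)) powr - s)))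
      \<and> (\<forall>y z. y \<noteq> z \<longrightarrow> pmf (edge_law q \<beta> {y, z}) True \<le> \<kappa> * \<beta> * real (sup_norm (y - z)) powr - s))"
proof -
  obtain c R where c: "0 < c" and R: "R \<ge> (1::nat)" and b: "\<And>x. real R \<le> real (sup_norm x) \<Longrightarrow>
     q x \<noteq> \<infinity> \<and> c * real (sup_norm x) powr - s \<le> enn2real (q x) \<and> enn2real (q x) \<le> real (sup_norm x) powr - s / c"
    using kernel_bounds[OF assms] by blast
  define \<kappa> where "\<kappa> = max (max 1 (1 / c)) (real R powr s)"
  have sym: "q x = q (- x)" and inf: "nearest_neighbor_of_origin x \<Longrightarrow> q x = \<infinity>" for x
    using q unfolding admissible_kernel_def by blast+
  have law_eq: "pmf (edge_law q \<beta> {x, y}) True = connection_prob q \<beta> x y" if "\<beta> \<ge> 1" for \<beta> x y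
    by (rule edge_law_True[of q, OF sym]) (use that in linarith)
  have "pmf (edge_law q \<beta> {u, v}) True = 1" if "\<beta> \<ge> 1" "nearest_neighbor_of_origin (u - v)" for \<beta> u v
    using inf[OF that(2)] unfolding law_eq[OF that(1)] by (simp add: connection_prob_def)
  moreover have "1 - pmf (edge_law q \<beta> {y, z}) True \<le> exp (- (\<beta> * c * real (sup_norm (y - z)) powr - s))"
    if "\<beta> \<ge> 1" "real R \<le> real (sup_norm (y - z))" for \<beta> y z
  proof -
    have "\<beta> * (c * real (sup_norm (y - z)) powr - s) \<le> \<beta> * enn2real (q (y - z))"
      using that b[OF that(2)] by (intro mult_left_mono) auto
    then show ?thesis
      using b[OF that(2)] unfolding law_eq[OF that(1)] by (simp add: connection_prob_def mult.assoc)
  qed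
  moreover have "pmf (edge_law q \<beta> {y, z}) True \<le> \<kappa> * \<beta> * real (sup_norm (y - z)) powr - s"
    if "\<beta> \<ge> 1" "y \<noteq> z" for \<beta> y z
  proof (cases "real R \<le> real (sup_norm (y - z))")
    case True
    have "connection_prob q \<beta> y z = 1 - exp (- (\<beta> * enn2real (q (y - z))))"
      using b[OF True] by (simp add: connection_prob_def)
    also have "\<dots> \<le> \<beta> * enn2real (q (y - z))"
      using exp_ge_add_one_self[of "- (\<beta> * enn2real (q (y - z)))"] by linarith
    also have "\<dots> \<le> \<beta> * (real (sup_norm (y - z)) powr - s / c)"
      using b[OF True] that by (intro mult_left_mono) auto
    also have "\<dots> = 1 / c * \<beta> * real (sup_norm (y - z)) powr - s" by simp
    also have "\<dots> \<le> \<kappa> * \<beta> * real (sup_norm (y - z)) powr - s"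
      using that by (intro mult_right_mono) (auto simp: \<kappa>_def)
    finally show ?thesis unfolding law_eq[OF that(1)] .
  next
    case False
    define n where "n = real (sup_norm (y - z))"
    have n: "n \<ge> 1" "n \<le> real R" using False that sup_norm_eq_0[of "y - z"] by (auto simp: n_def Suc_le_eq)
    have "1 = real R powr s * real R powr - s" using R by (simp add: powr_minus)
    also have "\<dots> \<le> real R powr s * n powr - s" using n s R by (intro mult_left_mono powr_mono2') auto
    also have "\<dots> \<le> \<kappa> * \<beta> * n powr - s"
    proof (intro mult_right_mono)
      have "real R powr s * 1 \<le> \<kappa> * \<beta>" using that by (intro mult_mono) (auto simp: \<kappa>_def)
      then show "real R powr s \<le> \<kappa> * \<beta>" by simp
    qed auto
    finally have "1 \<le> \<kappa> * \<beta> * n powr - s" .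
    then show ?thesis unfolding n_def by (rule order.trans[OF pmf_le_1])
  qed
  moreover have "\<kappa> \<ge> 1" by (simp add: \<kappa>_def)
  ultimately show ?thesis
    by (intro exI[of _ c] exI[of _ R] exI[of _ \<kappa>] conjI allI impI c R)
qed

context lattice_percolation
begin

lemma chemical_dist_le_iff:
  "chemical_dist \<omega> a x \<le> enat n \<longleftrightarrow> (\<exists>vs. connecting_path \<omega> a x vs \<and> length vs \<le> Suc n)"
proof
  assume *: "chemical_dist \<omega> a x \<le> enat n"
  let ?A = "(\<lambda>vs. enat (length vs - 1)) ` {vs. connecting_path \<omega> a x vs}"
  have "?A \<noteq> {}"
  proof
    assume "?A = {}"
    then have "chemical_dist \<omega> a x = \<infinity>" unfolding chemical_dist_def \<open>?A = {}\<close> by (simp add: top_enat_def)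
    with * show False by simp
  qed
  then have "Inf ?A \<in> ?A" by (auto intro: wellorder_InfI)
  then obtain vs where "connecting_path \<omega> a x vs" "chemical_dist \<omega> a x = enat (length vs - 1)"
    unfolding chemical_dist_def by auto
  then show "\<exists>vs. connecting_path \<omega> a x vs \<and> length vs \<le> Suc n" using * by (intro exI[of _ vs]) auto
next
  assume "\<exists>vs. connecting_path \<omega> a x vs \<and> length vs \<le> Suc n"
  then obtain vs where vs: "connecting_path \<omega> a x vs" "length vs \<le> Suc n" by blast
  have "chemical_dist \<omega> a x \<le> enat (length vs - 1)"
    unfolding chemical_dist_def using vs(1) by (intro INF_lower) simp
  also have "\<dots> \<le> enat n" using vs(2) by simp
  finally show "chemical_dist \<omega> a x \<le> enat n" .
qed

lemma reach_eq_chemical_dist: "reach n a x = {\<omega> \<in> space law. chemical_dist \<omega> a x \<le> enat n}"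
  unfolding reach_def chemical_dist_le_iff ..

lemma chemical_dist_measurable [measurable]:
  "(\<lambda>\<omega>. chemical_dist \<omega> a x) \<in> measurable law (count_space UNIV)"
proof (subst measurable_count_space_eq_countable)
  show "countable (UNIV :: enat set)" by (rule countableI_type)
  have "(\<lambda>\<omega>. chemical_dist \<omega> a x) -` {D} \<inter> space law \<in> sets law" for D
  proof (cases D)
    case (enat n)
    have "(\<lambda>\<omega>. chemical_dist \<omega> a x) -` {D} \<inter> space law = reach n a x - (\<Union>m\<in>{..<n}. reach m a x)"
      unfolding reach_eq_chemical_dist enat
    proof (intro set_eqI iffI)
      fix \<omega> assume "\<omega> \<in> {\<omega> \<in> space law. chemical_dist \<omega> a x \<le> enat n} - (\<Union>m\<in>{..<n}. {\<omega> \<in> space law. chemical_dist \<omega> a x \<le> enat m})"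
      then have *: "\<omega> \<in> space law" "chemical_dist \<omega> a x \<le> enat n" "\<And>m. m < n \<Longrightarrow> \<not> chemical_dist \<omega> a x \<le> enat m" by auto
      from *(2) obtain j where "chemical_dist \<omega> a x = enat j" "j \<le> n" by (cases "chemical_dist \<omega> a x") auto
      then have "chemical_dist \<omega> a x = enat n" using *(3)[of j] by (cases "j = n") auto
      with * show "\<omega> \<in> (\<lambda>\<omega>. chemical_dist \<omega> a x) -` {enat n} \<inter> space law" by simp
    qed auto
    also have "\<dots> \<in> sets law" by (intro sets.Diff sets.finite_UN reach_sets finite_lessThan)
    finally show ?thesis .
  next
    case infinity
    have "(\<lambda>\<omega>. chemical_dist \<omega> a x) -` {D} \<inter> space law = space law - (\<Union>m. reach m a x)"
      unfolding reach_eq_chemical_dist infinity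
    proof (intro set_eqI iffI)
      fix \<omega> assume *: "\<omega> \<in> space law - (\<Union>m. {\<omega> \<in> space law. chemical_dist \<omega> a x \<le> enat m})"
      then have "chemical_dist \<omega> a x = \<infinity>" by (cases "chemical_dist \<omega> a x") auto
      with * show "\<omega> \<in> (\<lambda>\<omega>. chemical_dist \<omega> a x) -` {\<infinity>} \<inter> space law" by simp
    qed auto
    also have "\<dots> \<in> sets law" by (intro sets.Diff sets.top sets.countable_UN''[OF countableI_type] reach_sets)
    finally show ?thesis .
  qed
  then show "(\<lambda>\<omega>. chemical_dist \<omega> a x) \<in> space law \<rightarrow> UNIV \<and>
      (\<forall>D\<in>UNIV. (\<lambda>\<omega>. chemical_dist \<omega> a x) -` {D} \<inter> space law \<in> sets law)" by simp
qed

end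

section \<open>From typical distances to the limiting profile\<close>

text \<open>
  An infinite distance always deviates, so a non-deviating vertex has a finite distance.
\<close>

lemma not_deviating_iff:
  assumes "M > 0"
  shows "\<not> \<bar>ereal_of_enat D / ereal M - 1\<bar> > ereal \<epsilon> \<longleftrightarrow> (\<exists>n. D = enat n \<and> \<bar>real n / M - 1\<bar> \<le> \<epsilon>)"
proof (cases D)
  case (enat n)
  have "\<bar>ereal_of_enat D / ereal M - 1\<bar> = ereal \<bar>real n / M - 1\<bar>"
    using assms by (simp add: enat one_ereal_def)
  then show ?thesis using enat by (auto simp: not_less)
next
  case infinity
  then show ?thesis using assms by simp
qed

definition deviates :: "real \<Rightarrow> (real \<Rightarrow> real) \<Rightarrow> real \<Rightarrow> real \<Rightarrow> int ^ 'n \<Rightarrow> ((int ^ 'n) set \<Rightarrow> bool) \<Rightarrow> bool" where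
  "deviates \<Delta> f \<epsilon> r x \<omega> \<longleftrightarrow> \<bar>ereal_of_enat (chemical_dist \<omega> 0 x) / ereal (f r * ln r powr \<Delta>) - 1\<bar> > ereal \<epsilon>"

context lattice_percolation
begin

lemma deviates_sets: "{\<omega> \<in> space law. deviates \<Delta> f \<epsilon> r x \<omega>} \<in> sets law"
proof -
  have "Measurable.pred law (\<lambda>\<omega>. deviates \<Delta> f \<epsilon> r x \<omega>)"
    unfolding deviates_def by (rule measurable_compose[OF chemical_dist_measurable]) simp
  then show ?thesis by simp
qed

text \<open>
  The deviating fraction is bounded, so convergence to zero in probability implies convergence of
  its mean. This turns bounds on the probability of deviation of single vertices into a contradiction.
\<close>

lemma deviating_fraction_not_tends_to_zero:
  fixes \<rho> :: "nat \<Rightarrow> real" and N :: "real ^ 'n \<Rightarrow> real"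
  assumes ball: "\<And>r. r \<ge> 1 \<Longrightarrow> finite (lattice_ball N 0 r)"
      "\<And>r. r \<ge> 1 \<Longrightarrow> real (card (lattice_ball N 0 r)) \<le> A * r ^ CARD('n)" "A > 0"
    and lim: "filterlim \<rho> at_top sequentially"
    and c: "c > 0"
    and ev: "eventually (\<lambda>k. c * \<rho> k ^ CARD('n)
      \<le> (\<Sum>x\<in>lattice_ball N 0 (\<rho> k). law.prob {\<omega> \<in> space law. deviates \<Delta> f \<epsilon> (\<rho> k) x \<omega>})) sequentially"
  shows "\<not> tends_to_zero_in_prob law (deviating_fraction N \<Delta> f \<epsilon>)"
proof
  assume tz: "tends_to_zero_in_prob law (deviating_fraction N \<Delta> f \<epsilon>)"
  define X where "X = deviating_fraction N \<Delta> f \<epsilon>"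
  define P where "P r = law.prob {\<omega> \<in> space law. \<bar>X r \<omega>\<bar> > c / 2}" for r
  have "(P \<longlongrightarrow> 0) at_top"
    using tz[unfolded tends_to_zero_in_prob_def, rule_format, of "c / 2"] c
    unfolding P_def[abs_def] X_def by simp
  then have P0: "(\<lambda>k. P (\<rho> k)) \<longlonglongrightarrow> 0" using lim by (rule filterlim_compose)
  have "eventually (\<lambda>k. P (\<rho> k) \<ge> c / (2 * A)) sequentially"
    using ev filterlim_at_top[THEN iffD1, OF lim, rule_format, of 1]
  proof eventually_elim
    case (elim k)
    define r where "r = \<rho> k"
    define S where "S = lattice_ball N (0 :: int ^ 'n) r"
    define E where "E x = {\<omega> \<in> space law. deviates \<Delta> f \<epsilon> r x \<omega>}" for x
    have r: "r \<ge> 1" and rd: "r ^ CARD('n) > 0" using elim by (auto simp: r_def)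
    have S: "finite S" "real (card S) \<le> A * r ^ CARD('n)" using ball(1,2)[OF r] by (auto simp: S_def)
    have Es: "E x \<in> sets law" for x unfolding E_def by (rule deviates_sets)
    have X_eq: "X r \<omega> = (\<Sum>x\<in>S. indicator (E x) \<omega>) / r ^ CARD('n)" if "\<omega> \<in> space law" for \<omega>
    proof -
      have "(\<Sum>x\<in>S. indicator (E x) \<omega> :: real) = real (card {x \<in> S. \<omega> \<in> E x})"
        using S by (simp add: indicator_def sum.If_cases Int_def)
      also have "{x \<in> S. \<omega> \<in> E x} = {x \<in> S. deviates \<Delta> f \<epsilon> r x \<omega>}" using that by (auto simp: E_def)
      finally show ?thesis unfolding X_def deviating_fraction_def deviates_def S_def by simp
    qed
    define T where "T = {\<omega> \<in> space law. \<bar>X r \<omega>\<bar> > c / 2}"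
    have T_eq: "T = {\<omega> \<in> space law. \<bar>(\<Sum>x\<in>S. indicator (E x) \<omega>) / r ^ CARD('n)\<bar> > c / 2}"
      unfolding T_def using X_eq by auto
    have T: "T \<in> sets law" unfolding T_eq using Es by measurable
    have "c * r ^ CARD('n) \<le> (\<Sum>x\<in>S. law.prob (E x))"
      using elim unfolding r_def[symmetric] S_def E_def by simp
    also have "\<dots> = law.expectation (\<lambda>\<omega>. \<Sum>x\<in>S. indicator (E x) \<omega>)"
      using Es S by (subst Bochner_Integration.integral_sum) (auto simp: less_top[symmetric])
    also have "\<dots> \<le> law.expectation (\<lambda>\<omega>. c / 2 * r ^ CARD('n) + A * r ^ CARD('n) * indicator T \<omega>)"
    proof (rule integral_mono)
      show "integrable law (\<lambda>\<omega>. \<Sum>x\<in>S. indicator (E x) \<omega> :: real)"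
        using Es by (intro Bochner_Integration.integrable_sum) (auto simp: less_top[symmetric])
      show "integrable law (\<lambda>\<omega>. c / 2 * r ^ CARD('n) + A * r ^ CARD('n) * indicator T \<omega>)"
        using T by (auto simp: less_top[symmetric])
      fix \<omega> assume \<omega>: "\<omega> \<in> space law"
      have le: "(\<Sum>x\<in>S. indicator (E x) \<omega> :: real) \<le> (\<Sum>x\<in>S. 1)" by (intro sum_mono) (simp add: indicator_def)
      show "(\<Sum>x\<in>S. indicator (E x) \<omega> :: real) \<le> c / 2 * r ^ CARD('n) + A * r ^ CARD('n) * indicator T \<omega>"
      proof (cases "\<omega> \<in> T")
        case True
        have "0 \<le> c / 2 * r ^ CARD('n)" using c rd by simp
        moreover have "(\<Sum>x\<in>S. indicator (E x) \<omega> :: real) \<le> A * r ^ CARD('n)" using le S(2) by simp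
        moreover have T1: "indicator T \<omega> = (1 :: real)" using True by simp
        ultimately show ?thesis unfolding T1 by linarith
      next
        case False
        then have "\<not> c / 2 < \<bar>(\<Sum>x\<in>S. indicator (E x) \<omega>) / r ^ CARD('n)\<bar>"
          using \<omega> unfolding T_eq by blast
        then have "(\<Sum>x\<in>S. indicator (E x) \<omega>) / r ^ CARD('n) \<le> c / 2" by linarith
        then have "(\<Sum>x\<in>S. indicator (E x) \<omega>) \<le> c / 2 * r ^ CARD('n)"
          by (simp only: pos_divide_le_eq[OF rd])
        moreover have "indicator T \<omega> = (0 :: real)" using False by simp
        ultimately show ?thesis by simp
      qed
    qed
    also have "\<dots> = c / 2 * r ^ CARD('n) + A * r ^ CARD('n) * law.prob T"
      using T by (subst Bochner_Integration.integral_add) (auto simp: less_top[symmetric] law.prob_space)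
    finally have "c / 2 * r ^ CARD('n) \<le> (A * law.prob T) * r ^ CARD('n)" by (simp add: algebra_simps)
    then have "c / 2 \<le> A * law.prob T" using rd by (simp only: mult_le_cancel_right_pos)
    then show ?case using ball(3) unfolding P_def T_def[symmetric] r_def[symmetric] by (simp add: field_simps)
  qed
  then have "c / (2 * A) \<le> 0" by (rule tendsto_lowerbound[OF P0]) simp
  moreover have "c / (2 * A) > 0" using c ball(3) by simp
  ultimately show False by simp
qed

end

text \<open>
  One member \<open>\<phi>\<^sub>\<beta>\<close> of the family, with the properties that do not refer to the random graph.
\<close>

locale log_periodic =
  fixes d s \<theta> \<Delta> :: real and f :: "real \<Rightarrow> real"
  assumes s: "d > 0" "d < s" "s < 2 * d"
    and \<theta>_def: "\<theta> = d / s" and \<Delta>_def: "\<Delta> = 1 / log 2 (2 * d / s)"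
    and pos: "\<And>r. r > 1 \<Longrightarrow> f r > 0"
    and period: "\<And>r. r > 1 \<Longrightarrow> f (r powr (s / (2 * d))) = f r"
begin

lemma \<theta>: "1 / 2 < \<theta>" "\<theta> < 1" "1 < 2 * \<theta>"
  using s by (auto simp: \<theta>_def field_simps)

lemma \<Delta>: "\<Delta> > 0" "(2 * \<theta>) powr \<Delta> = 2"
proof -
  have eq: "2 * d / s = 2 * \<theta>" by (simp add: \<theta>_def)
  show "\<Delta> > 0" unfolding \<Delta>_def eq using \<theta> by simp
  have "(2 * \<theta>) powr \<Delta> = (2 powr log 2 (2 * \<theta>)) powr \<Delta>" using \<theta> by simp
  also have "\<dots> = 2"
  proof -
    have "log 2 (2 * \<theta>) > 0" using \<theta> by simp
    then show ?thesis unfolding powr_powr \<Delta>_def eq by simp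
  qed
  finally show "(2 * \<theta>) powr \<Delta> = 2" .
qed

lemma scaling:
  assumes "\<Lambda> > 0"
  shows "f (exp (\<Lambda> * (2 * \<theta>) ^ k)) * ln (exp (\<Lambda> * (2 * \<theta>) ^ k)) powr \<Delta> = f (exp \<Lambda>) * \<Lambda> powr \<Delta> * 2 ^ k"
proof -
  have "f (exp (\<Lambda> * (2 * \<theta>) ^ k)) = f (exp \<Lambda>)"
  proof (induction k)
    case (Suc k)
    have "exp (\<Lambda> * (2 * \<theta>) ^ Suc k) powr (s / (2 * d)) = exp (\<Lambda> * (2 * \<theta>) ^ k)"
      using s by (simp add: powr_def \<theta>_def)
    moreover have "exp (\<Lambda> * (2 * \<theta>) ^ Suc k) > 1" using assms \<theta> by simp
    ultimately show ?case using period Suc by metis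
  qed simp
  moreover have "(\<Lambda> * (2 * \<theta>) ^ k) powr \<Delta> = \<Lambda> powr \<Delta> * 2 ^ k"
  proof -
    have "((2 * \<theta>) ^ k) powr \<Delta> = ((2 * \<theta>) powr \<Delta>) ^ k"
    proof -
      have "((2 * \<theta>) ^ k) powr \<Delta> = ((2 * \<theta>) powr real k) powr \<Delta>" using \<theta> by (subst powr_realpow) auto
      also have "\<dots> = ((2 * \<theta>) powr \<Delta>) powr real k" by (simp only: powr_powr mult.commute)
      also have "\<dots> = ((2 * \<theta>) powr \<Delta>) ^ k" using \<theta> by (subst powr_realpow) auto
      finally show ?thesis .
    qed
    then show ?thesis using assms \<theta> \<Delta> by (simp add: powr_mult)
  qed
  ultimately show ?thesis by simp
qed

end

text \<open>
  Strict concavity of \<open>x\<close> to the power \<open>\<kappa>\<close> at the midpoint of \<open>[1, 2]\<close>, by comparing the slopes on the two halves.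
\<close>

lemma midpoint_powr_less:
  fixes \<kappa> :: real
  assumes "0 < \<kappa>" "\<kappa> < 1"
  shows "(1 + 2 powr \<kappa>) / 2 < (3 / 2) powr \<kappa>"
proof -
  have D: "((\<lambda>x. x powr \<kappa>) has_real_derivative \<kappa> * x powr (\<kappa> - 1)) (at x)" if "x > 0" for x
    using that by (auto intro!: derivative_eq_intros)
  obtain u where u: "1 < u" "u < 3/2" "(3/2) powr \<kappa> - 1 powr \<kappa> = (3/2 - 1) * (\<kappa> * u powr (\<kappa> - 1))"
    using MVT2[of 1 "3/2" "\<lambda>x. x powr \<kappa>" "\<lambda>x. \<kappa> * x powr (\<kappa> - 1)"] D by auto
  obtain v where v: "3/2 < v" "v < 2" "2 powr \<kappa> - (3/2) powr \<kappa> = (2 - 3/2) * (\<kappa> * v powr (\<kappa> - 1))"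
    using MVT2[of "3/2" 2 "\<lambda>x. x powr \<kappa>" "\<lambda>x. \<kappa> * x powr (\<kappa> - 1)"] D by auto
  have "v powr (\<kappa> - 1) < u powr (\<kappa> - 1)" using u v assms by (intro powr_less_mono2_neg) auto
  then have "\<kappa> * v powr (\<kappa> - 1) < \<kappa> * u powr (\<kappa> - 1)" using assms by simp
  then show ?thesis using u v by simp
qed

lemma (in log_periodic) midpoint_defect: "(\<theta> + 1 / 2) powr \<Delta> < 3 / 2"
proof -
  define \<kappa> where "\<kappa> = log 2 (2 * \<theta>)"
  have \<kappa>: "0 < \<kappa>" "\<kappa> < 1" unfolding \<kappa>_def using \<theta> by (auto simp: log_less_one_cancel_iff)
  have "\<Delta> * \<kappa> = 1" using \<kappa> unfolding \<Delta>_def \<kappa>_def \<theta>_def by simp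
  have "2 powr \<kappa> = 2 * \<theta>" unfolding \<kappa>_def using \<theta> by simp
  then have "\<theta> + 1 / 2 < (3 / 2) powr \<kappa>" using midpoint_powr_less[OF \<kappa>] by simp
  then have "(\<theta> + 1 / 2) powr \<Delta> < ((3 / 2) powr \<kappa>) powr \<Delta>"
    using \<theta> \<Delta> by (intro powr_less_mono2) auto
  also have "\<dots> = 3 / 2" using \<open>\<Delta> * \<kappa> = 1\<close> by (simp add: powr_powr mult.commute)
  finally show ?thesis .
qed

lemma (in log_periodic) scale_at_top:
  assumes "\<Lambda> > 0" shows "filterlim (\<lambda>k. exp (\<Lambda> * (2 * \<theta>) ^ k)) at_top sequentially"
proof -
  have "filterlim (\<lambda>k. (2 * \<theta>) ^ k) at_top sequentially"
    using \<theta>(3) by real_asymp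
  then have "filterlim (\<lambda>k. \<Lambda> * (2 * \<theta>) ^ k) at_top sequentially"
    using assms by (intro filterlim_tendsto_pos_mult_at_top[OF tendsto_const])
  then show ?thesis by (rule filterlim_compose[OF exp_at_top])
qed

text \<open>
  Suppose that \<open>f\<close> is too small at \<open>exp \<Lambda>\<close>, hence at all radii \<open>\<rho>\<^sub>k = exp (\<Lambda> (2 \<theta>)\<^sup>k\<^sup>+\<^sup>1)\<close>. Then vertices that do not
  deviate are reached in fewer than \<open>3 \<cdot> 2\<^sup>k\<close> steps. By \<open>expected_ball_at_midpoint\<close> their expected number is at
  most \<open>exp (V (2 \<theta>)\<^sup>k\<^sup>+\<^sup>1)\<close>, where \<open>V < d \<Lambda>\<close> by the choice of \<open>\<Lambda>\<close>, and this is negligible in comparison with the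
  volume.
\<close>

lemma phi_ge:
  fixes N :: "real ^ 'n \<Rightarrow> real" and q :: "int ^ 'n \<Rightarrow> ennreal"
  assumes N: "is_norm N" and s: "real CARD('n) < s" "s < 2 * real CARD('n)" and q: "admissible_kernel N s q"
    and \<delta>: "\<delta> > 0" and \<theta>_def: "\<theta> = real CARD('n) / s"
  shows "\<exists>\<beta>\<^sub>0\<ge>1. \<forall>\<beta>>\<beta>\<^sub>0. \<forall>f \<Delta>. log_periodic (real CARD('n)) s \<theta> \<Delta> f \<longrightarrow>
    tends_to_zero_in_prob (percolation_law q \<beta>) (deviating_fraction N \<Delta> f \<delta>) \<longrightarrow>
    3 / 2 \<le> (1 + \<delta>) * (f (exp ((1 + \<delta>) * (\<theta> + 1 / 2) * ln \<beta> / (2 * real CARD('n) - s)))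
       * ((1 + \<delta>) * (\<theta> + 1 / 2) * ln \<beta> / (2 * real CARD('n) - s)) powr \<Delta>)"
proof -
  define d where "d = real CARD('n)"
  define e where "e = 2 * d - s"
  have d: "d > 0" "s > 0" "e > 0" using s by (auto simp: d_def e_def intro: order.strict_trans1[rotated])
  have \<theta>: "1 / 2 < \<theta>" "\<theta> < 1" using s d by (auto simp: \<theta>_def d_def field_simps)
  have \<theta>_e: "\<theta> / (2 * \<theta> - 1) = d / e" using d by (simp add: \<theta>_def e_def d_def field_simps)
  obtain b A where bA: "0 < b" "0 < A" "\<And>r. r \<ge> 1 \<Longrightarrow> finite (lattice_ball N 0 r)"
    "\<And>r. r \<ge> 1 \<Longrightarrow> b * r ^ CARD('n) \<le> real (card (lattice_ball N 0 r))"
    "\<And>r. r \<ge> 1 \<Longrightarrow> real (card (lattice_ball N 0 r)) \<le> A * r ^ CARD('n)"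
    using lattice_ball_growth[OF N] by metis
  obtain c R \<kappa> where \<kappa>: "\<kappa> \<ge> 1" and laws: "\<forall>\<beta>\<ge>1. (\<forall>u v. nearest_neighbor_of_origin (u - v) \<longrightarrow> pmf (edge_law q \<beta> {u, v}) True = 1)
      \<and> (\<forall>y z. real R \<le> real (sup_norm (y - z)) \<longrightarrow>
            1 - pmf (edge_law q \<beta> {y, z}) True \<le> exp (- (\<beta> * c * real (sup_norm (y - z)) powr - s)))
      \<and> (\<forall>y z. y \<noteq> z \<longrightarrow> pmf (edge_law q \<beta> {y, z}) True \<le> \<kappa> * \<beta> * real (sup_norm (y - z)) powr - s)"
    using edge_law_bounds[OF N d(2) q] by (elim exE conjE)
  obtain G where G: "\<forall>(B :: (int ^ 'n) set \<Rightarrow> bool pmf) J k a. J \<ge> 1 \<longrightarrow>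
    (\<forall>y z. y \<noteq> z \<longrightarrow> pmf (B {y, z}) True \<le> J * real (sup_norm (y - z)) powr - s) \<longrightarrow>
    (\<integral>\<^sup>+x. emeasure (bernoulli_field.law lattice_edges B) (lattice_percolation.reach B (3 * 2 ^ k - 1) a x) \<partial>count_space UNIV)
     \<le> ennreal (exp ((2 * \<theta>) ^ Suc k * (\<theta> * ln J / (2 * \<theta> - 1) * (\<theta> + 1 / 2) + G)))"
    using expected_ball_at_midpoint[OF s \<theta>_def] by (elim exE)
  have "\<forall>\<^sub>F \<beta> in at_top. d / e * (\<theta> + 1 / 2) * ln \<kappa> + G < \<delta> * (\<theta> + 1 / 2) * (d / e) * ln \<beta>"
  proof -
    have "\<delta> * (\<theta> + 1 / 2) * (d / e) > 0" using \<delta> \<theta> d by simp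
    then have "filterlim (\<lambda>\<beta>. \<delta> * (\<theta> + 1 / 2) * (d / e) * ln \<beta>) at_top at_top"
      by (rule filterlim_tendsto_pos_mult_at_top[OF tendsto_const _ ln_at_top])
    then show ?thesis by (auto simp: filterlim_at_top_dense)
  qed
  then obtain \<beta>1 where \<beta>1: "\<And>\<beta>. \<beta> \<ge> \<beta>1 \<Longrightarrow> d / e * (\<theta> + 1 / 2) * ln \<kappa> + G < \<delta> * (\<theta> + 1 / 2) * (d / e) * ln \<beta>"
    unfolding eventually_at_top_linorder by blast
  show ?thesis
  proof (intro exI[of _ "max 1 \<beta>1"] conjI allI impI)
    fix \<beta> f \<Delta>
    assume \<beta>: "\<beta> > max 1 \<beta>1" and lp: "log_periodic (real CARD('n)) s \<theta> \<Delta> f"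
      and tz: "tends_to_zero_in_prob (percolation_law q \<beta>) (deviating_fraction N \<Delta> f \<delta>)"
    interpret log_periodic "real CARD('n)" s \<theta> \<Delta> f by (rule lp)
    interpret lattice_percolation "edge_law q \<beta>" .
    define \<Lambda> where "\<Lambda> = (1 + \<delta>) * (\<theta> + 1 / 2) * ln \<beta> / e"
    have \<Lambda>: "\<Lambda> > 0" unfolding \<Lambda>_def using \<delta> \<theta> \<beta> d by simp
    define V where "V = \<theta> * ln (\<kappa> * \<beta>) / (2 * \<theta> - 1) * (\<theta> + 1 / 2) + G"
    have V: "V < d * \<Lambda>"
    proof -
      have "V = d / e * (\<theta> + 1 / 2) * ln \<kappa> + G + (\<theta> + 1 / 2) * (d / e) * ln \<beta>"
      proof -
        have "\<theta> * ln (\<kappa> * \<beta>) / (2 * \<theta> - 1) = \<theta> / (2 * \<theta> - 1) * (ln \<kappa> + ln \<beta>)"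
          using \<kappa> \<beta> by (simp add: ln_mult)
        then show ?thesis unfolding V_def \<theta>_e by (simp add: algebra_simps)
      qed
      moreover have "d * \<Lambda> = \<delta> * (\<theta> + 1 / 2) * (d / e) * ln \<beta> + (\<theta> + 1 / 2) * (d / e) * ln \<beta>"
        unfolding \<Lambda>_def by (simp add: algebra_simps add_divide_distrib)
      ultimately show ?thesis using \<beta>1[of \<beta>] \<beta> by simp
    qed
    define \<rho> where "\<rho> k = exp (\<Lambda> * (2 * \<theta>) ^ Suc k)" for k
    have \<rho>_top: "filterlim \<rho> at_top sequentially"
      unfolding \<rho>_def using scale_at_top[OF \<Lambda>] by (rule filterlim_compose) (rule filterlim_Suc)
    have \<rho>1: "\<rho> k \<ge> 1" for k unfolding \<rho>_def using \<Lambda> \<theta> by simp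
    have lnp: "f (\<rho> k) * ln (\<rho> k) powr \<Delta> = f (exp \<Lambda>) * \<Lambda> powr \<Delta> * 2 ^ Suc k" for k
      unfolding \<rho>_def by (rule scaling[OF \<Lambda>])
    have fpos: "f (exp \<Lambda>) * \<Lambda> powr \<Delta> > 0" using pos[of "exp \<Lambda>"] \<Lambda> by simp
    have "3 / 2 \<le> (1 + \<delta>) * (f (exp \<Lambda>) * \<Lambda> powr \<Delta>)"
    proof (rule ccontr)
      assume contra: "\<not> ?thesis"
      have dev: "law.prob {\<omega> \<in> space law. deviates \<Delta> f \<delta> (\<rho> k) x \<omega>} \<ge> 1 - law.prob (reach (3 * 2 ^ k - 1) 0 x)" for k x
      proof -
        let ?D = "{\<omega> \<in> space law. deviates \<Delta> f \<delta> (\<rho> k) x \<omega>}"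
        define M where "M = f (\<rho> k) * ln (\<rho> k) powr \<Delta>"
        have M: "M > 0" unfolding M_def lnp using fpos by simp
        have "(1 + \<delta>) * M < 3 / 2 * 2 ^ Suc k"
        proof -
          have "(1 + \<delta>) * M = ((1 + \<delta>) * (f (exp \<Lambda>) * \<Lambda> powr \<Delta>)) * 2 ^ Suc k"
            unfolding M_def lnp by simp
          also have "\<dots> < 3 / 2 * 2 ^ Suc k" using contra by (intro mult_strict_right_mono) auto
          finally show ?thesis .
        qed
        then have small: "(1 + \<delta>) * M < 3 * 2 ^ k" by simp
        have "space law - ?D \<subseteq> reach (3 * 2 ^ k - 1) 0 x"
        proof
          fix \<omega> assume \<omega>: "\<omega> \<in> space law - ?D"
          then have "\<not> \<bar>ereal_of_enat (chemical_dist \<omega> 0 x) / ereal M - 1\<bar> > ereal \<delta>"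
            by (simp add: deviates_def M_def)
          then obtain n where n: "chemical_dist \<omega> 0 x = enat n" "\<bar>real n / M - 1\<bar> \<le> \<delta>"
            unfolding not_deviating_iff[OF M] by blast
          then have "real n \<le> (1 + \<delta>) * M" using M by (simp add: abs_le_iff field_simps)
          then have "real n < real (3 * 2 ^ k)" using small by simp
          then have "n \<le> 3 * 2 ^ k - 1" by (simp only: of_nat_less_iff)
          then show "\<omega> \<in> reach (3 * 2 ^ k - 1) 0 x" using n \<omega> by (simp add: reach_eq_chemical_dist)
        qed
        then have "law.prob (space law - ?D) \<le> law.prob (reach (3 * 2 ^ k - 1) 0 x)"
          by (intro law.finite_measure_mono reach_sets)
        then show ?thesis using law.prob_compl[OF deviates_sets, of \<Delta> f \<delta> "\<rho> k" x] by linarith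
      qed
      have sum_reach: "(\<Sum>x\<in>lattice_ball N 0 (\<rho> k). law.prob (reach (3 * 2 ^ k - 1) 0 x)) \<le> exp ((2 * \<theta>) ^ Suc k * V)" for k
      proof -
        let ?S = "lattice_ball N (0 :: int ^ 'n) (\<rho> k)"
        have fin: "finite ?S" by (rule bA(3)[OF \<rho>1])
        have "ennreal (\<Sum>x\<in>?S. law.prob (reach (3 * 2 ^ k - 1) 0 x)) = (\<Sum>x\<in>?S. emeasure law (reach (3 * 2 ^ k - 1) 0 x))"
          by (simp add: law.emeasure_eq_measure sum_ennreal)
        also have "\<dots> = (\<integral>\<^sup>+x. emeasure law (reach (3 * 2 ^ k - 1) 0 x) \<partial>count_space ?S)"
          using fin by (simp add: nn_integral_count_space_finite)
        also have "\<dots> \<le> (expected_ball (3 * 2 ^ k - 1) 0)"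
          by (simp add: nn_integral_count_space_indicator) (intro nn_integral_mono, auto simp: indicator_def)
        also have "\<dots> \<le> ennreal (exp ((2 * \<theta>) ^ Suc k * V))"
          unfolding V_def
        proof (rule G[rule_format])
          show "1 \<le> \<kappa> * \<beta>" using \<kappa> \<beta> mult_mono[of 1 \<kappa> 1 \<beta>] by simp
          show "pmf (edge_law q \<beta> {y, z}) True \<le> \<kappa> * \<beta> * real (sup_norm (y - z)) powr - s" if "y \<noteq> z" for y z
            using laws \<beta> that by simp
        qed
        finally show ?thesis by (simp add: ennreal_le_iff)
      qed
      have \<rho>d: "\<rho> k ^ CARD('n) = exp ((2 * \<theta>) ^ Suc k * (d * \<Lambda>))" for k
        unfolding \<rho>_def d_def by (simp add: exp_of_nat_mult[symmetric] mult_ac)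
      have "filterlim (\<lambda>k. exp ((d * \<Lambda> - V) * (2 * \<theta>) ^ Suc k)) at_top sequentially"
        using scale_at_top[of "d * \<Lambda> - V"] V by (intro filterlim_compose[OF _ filterlim_Suc]) simp
      then have "\<forall>\<^sub>F k in sequentially. 2 / b \<le> exp ((d * \<Lambda> - V) * (2 * \<theta>) ^ Suc k)"
        unfolding filterlim_at_top by blast
      then have "\<forall>\<^sub>F k in sequentially. b / 2 * \<rho> k ^ CARD('n)
          \<le> (\<Sum>x\<in>lattice_ball N 0 (\<rho> k). law.prob {\<omega> \<in> space law. deviates \<Delta> f \<delta> (\<rho> k) x \<omega>})"
      proof eventually_elim
        case (elim k)
        let ?S = "lattice_ball N (0 :: int ^ 'n) (\<rho> k)"
        have "exp ((2 * \<theta>) ^ Suc k * V) \<le> b / 2 * (exp ((d * \<Lambda> - V) * (2 * \<theta>) ^ Suc k) * exp ((2 * \<theta>) ^ Suc k * V))"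
          using elim bA(1) mult_right_mono[of 1 "b / 2 * exp ((d * \<Lambda> - V) * (2 * \<theta>) ^ Suc k)" "exp ((2 * \<theta>) ^ Suc k * V)"]
          by (simp add: field_simps)
        also have "exp ((d * \<Lambda> - V) * (2 * \<theta>) ^ Suc k) * exp ((2 * \<theta>) ^ Suc k * V) = \<rho> k ^ CARD('n)"
          unfolding \<rho>d by (simp only: exp_add[symmetric]) (simp add: algebra_simps)
        finally have "exp ((2 * \<theta>) ^ Suc k * V) \<le> b / 2 * \<rho> k ^ CARD('n)" .
        moreover have "(\<Sum>x\<in>?S. 1 - law.prob (reach (3 * 2 ^ k - 1) 0 x))
            = real (card ?S) - (\<Sum>x\<in>?S. law.prob (reach (3 * 2 ^ k - 1) 0 x))"
          by (simp add: sum_subtractf)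
        moreover have "(\<Sum>x\<in>?S. 1 - law.prob (reach (3 * 2 ^ k - 1) 0 x))
            \<le> (\<Sum>x\<in>?S. law.prob {\<omega> \<in> space law. deviates \<Delta> f \<delta> (\<rho> k) x \<omega>})"
          by (intro sum_mono dev)
        ultimately show ?case using sum_reach[of k] bA(4)[OF \<rho>1[of k]] by linarith
      qed
      with deviating_fraction_not_tends_to_zero[OF bA(3,5,2) \<rho>_top, of "b / 2" \<Delta> f \<delta>] bA(1) tz
      show False unfolding percolation_law_eq by simp
    qed
    then show "3 / 2 \<le> (1 + \<delta>) * (f (exp ((1 + \<delta>) * (\<theta> + 1 / 2) * ln \<beta> / (2 * real CARD('n) - s)))
       * ((1 + \<delta>) * (\<theta> + 1 / 2) * ln \<beta> / (2 * real CARD('n) - s)) powr \<Delta>)"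
      unfolding \<Lambda>_def e_def d_def .
  qed simp
qed

text \<open>
  The scales are \<open>ln r\<^sub>k = \<Lambda>\<^sub>0 ((2 \<theta>)\<^sup>k - 1) + k / e\<close> with \<open>e = 2 d - s\<close>. Without the linear term
  \<open>s ln r\<^sub>k\<^sub>+\<^sub>1 - 2 d ln r\<^sub>k = e \<Lambda>\<^sub>0\<close> would not depend on \<open>k\<close>, whereas the number of candidate edges has to exceed
  the growing \<open>ln r\<^sub>k\<^sub>+\<^sub>1\<close>; the linear term supplies a factor \<open>exp k\<close>, which suffices. The margin between
  \<open>\<Lambda> = (1 - 2 \<delta>) ln \<beta> / e\<close> and \<open>\<Lambda>\<^sub>0 = (1 - \<delta>) ln \<beta> / e\<close> makes a ball of radius \<open>exp (\<Lambda> (2 \<theta>)\<^sup>k)\<close> in the given norm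
  fit into scale \<open>r\<^sub>k\<close>. Were \<open>f\<close> too large, Markov's inequality would make every vertex
  away from the origin deviate with probability at least \<open>\<delta> / (1 + \<delta>)\<close>.
\<close>

lemma phi_le:
  fixes N :: "real ^ 'n \<Rightarrow> real" and q :: "int ^ 'n \<Rightarrow> ennreal"
  assumes N: "is_norm N" and s: "real CARD('n) < s" "s < 2 * real CARD('n)" and q: "admissible_kernel N s q"
    and \<delta>: "0 < \<delta>" "\<delta> < 1 / 2" and \<theta>_def: "\<theta> = real CARD('n) / s"
  shows "\<exists>\<beta>\<^sub>0\<ge>1. \<forall>\<beta>>\<beta>\<^sub>0. \<forall>f \<Delta>. log_periodic (real CARD('n)) s \<theta> \<Delta> f \<longrightarrow>
    tends_to_zero_in_prob (percolation_law q \<beta>) (deviating_fraction N \<Delta> f (\<delta> / (1 + \<delta>))) \<longrightarrow>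
    f (exp ((1 - 2 * \<delta>) * ln \<beta> / (2 * real CARD('n) - s)))
       * ((1 - 2 * \<delta>) * ln \<beta> / (2 * real CARD('n) - s)) powr \<Delta> \<le> (1 + \<delta>) ^ 3"
proof -
  define d where "d = real CARD('n)"
  define e where "e = 2 * d - s"
  have d: "d > 0" "s > 0" "e > 0" using s by (auto simp: d_def e_def intro: order.strict_trans1[rotated])
  have \<theta>: "1 / 2 < \<theta>" "\<theta> < 1" using s d by (auto simp: \<theta>_def d_def field_simps)
  obtain b A where bA: "0 < b" "0 < A" "\<And>r. r \<ge> 1 \<Longrightarrow> finite (lattice_ball N 0 r)"
    "\<And>r. r \<ge> 1 \<Longrightarrow> b * r ^ CARD('n) \<le> real (card (lattice_ball N 0 r))"
    "\<And>r. r \<ge> 1 \<Longrightarrow> real (card (lattice_ball N 0 r)) \<le> A * r ^ CARD('n)"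
    "\<And>r x. r \<ge> 1 \<Longrightarrow> x \<in> lattice_ball N 0 r \<Longrightarrow> real (sup_norm x) \<le> A * r"
    using lattice_ball_growth[OF N] by metis
  obtain c R \<kappa>0 where c: "c > 0" and R: "R \<ge> (1::nat)" and laws: "\<forall>\<beta>\<ge>1. (\<forall>u v. nearest_neighbor_of_origin (u - v) \<longrightarrow> pmf (edge_law q \<beta> {u, v}) True = 1)
      \<and> (\<forall>y z. real R \<le> real (sup_norm (y - z)) \<longrightarrow>
            1 - pmf (edge_law q \<beta> {y, z}) True \<le> exp (- (\<beta> * c * real (sup_norm (y - z)) powr - s)))
      \<and> (\<forall>y z. y \<noteq> z \<longrightarrow> pmf (edge_law q \<beta> {y, z}) True \<le> \<kappa>0 * \<beta> * real (sup_norm (y - z)) powr - s)"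
    using edge_law_bounds[OF N d(2) q] by (elim exE conjE)
  define \<kappa> where "\<kappa> = 2 powr - s / (2 * real (2 * R) + 1) ^ (2 * CARD('n))"
  have \<kappa>: "\<kappa> > 0" unfolding \<kappa>_def by (intro divide_pos_pos zero_less_power) auto
  define l where "l = \<bar>ln (d / \<delta>)\<bar>"
  define B where "B = 1 / e"
  have "\<forall>\<^sub>F \<beta> in at_top. l + 1 / e \<le> c * \<kappa> / 4 ^ (2 * CARD('n)) * \<beta>"
  proof -
    have "c * \<kappa> / 4 ^ (2 * CARD('n)) > 0" using c \<kappa> by simp
    then have "filterlim (\<lambda>\<beta>. c * \<kappa> / 4 ^ (2 * CARD('n)) * \<beta>) at_top at_top"
      by (rule filterlim_tendsto_pos_mult_at_top[OF tendsto_const _ filterlim_ident])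
    then show ?thesis unfolding filterlim_at_top by blast
  qed
  moreover have "\<forall>\<^sub>F \<beta> in at_top. l + B + 2 / e * ln \<beta> \<le> c * \<kappa> * exp (- (s * B)) * \<beta> powr \<delta>"
  proof -
    have "c * \<kappa> * exp (- (s * B)) > 0" using c \<kappa> by simp
    then show ?thesis using \<delta> by real_asymp
  qed
  ultimately have "\<forall>\<^sub>F \<beta> in at_top. l + 1 / e \<le> c * \<kappa> / 4 ^ (2 * CARD('n)) * \<beta>
      \<and> l + B + 2 / e * ln \<beta> \<le> c * \<kappa> * exp (- (s * B)) * \<beta> powr \<delta>"
    by (rule eventually_conj)
  then obtain \<beta>1 where \<beta>1: "\<And>\<beta>. \<beta> \<ge> \<beta>1 \<Longrightarrow> l + 1 / e \<le> c * \<kappa> / 4 ^ (2 * CARD('n)) * \<beta>"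
     "\<And>\<beta>. \<beta> \<ge> \<beta>1 \<Longrightarrow> l + B + 2 / e * ln \<beta> \<le> c * \<kappa> * exp (- (s * B)) * \<beta> powr \<delta>"
    unfolding eventually_at_top_linorder by blast
  show ?thesis
  proof (intro exI[of _ "max 1 \<beta>1"] conjI allI impI)
    fix \<beta> f \<Delta>
    assume \<beta>: "\<beta> > max 1 \<beta>1" and lp: "log_periodic (real CARD('n)) s \<theta> \<Delta> f"
      and tz: "tends_to_zero_in_prob (percolation_law q \<beta>) (deviating_fraction N \<Delta> f (\<delta> / (1 + \<delta>)))"
    interpret log_periodic "real CARD('n)" s \<theta> \<Delta> f by (rule lp)
    interpret lattice_percolation "edge_law q \<beta>" .
    define \<Lambda>0 where "\<Lambda>0 = (1 - \<delta>) * ln \<beta> / e"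
    define \<Lambda> where "\<Lambda> = (1 - 2 * \<delta>) * ln \<beta> / e"
    have ln\<beta>: "ln \<beta> > 0" using \<beta> by simp
    have \<Lambda>: "\<Lambda> > 0" "\<Lambda> < \<Lambda>0" unfolding \<Lambda>_def \<Lambda>0_def using \<delta> ln\<beta> d
      by (auto intro!: divide_strict_right_mono mult_strict_right_mono)
    define r where "r k = exp (\<Lambda>0 * ((2 * \<theta>) ^ k - 1) + B * real k)" for k :: nat
    have \<theta>k: "(2 * \<theta>) ^ k \<ge> 1" for k using \<theta>(3) by (intro one_le_power) linarith
    have B: "B > 0" using d by (simp add: B_def)
    have r: "r 0 = 1" "r k \<ge> 1" for k
    proof -
      show "r 0 = 1" by (simp add: r_def)
      have "0 \<le> \<Lambda>0 * ((2 * \<theta>) ^ k - 1) + B * real k" using \<theta>k[of k] \<Lambda> B by (intro add_nonneg_nonneg mult_nonneg_nonneg) auto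
      then show "r k \<ge> 1" by (simp add: r_def)
    qed
    have ln_split: "ln (d * x / \<delta>) \<le> l + ln x" if "x \<ge> 1" for x
    proof -
      have "ln (d * x / \<delta>) = ln (d / \<delta>) + ln x"
        using that d \<delta> ln_mult[of "d / \<delta>" x] by simp
      then show ?thesis unfolding l_def by linarith
    qed
    have near: "ln (d * x / \<delta>) \<le> \<beta> * c * \<kappa> * x powr - s * (x / 4) ^ (2 * CARD('n))" if x: "x \<ge> 1" for x
    proof -
      have xe: "x powr - s * (x / 4) ^ (2 * CARD('n)) = x powr e / 4 ^ (2 * CARD('n))"
      proof -
        have "x ^ (2 * CARD('n)) = x powr (2 * d)" using x by (subst powr_realpow[symmetric]) (auto simp: d_def)
        moreover have "x powr - s * x powr (2 * d) = x powr e" by (simp add: powr_add[symmetric] e_def)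
        ultimately show ?thesis by (simp add: power_divide)
      qed
      have x1: "x powr e \<ge> 1" using x d by (simp add: ge_one_powr_ge_zero)
      have "e * ln x = ln (x powr e)" using x by (simp add: ln_powr)
      also have "\<dots> \<le> x powr e - 1" by (rule ln_le_minus_one) (use x1 in linarith)
      finally have "e * ln x \<le> x powr e" by linarith
      then have "ln x \<le> 1 / e * x powr e" using d by (simp add: field_simps)
      moreover have "l * 1 \<le> l * x powr e" using x1 by (intro mult_left_mono) (auto simp: l_def)
      ultimately have "l + ln x \<le> (l + 1 / e) * x powr e" by (simp add: distrib_right)
      also have "\<dots> \<le> (c * \<kappa> / 4 ^ (2 * CARD('n)) * \<beta>) * x powr e"
        using \<beta>1(1)[of \<beta>] \<beta> by (intro mult_right_mono) auto
      also have "\<dots> = \<beta> * c * \<kappa> * (x powr e / 4 ^ (2 * CARD('n)))" by simp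
      also have "\<dots> = \<beta> * c * \<kappa> * x powr - s * (x / 4) ^ (2 * CARD('n))"
        unfolding xe[symmetric] by (simp only: mult.assoc)
      finally show ?thesis using ln_split[OF x] by linarith
    qed
    have scale: "ln (d * x / \<delta>) \<le> \<beta> * c * \<kappa> * x powr - s * r k ^ (2 * CARD('n))" if x: "x \<ge> 1" "x < r (Suc k)" for x k
    proof -
      have ek: "real k + 1 \<le> exp (real k)" using exp_ge_add_one_self[of "real k"] by linarith
      have "(2 * \<theta>) ^ k \<le> exp 1 ^ k"
      proof (rule power_mono)
        show "2 * \<theta> \<le> exp 1" using \<theta> exp_ge_add_one_self[of "1::real"] by linarith
      qed (use \<theta> in simp)
      then have \<theta>e: "(2 * \<theta>) ^ k \<le> exp (real k)" by (simp only: exp_of_nat_mult[symmetric] mult_1_right)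
      have "ln x \<le> ln (r (Suc k))" using x by simp
      also have "\<dots> = \<Lambda>0 * ((2 * \<theta>) ^ Suc k - 1) + B * real (Suc k)" by (simp add: r_def)
      also have "\<dots> \<le> \<Lambda>0 * (2 * exp (real k)) + B * exp (real k)"
      proof (intro add_mono mult_left_mono)
        have "(2 * \<theta>) * (2 * \<theta>) ^ k \<le> 2 * exp (real k)" using \<theta> \<theta>e by (intro mult_mono) auto
        then show "(2 * \<theta>) ^ Suc k - 1 \<le> 2 * exp (real k)" unfolding power_Suc by linarith
      qed (use \<Lambda> B ek in auto)
      finally have "ln x \<le> (2 * \<Lambda>0 + B) * exp (real k)" by (simp add: algebra_simps)
      moreover have "l * 1 \<le> l * exp (real k)" by (intro mult_left_mono) (auto simp: l_def)
      ultimately have "l + ln x \<le> (l + B + 2 * \<Lambda>0) * exp (real k)" by (simp add: algebra_simps)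
      also have "\<dots> \<le> (c * \<kappa> * exp (- (s * B)) * \<beta> powr \<delta>) * exp (real k)"
      proof (rule mult_right_mono)
        have "2 * \<Lambda>0 \<le> 2 / e * ln \<beta>" unfolding \<Lambda>0_def using \<delta> ln\<beta> d by (simp add: field_simps)
        then show "l + B + 2 * \<Lambda>0 \<le> c * \<kappa> * exp (- (s * B)) * \<beta> powr \<delta>"
          using \<beta>1(2)[of \<beta>] \<beta> by linarith
      qed simp
      also have "\<dots> = \<beta> * c * \<kappa> * (r (Suc k) powr - s * r k ^ (2 * CARD('n)))"
      proof -
        have "r (Suc k) powr - s = exp (- s * (\<Lambda>0 * ((2 * \<theta>) ^ Suc k - 1) + B * real (Suc k)))"
          by (simp add: r_def powr_def)
        moreover have "r k ^ (2 * CARD('n)) = exp (2 * d * (\<Lambda>0 * ((2 * \<theta>) ^ k - 1) + B * real k))"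
          by (simp add: r_def exp_of_nat_mult[symmetric] d_def)
        moreover have "- s * (\<Lambda>0 * ((2 * \<theta>) ^ Suc k - 1) + B * real (Suc k)) + 2 * d * (\<Lambda>0 * ((2 * \<theta>) ^ k - 1) + B * real k)
            = - (e * \<Lambda>0) + (e * B) * real k - s * B"
        proof -
          have s\<theta>: "s * (2 * \<theta>) = 2 * d" using d by (simp add: \<theta>_def d_def)
          have "s * (\<Lambda>0 * (2 * \<theta>) ^ Suc k) = (s * (2 * \<theta>)) * (\<Lambda>0 * (2 * \<theta>) ^ k)"
            by (simp only: power_Suc mult_ac)
          then have "s * (\<Lambda>0 * (2 * \<theta>) ^ Suc k) = 2 * d * (\<Lambda>0 * (2 * \<theta>) ^ k)" unfolding s\<theta> .
          moreover have "- s * (\<Lambda>0 * (v - 1) + B * real (Suc k)) + 2 * d * (\<Lambda>0 * (w - 1) + B * real k)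
              = - (e * \<Lambda>0) + (e * B) * real k - s * B" if "s * (\<Lambda>0 * v) = 2 * d * (\<Lambda>0 * w)" for v w
          proof -
            have "- s * (\<Lambda>0 * (v - 1) + B * real (Suc k)) + 2 * d * (\<Lambda>0 * (w - 1) + B * real k)
                = - (e * \<Lambda>0) + (e * B) * real k - s * B + (2 * d * (\<Lambda>0 * w) - s * (\<Lambda>0 * v))"
              unfolding e_def by (simp add: algebra_simps)
            then show ?thesis unfolding that by simp
          qed
          ultimately show ?thesis by blast
        qed
        moreover have "e * B = 1" using d by (simp add: B_def)
        moreover have "e * \<Lambda>0 = (1 - \<delta>) * ln \<beta>" using d by (simp add: \<Lambda>0_def)
        ultimately have "r (Suc k) powr - s * r k ^ (2 * CARD('n)) = exp (- ((1 - \<delta>) * ln \<beta>) + real k - s * B)"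
          by (simp only: exp_add[symmetric] mult_1)
        also have "\<beta> * \<dots> = exp (- (s * B)) * \<beta> powr \<delta> * exp (real k)"
        proof -
          have "\<beta> * exp (- ((1 - \<delta>) * ln \<beta>) + real k - s * B) = exp (ln \<beta>) * exp (- ((1 - \<delta>) * ln \<beta>) + real k - s * B)"
            using \<beta> by simp
          also have "\<dots> = exp (- (s * B)) * exp (\<delta> * ln \<beta>) * exp (real k)"
            unfolding exp_add[symmetric] by (simp add: algebra_simps)
          also have "exp (\<delta> * ln \<beta>) = \<beta> powr \<delta>" using \<beta> by (simp add: powr_def)
          finally show ?thesis .
        qed
        finally have eq: "\<beta> * (r (Suc k) powr - s * r k ^ (2 * CARD('n))) = exp (- (s * B)) * \<beta> powr \<delta> * exp (real k)" .
        have "(c * \<kappa> * exp (- (s * B)) * \<beta> powr \<delta>) * exp (real k)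
            = c * \<kappa> * (exp (- (s * B)) * \<beta> powr \<delta> * exp (real k))" by (simp only: mult.assoc)
        also have "\<dots> = c * \<kappa> * (\<beta> * (r (Suc k) powr - s * r k ^ (2 * CARD('n))))" unfolding eq ..
        also have "\<dots> = \<beta> * c * \<kappa> * (r (Suc k) powr - s * r k ^ (2 * CARD('n)))" by (simp only: mult_ac)
        finally show ?thesis .
      qed
      also have "\<dots> \<le> \<beta> * c * \<kappa> * (x powr - s * r k ^ (2 * CARD('n)))"
        using x d \<beta> c \<kappa> r(2)[of k] by (intro mult_left_mono mult_right_mono powr_mono2') auto
      finally show ?thesis using ln_split[OF x(1)] by (simp add: mult.assoc)
    qed
    have ED: "expected_dist (sup_box 0 (2 * sup_norm x)) 0 x \<le> ennreal ((1 + \<delta>) * (2 ^ k - 1))"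
      if "2 * R \<le> sup_norm x" "real (sup_norm x) < r k" for x k
    proof -
      have "expected_dist (sup_box 0 (2 * sup_norm (x - 0))) 0 x \<le> ennreal ((1 + \<delta>) * (2 ^ k - 1))"
      proof (rule expected_dist_le[where b = "\<beta> * c" and s = s and ?R1.0 = R and \<kappa> = \<kappa> and r = r and \<delta> = \<delta>])
        show "p {u, v} = 1" if "nearest_neighbor_of_origin (u - v)" for u v using laws \<beta> that by simp
        show "1 - p {y, z} \<le> exp (- (\<beta> * c * real (sup_norm (y - z)) powr - s))"
          if "real R \<le> real (sup_norm (y - z))" for y z using laws \<beta> that by simp
        show "\<kappa> = 2 powr - s / (2 * real (2 * R) + 1) ^ (2 * CARD('n))" by (rule \<kappa>_def)
      qed (use r near scale R c \<beta> d \<delta> that in \<open>simp_all add: d_def\<close>)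
      then show ?thesis by simp
    qed
    define \<rho> where "\<rho> k = exp (\<Lambda> * (2 * \<theta>) ^ k)" for k
    have \<rho>_top: "filterlim \<rho> at_top sequentially" unfolding \<rho>_def by (rule scale_at_top[OF \<Lambda>(1)])
    have \<rho>1: "\<rho> k \<ge> 1" for k
      using \<Lambda> \<theta>k[of k] mult_nonneg_nonneg[of \<Lambda> "(2 * \<theta>) ^ k"] unfolding \<rho>_def
      by (simp only: one_le_exp_iff)
    have lnp: "f (\<rho> k) * ln (\<rho> k) powr \<Delta> = f (exp \<Lambda>) * \<Lambda> powr \<Delta> * 2 ^ k" for k
      unfolding \<rho>_def by (rule scaling[OF \<Lambda>(1)])
    have fpos: "f (exp \<Lambda>) * \<Lambda> powr \<Delta> > 0" using pos[of "exp \<Lambda>"] \<Lambda> by simp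
    define \<eta> where "\<eta> = \<delta> / (1 + \<delta>)"
    have \<eta>: "\<eta> > 0" "1 - \<eta> = 1 / (1 + \<delta>)" unfolding \<eta>_def using \<delta> by (auto simp: field_simps)
    have "f (exp \<Lambda>) * \<Lambda> powr \<Delta> \<le> (1 + \<delta>) ^ 3"
    proof (rule ccontr)
      assume contra: "\<not> ?thesis"
      have dev: "law.prob {\<omega> \<in> space law. deviates \<Delta> f \<eta> (\<rho> k) x \<omega>} \<ge> \<eta>"
        if x: "2 * R \<le> sup_norm x" "real (sup_norm x) < r k" for k x
      proof -
        let ?D = "{\<omega> \<in> space law. deviates \<Delta> f \<eta> (\<rho> k) x \<omega>}"
        let ?T = "\<lambda>\<omega>. dist_in (sup_box 0 (2 * sup_norm x)) \<omega> 0 x"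
        define M where "M = f (\<rho> k) * ln (\<rho> k) powr \<Delta>"
        have M: "M > 0" unfolding M_def lnp using fpos by simp
        define t where "t = (1 + \<delta>) ^ 2 * 2 ^ k"
        have t: "t > 0" unfolding t_def using \<delta> by simp
        have "(1 + \<delta>) ^ 3 * 2 ^ k < M" unfolding M_def lnp using contra by (intro mult_strict_right_mono) auto
        then have big: "(1 + \<delta>) * t < M" unfolding t_def by (simp add: power3_eq_cube power2_eq_square mult_ac)
        have sub: "space law - ?D \<subseteq> {\<omega> \<in> space law. 1 \<le> ennreal (1 / t) * ?T \<omega>}"
        proof
          fix \<omega> assume \<omega>: "\<omega> \<in> space law - ?D"
          then have "\<not> \<bar>ereal_of_enat (chemical_dist \<omega> 0 x) / ereal M - 1\<bar> > ereal \<eta>"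
            by (simp add: deviates_def M_def)
          then obtain n where n: "chemical_dist \<omega> 0 x = enat n" "\<bar>real n / M - 1\<bar> \<le> \<eta>"
            unfolding not_deviating_iff[OF M] by blast
          have "1 / (1 + \<delta>) \<le> real n / M" using n(2) \<eta>(2) by linarith
          then have "M \<le> (1 + \<delta>) * real n" using M \<delta> by (simp add: field_simps)
          then have "(1 + \<delta>) * t < (1 + \<delta>) * real n" using big by linarith
          then have tn: "t < real n" using \<delta> by simp
          have "ennreal t \<le> ?T \<omega>"
          proof (cases "?T \<omega> = \<top>")
            case False
            then obtain vs where vs: "connecting_path \<omega> 0 x vs" "?T \<omega> = of_nat (length vs - 1)"
              by (rule dist_in_attained)
            have "chemical_dist \<omega> 0 x \<le> enat (length vs - 1)"
              unfolding chemical_dist_le_iff using vs(1) by (intro exI[of _ vs]) auto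
            then have "n \<le> length vs - 1" using n by simp
            then have "t \<le> real (length vs - 1)" using tn by linarith
            then show ?thesis unfolding vs(2) by (simp add: ennreal_of_nat_eq_real_of_nat ennreal_leI)
          qed simp
          then have "ennreal (1 / t) * ennreal t \<le> ennreal (1 / t) * ?T \<omega>" by (rule mult_left_mono) simp
          moreover have "ennreal (1 / t) * ennreal t = 1" using t by (simp add: ennreal_mult[symmetric])
          ultimately show "\<omega> \<in> {\<omega> \<in> space law. 1 \<le> ennreal (1 / t) * ?T \<omega>}" using \<omega> by simp
        qed
        have Tm: "?T \<in> borel_measurable law" by (rule dist_in_measurable) (auto simp: inner_edges_def)
        then have "emeasure law (space law - ?D) \<le> emeasure law {\<omega> \<in> space law. 1 \<le> ennreal (1 / t) * ?T \<omega>}"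
          by (intro emeasure_mono sub) measurable
        also have "\<dots> \<le> ennreal (1 / t) * (\<integral>\<^sup>+\<omega>. ?T \<omega> * indicator (space law) \<omega> \<partial>law)"
          by (rule nn_integral_Markov_inequality) (use Tm in auto)
        also have "(\<integral>\<^sup>+\<omega>. ?T \<omega> * indicator (space law) \<omega> \<partial>law) = (\<integral>\<^sup>+\<omega>. ?T \<omega> \<partial>law)"
          by (intro nn_integral_cong) simp
        also have "ennreal (1 / t) * \<dots> \<le> ennreal (1 / t) * ennreal ((1 + \<delta>) * 2 ^ k)"
        proof (rule mult_left_mono)
          have "(1 + \<delta>) * (2 ^ k - 1) \<le> (1 + \<delta>) * 2 ^ k" using \<delta> by (intro mult_left_mono) auto
          then show "(\<integral>\<^sup>+\<omega>. ?T \<omega> \<partial>law) \<le> ennreal ((1 + \<delta>) * 2 ^ k)"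
            using ED[OF x] ennreal_leI order.trans by blast
        qed simp
        also have "\<dots> = ennreal (1 / (1 + \<delta>))"
        proof -
          have "1 / t * ((1 + \<delta>) * 2 ^ k) = 1 / (1 + \<delta>)"
            unfolding t_def using \<delta> by (simp add: power2_eq_square)
          then show ?thesis using t \<delta> by (simp add: ennreal_mult[symmetric])
        qed
        finally have "law.prob (space law - ?D) \<le> 1 / (1 + \<delta>)"
          unfolding law.emeasure_eq_measure using \<delta> by (simp add: ennreal_le_iff)
        then show ?thesis using law.prob_compl[OF deviates_sets, of \<Delta> f \<eta> "\<rho> k" x] \<eta>(2) by linarith
      qed
      let ?K = "real (card (sup_box (0 :: int ^ 'n) (2 * R)))"
      have "\<forall>\<^sub>F k in sequentially. A * \<rho> k < r k"
      proof -
        have "\<forall>\<^sub>F k in sequentially. A * exp \<Lambda>0 + 1 \<le> exp ((\<Lambda>0 - \<Lambda>) * (2 * \<theta>) ^ k)"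
          using scale_at_top[of "\<Lambda>0 - \<Lambda>"] \<Lambda> unfolding filterlim_at_top by simp
        then show ?thesis
        proof eventually_elim
          case (elim k)
          then have "A * exp \<Lambda>0 < exp ((\<Lambda>0 - \<Lambda>) * (2 * \<theta>) ^ k)" by linarith
          then have "A * exp \<Lambda>0 * exp (\<Lambda> * (2 * \<theta>) ^ k - \<Lambda>0) < exp ((\<Lambda>0 - \<Lambda>) * (2 * \<theta>) ^ k) * exp (\<Lambda> * (2 * \<theta>) ^ k - \<Lambda>0)"
            by (intro mult_strict_right_mono) auto
          also have "\<dots> = exp (\<Lambda>0 * ((2 * \<theta>) ^ k - 1))" unfolding exp_add[symmetric] by (simp add: algebra_simps)
          also have "\<dots> \<le> r k" unfolding r_def using B by simp
          also have "A * exp \<Lambda>0 * exp (\<Lambda> * (2 * \<theta>) ^ k - \<Lambda>0) = A * \<rho> k"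
            unfolding \<rho>_def mult.assoc exp_add[symmetric] by simp
          finally show ?case .
        qed
      qed
      moreover have "\<forall>\<^sub>F k in sequentially. 2 * ?K / b + 1 \<le> \<rho> k"
        using \<rho>_top unfolding filterlim_at_top by blast
      ultimately have "\<forall>\<^sub>F k in sequentially. \<eta> * b / 2 * \<rho> k ^ CARD('n)
          \<le> (\<Sum>x\<in>lattice_ball N 0 (\<rho> k). law.prob {\<omega> \<in> space law. deviates \<Delta> f \<eta> (\<rho> k) x \<omega>})"
      proof eventually_elim
        case (elim k)
        let ?S = "lattice_ball N (0 :: int ^ 'n) (\<rho> k)" and ?Q = "sup_box (0 :: int ^ 'n) (2 * R)"
        have fin: "finite ?S" by (rule bA(3)[OF \<rho>1])
        have "\<rho> k ^ 1 \<le> \<rho> k ^ CARD('n)" using \<rho>1[of k] by (intro power_increasing) auto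
        then have "2 * ?K / b \<le> \<rho> k ^ CARD('n)" using elim(2) by simp
        then have "?K \<le> b / 2 * \<rho> k ^ CARD('n)" using bA(1) by (simp add: field_simps)
        then have "b / 2 * \<rho> k ^ CARD('n) \<le> real (card ?S) - ?K" using bA(4)[OF \<rho>1[of k]] by linarith
        also have "\<dots> \<le> real (card (?S - ?Q))"
        proof -
          have "card ?S - card ?Q \<le> card (?S - ?Q)" by (rule diff_card_le_card_Diff[OF finite_sup_box])
          then show ?thesis by linarith
        qed
        finally have "\<eta> * (b / 2 * \<rho> k ^ CARD('n)) \<le> \<eta> * real (card (?S - ?Q))"
          using \<eta> by (intro mult_left_mono) auto
        also have "\<dots> = (\<Sum>x\<in>?S - ?Q. \<eta>)" by simp
        also have "\<dots> \<le> (\<Sum>x\<in>?S - ?Q. law.prob {\<omega> \<in> space law. deviates \<Delta> f \<eta> (\<rho> k) x \<omega>})"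
        proof (intro sum_mono dev)
          fix x assume x: "x \<in> ?S - ?Q"
          then show "2 * R \<le> sup_norm x" by (simp add: sup_box_def)
          show "real (sup_norm x) < r k" using bA(6)[OF \<rho>1[of k], of x] x elim(1) by simp
        qed
        also have "\<dots> \<le> (\<Sum>x\<in>?S. law.prob {\<omega> \<in> space law. deviates \<Delta> f \<eta> (\<rho> k) x \<omega>})"
          using fin by (intro sum_mono2) auto
        finally show ?case by simp
      qed
      moreover have "\<eta> * b / 2 > 0" using \<eta> bA by simp
      ultimately show False
        using deviating_fraction_not_tends_to_zero[OF bA(3,5,2) \<rho>_top, of "\<eta> * b / 2" \<Delta> f \<eta>] tz
        unfolding percolation_law_eq \<eta>_def by blast
    qed
    then show "f (exp ((1 - 2 * \<delta>) * ln \<beta> / (2 * real CARD('n) - s)))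
       * ((1 - 2 * \<delta>) * ln \<beta> / (2 * real CARD('n) - s)) powr \<Delta> \<le> (1 + \<delta>) ^ 3"
      unfolding \<Lambda>_def e_def d_def .
  qed simp
qed

section \<open>Non-constancy\<close>

text \<open>
  All losses in \<open>phi_ge\<close>, \<open>phi_le\<close> and in the sandwiching of \<open>\<beta>\<close> tend to zero with \<open>\<delta>\<close>, where the
  inequality becomes \<open>midpoint_defect\<close>.
\<close>

lemma (in log_periodic) slack_exists:
  "\<exists>\<delta>>0. \<delta> < 1 / 4 \<and> (1 + \<delta>) ^ 4 * ((1 + \<delta>) ^ 2 * (\<theta> + 1 / 2)) powr \<Delta> < 3 / 2 * ((1 - 2 * \<delta>) * (1 - \<delta>)) powr \<Delta>"
proof -
  define g where "g \<delta> = 3 / 2 * ((1 - 2 * \<delta>) * (1 - \<delta>)) powr \<Delta> - (1 + \<delta>) ^ 4 * ((1 + \<delta>) ^ 2 * (\<theta> + 1 / 2)) powr \<Delta>" for \<delta> :: real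
  have "(g \<longlongrightarrow> 3 / 2 - (\<theta> + 1 / 2) powr \<Delta>) (at_right 0)"
    unfolding g_def using \<theta> by (auto intro!: tendsto_eq_intros)
  then have "\<forall>\<^sub>F \<delta> in at_right 0. g \<delta> > 0"
    using midpoint_defect by (intro order_tendstoD(1)) auto
  moreover have "\<forall>\<^sub>F \<delta> in at_right (0::real). \<delta> \<in> {0<..<1/4}"
    by (rule eventually_at_right_real) simp
  ultimately have "\<forall>\<^sub>F \<delta> in at_right 0. g \<delta> > 0 \<and> \<delta> \<in> {0<..<1/4}" by (rule eventually_conj)
  then obtain \<delta> where "g \<delta> > 0" "\<delta> \<in> {0<..<1/4}" using eventually_happens'[of "at_right (0::real)"] by auto
  then show ?thesis unfolding g_def by (intro exI[of _ \<delta>]) auto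
qed

lemma co_countable_meets_interval:
  fixes a b :: real
  assumes "countable C" "a < b"
  obtains x where "a < x" "x < b" "x \<notin> C"
proof -
  have "\<not> {a<..<b} \<subseteq> C"
    using assms uncountable_open_interval[of a b] countable_subset by blast
  then obtain x where "x \<in> {a<..<b}" "x \<notin> C" by blast
  then show thesis using that[of x] by simp
qed

theorem corollary1p3:
  fixes N :: "real ^ 'n \<Rightarrow> real"
    and s :: real
    and q :: "int ^ 'n \<Rightarrow> ennreal"
    and \<phi> :: "real \<Rightarrow> real \<Rightarrow> real"
  assumes "is_norm N"
    and "real CARD('n) < s" and "s < 2 * real CARD('n)"
    and "admissible_kernel N s q"
    and "is_phi_family N s q \<phi>"
  shows "\<exists>\<beta>\<^sub>0>0. \<forall>\<beta>>\<beta>\<^sub>0. \<not> (\<phi> \<beta>) constant_on {1<..}"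
proof -
  define d where "d = real CARD('n)"
  define \<Delta> where "\<Delta> = 1 / log 2 (2 * d / s)"
  define \<theta> where "\<theta> = d / s"
  define e where "e = 2 * d - s"
  note phi = assms(5)[unfolded is_phi_family_def Let_def]
  have pos: "\<phi> \<beta> r > 0" if "\<beta> > 0" "r > 1" for \<beta> r using phi that by blast
  have period: "\<phi> \<beta> (r powr (s / (2 * d))) = \<phi> \<beta> r" if "\<beta> > 0" "r > 1" for \<beta> r
    using phi that unfolding d_def by blast
  have anti: "\<phi> b' r \<le> \<phi> b r" if "0 < b" "b \<le> b'" "r > 1" for b b' r
  proof -
    have "antimono_on {0<..} (\<lambda>\<beta>. \<phi> \<beta> r)" using phi that(3) by blast
    from monotone_onD[OF this, of b b'] show ?thesis using that by simp
  qed
  obtain \<Sigma> where \<Sigma>0: "countable \<Sigma>" "\<forall>\<beta> \<in> {0<..} - \<Sigma>. (\<forall>r>1. isCont (\<lambda>b. \<phi> b r) \<beta>) \<and>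
      (\<forall>\<epsilon>>0. tends_to_zero_in_prob (percolation_law q \<beta>) (deviating_fraction N \<Delta> (\<phi> \<beta>) \<epsilon>))"
    using phi[THEN conjunct2, THEN conjunct2, THEN conjunct2, THEN conjunct2, THEN conjunct2]
    unfolding \<Delta>_def d_def by (elim exE conjE)
  have \<Sigma>: "countable \<Sigma>" "\<And>\<beta> \<epsilon>. \<beta> > 0 \<Longrightarrow> \<beta> \<notin> \<Sigma> \<Longrightarrow> \<epsilon> > 0 \<Longrightarrow>
      tends_to_zero_in_prob (percolation_law q \<beta>) (deviating_fraction N \<Delta> (\<phi> \<beta>) \<epsilon>)"
    using \<Sigma>0 by simp_all
  have d0: "d > 0" by (simp add: d_def)
  have e0: "e > 0" using assms by (simp add: e_def d_def)
  have lp: "log_periodic d s \<theta> \<Delta> (\<phi> \<beta>)" if "\<beta> > 0" for \<beta>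
  proof
    show "0 < d" "d < s" "s < 2 * d" using assms d0 by (simp_all add: d_def)
  qed (use pos period that in \<open>simp_all add: \<theta>_def \<Delta>_def\<close>)
  interpret one: log_periodic d s \<theta> \<Delta> "\<phi> 1" by (rule lp) simp
  obtain \<delta> where \<delta>: "0 < \<delta>" "\<delta> < 1 / 4"
    "(1 + \<delta>) ^ 4 * ((1 + \<delta>) ^ 2 * (\<theta> + 1 / 2)) powr \<Delta> < 3 / 2 * ((1 - 2 * \<delta>) * (1 - \<delta>)) powr \<Delta>"
    using one.slack_exists by blast
  have \<delta>2: "\<delta> < 1 / 2" using \<delta> by simp
  have \<theta>d: "\<theta> = real CARD('n) / s" by (simp add: \<theta>_def d_def)
  obtain \<beta>1 where \<beta>1: "\<beta>1 \<ge> 1" "\<forall>\<beta>>\<beta>1. \<forall>f \<Delta>. log_periodic d s \<theta> \<Delta> f \<longrightarrow>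
    tends_to_zero_in_prob (percolation_law q \<beta>) (deviating_fraction N \<Delta> f \<delta>) \<longrightarrow>
    3 / 2 \<le> (1 + \<delta>) * (f (exp ((1 + \<delta>) * (\<theta> + 1 / 2) * ln \<beta> / e)) * ((1 + \<delta>) * (\<theta> + 1 / 2) * ln \<beta> / e) powr \<Delta>)"
    using phi_ge[OF assms(1-4) \<delta>(1) \<theta>d] unfolding e_def d_def by (elim exE conjE)
  obtain \<beta>2 where \<beta>2: "\<beta>2 \<ge> 1" "\<forall>\<beta>>\<beta>2. \<forall>f \<Delta>. log_periodic d s \<theta> \<Delta> f \<longrightarrow>
    tends_to_zero_in_prob (percolation_law q \<beta>) (deviating_fraction N \<Delta> f (\<delta> / (1 + \<delta>))) \<longrightarrow>
    f (exp ((1 - 2 * \<delta>) * ln \<beta> / e)) * ((1 - 2 * \<delta>) * ln \<beta> / e) powr \<Delta> \<le> (1 + \<delta>) ^ 3"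
    using phi_le[OF assms(1-4) \<delta>(1) \<delta>2 \<theta>d] unfolding e_def d_def by (elim exE conjE)
  define \<beta>3 where "\<beta>3 = max \<beta>1 \<beta>2"
  have \<beta>3: "\<beta>3 \<ge> 1" using \<beta>1(1) by (simp add: \<beta>3_def)
  show ?thesis
  proof (intro exI[of _ "\<beta>3 ^ 2"] conjI allI impI notI)
    show "\<beta>3 ^ 2 > 0" using \<beta>3 by simp
    fix \<beta> assume \<beta>: "\<beta> > \<beta>3 ^ 2" and const: "\<phi> \<beta> constant_on {1<..}"
    obtain f0 where f0: "\<And>r. r > 1 \<Longrightarrow> \<phi> \<beta> r = f0" using const unfolding constant_on_def by auto
    have "1 \<le> \<beta>3 ^ 2" using \<beta>3 by simp
    then have \<beta>gt1: "\<beta> > 1" using \<beta> by linarith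
    define L where "L = ln \<beta>"
    have L: "L > 0" using \<beta>gt1 by (simp add: L_def)
    have "\<beta> powr (1 - \<delta>) < \<beta> powr 1" using \<beta>gt1 \<delta> by (intro powr_less_mono) auto
    then have "\<beta> powr (1 - \<delta>) < \<beta>" using \<beta>gt1 by simp
    then obtain b where b: "\<beta> powr (1 - \<delta>) < b" "b < \<beta>" "b \<notin> \<Sigma>"
      by (rule co_countable_meets_interval[OF \<Sigma>(1)])
    have "\<beta> powr 1 < \<beta> powr (1 + \<delta>)" using \<beta>gt1 \<delta> by (intro powr_less_mono) auto
    then have "\<beta> < \<beta> powr (1 + \<delta>)" using \<beta>gt1 by simp
    then obtain b' where b': "\<beta> < b'" "b' < \<beta> powr (1 + \<delta>)" "b' \<notin> \<Sigma>"
      by (rule co_countable_meets_interval[OF \<Sigma>(1)])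
    have b_gt: "b > \<beta>3"
    proof -
      have "\<beta>3 = (\<beta>3 ^ 2) powr (1 / 2)" using \<beta>3 by (simp add: powr_half_sqrt)
      also have "\<dots> \<le> \<beta> powr (1 / 2)" using \<beta> \<beta>3 by (intro powr_mono2) auto
      also have "\<dots> \<le> \<beta> powr (1 - \<delta>)" using \<beta>gt1 \<delta> by (intro powr_mono) auto
      finally show ?thesis using b by linarith
    qed
    have lnb: "ln b \<ge> (1 - \<delta>) * L"
    proof -
      have "(1 - \<delta>) * L = ln (\<beta> powr (1 - \<delta>))" using \<beta>gt1 by (simp add: L_def ln_powr)
      also have "\<dots> \<le> ln b" using b \<beta>gt1 by (intro ln_mono) auto
      finally show ?thesis .
    qed
    have lnb': "ln b' \<le> (1 + \<delta>) * L"
    proof -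
      have "ln b' \<le> ln (\<beta> powr (1 + \<delta>))" using b' \<beta>gt1 by (intro ln_mono) auto
      also have "\<dots> = (1 + \<delta>) * L" using \<beta>gt1 by (simp add: L_def ln_powr)
      finally show ?thesis .
    qed
    have bpos: "b > 0" "b' > 0" using b_gt \<beta>3 b' \<beta>gt1 by auto
    have "b' > \<beta>3" using b_gt b(2) b'(1) by linarith
    define \<Lambda>1 where "\<Lambda>1 = (1 - 2 * \<delta>) * ln b / e"
    define \<Lambda>2 where "\<Lambda>2 = (1 + \<delta>) * (\<theta> + 1 / 2) * ln b' / e"
    define x1 where "x1 = (1 - 2 * \<delta>) * (1 - \<delta>)"
    define x2 where "x2 = (1 + \<delta>) ^ 2 * (\<theta> + 1 / 2)"
    define u where "u = L / e"
    have u: "u > 0" using L e0 by (simp add: u_def)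
    have x: "x1 > 0" "x2 > 0" using \<delta> one.\<theta> by (simp_all add: x1_def x2_def)
    have \<Lambda>1: "x1 * u \<le> \<Lambda>1"
    proof -
      have "(1 - 2 * \<delta>) * ((1 - \<delta>) * L) / e \<le> \<Lambda>1"
        unfolding \<Lambda>1_def using lnb \<delta> e0 by (intro divide_right_mono mult_left_mono) auto
      then show ?thesis by (simp add: x1_def u_def mult.assoc)
    qed
    have \<Lambda>2: "0 < \<Lambda>2" "\<Lambda>2 \<le> x2 * u"
    proof -
      have "ln b' > 0" using b' \<beta>gt1 by simp
      then show "0 < \<Lambda>2" unfolding \<Lambda>2_def using \<delta> one.\<theta> e0 by simp
      have "\<Lambda>2 \<le> (1 + \<delta>) * (\<theta> + 1 / 2) * ((1 + \<delta>) * L) / e"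
        unfolding \<Lambda>2_def using lnb' \<delta> one.\<theta> e0 by (intro divide_right_mono mult_left_mono) auto
      then show "\<Lambda>2 \<le> x2 * u" by (simp add: x2_def u_def power2_eq_square mult_ac)
    qed
    have "0 < x1 * u" using x u by simp
    then have \<Lambda>1pos: "\<Lambda>1 > 0" using \<Lambda>1 by linarith
    have f0pos: "f0 > 0" using f0[of 2] pos[of \<beta> 2] \<beta>gt1 by simp
    have upper: "f0 * (x1 * u) powr \<Delta> \<le> (1 + \<delta>) ^ 3"
    proof -
      have "tends_to_zero_in_prob (percolation_law q b) (deviating_fraction N \<Delta> (\<phi> b) (\<delta> / (1 + \<delta>)))"
        using \<Sigma>(2)[of b "\<delta> / (1 + \<delta>)"] bpos b(3) \<delta> by simp
      then have "\<phi> b (exp \<Lambda>1) * \<Lambda>1 powr \<Delta> \<le> (1 + \<delta>) ^ 3"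
        unfolding \<Lambda>1_def using \<beta>2(2)[rule_format, OF _ lp[OF bpos(1)]] b_gt by (simp add: \<beta>3_def)
      moreover have "f0 \<le> \<phi> b (exp \<Lambda>1)"
        using f0[of "exp \<Lambda>1"] anti[of b \<beta> "exp \<Lambda>1"] \<Lambda>1pos bpos b by simp
      moreover have "(x1 * u) powr \<Delta> \<le> \<Lambda>1 powr \<Delta>"
        using \<Lambda>1 \<open>0 < x1 * u\<close> one.\<Delta> by (intro powr_mono2) auto
      ultimately show ?thesis
        using mult_mono[of f0 "\<phi> b (exp \<Lambda>1)" "(x1 * u) powr \<Delta>" "\<Lambda>1 powr \<Delta>"] f0pos by simp
    qed
    have lower: "3 / 2 \<le> (1 + \<delta>) * (f0 * (x2 * u) powr \<Delta>)"
    proof -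
      have "tends_to_zero_in_prob (percolation_law q b') (deviating_fraction N \<Delta> (\<phi> b') \<delta>)"
        using \<Sigma>(2)[of b' \<delta>] bpos b'(3) \<delta> by simp
      then have "3 / 2 \<le> (1 + \<delta>) * (\<phi> b' (exp \<Lambda>2) * \<Lambda>2 powr \<Delta>)"
        unfolding \<Lambda>2_def using \<beta>1(2)[rule_format, OF _ lp[OF bpos(2)]] \<open>b' > \<beta>3\<close> by (simp add: \<beta>3_def)
      also have "\<dots> \<le> (1 + \<delta>) * (f0 * (x2 * u) powr \<Delta>)"
      proof (intro mult_left_mono mult_mono)
        show "\<phi> b' (exp \<Lambda>2) \<le> f0"
          using f0[of "exp \<Lambda>2"] anti[of \<beta> b' "exp \<Lambda>2"] \<Lambda>2 \<beta>gt1 b' by simp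
        show "\<Lambda>2 powr \<Delta> \<le> (x2 * u) powr \<Delta>" using \<Lambda>2 one.\<Delta> by (intro powr_mono2) auto
      qed (use f0pos \<delta> in auto)
      finally show ?thesis .
    qed
    \<comment> \<open>The unknown constant \<open>f0\<close> and the scale \<open>u = ln \<beta> / e\<close> cancel.\<close>
    have "3 / 2 * x1 powr \<Delta> \<le> (1 + \<delta>) * (f0 * (x2 * u) powr \<Delta>) * x1 powr \<Delta>"
      using lower by (intro mult_right_mono) auto
    also have "\<dots> = (1 + \<delta>) * x2 powr \<Delta> * (f0 * (x1 * u) powr \<Delta>)"
      using x u by (simp add: powr_mult)
    also have "\<dots> \<le> (1 + \<delta>) * x2 powr \<Delta> * (1 + \<delta>) ^ 3"
      using upper \<delta> by (intro mult_left_mono) auto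
    also have "\<dots> = (1 + \<delta>) ^ 4 * x2 powr \<Delta>" by (simp add: power_numeral_reduce)
    finally show False using \<delta>(3) unfolding x1_def x2_def by linarith
  qed
qed

end
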